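(* Let $h>0$, $\tau>0$, $x_0\in\mathbb{R}^d$, and let $(u_n)$ be a real sequence such that $n\,\mu(B_n)\to\tau$, where $B_n:=B(x_0,e^{-u_n})$. Then for every integer $k\ge0$, $$\lim_{n\to\infty}\mathbb{P}\otimes\mu\left(\sum_{i=0}^{\lfloor \tau/\mu(B_n)\rfloor}1_{B_n}\big(X^x_{ih}\big)=k\right)=\frac{e^{-\tau}\tau^k}{k!}.$$
   Context: Consider on $\mathbb{R}^d$ the stochastic differential equation $dX_t=b(X_t)\,dt+dW_t$, $X_0=x$, where $W$ is a standard $d$-dimensional Brownian motion on a probability space $(\Omega,\mathcal{F},\mathbb{P})$ and $b:\mathbb{R}^d\to\mathbb{R}^d$ satisfies: (H) there is $K$ with $|b(x)-b(y)|\le K|x-y|$ for all $x,y$; (AD) there are constants $R_1\in\mathbb{R}$, $R_2>0$ with $\langle b(x),x\rangle\le R_1-R_2\|x\|^2$ for all $x$. $X^x_t$ denotes the solution started at $x$. Under these assumptions the process has a unique invariant probability measure $\mu$, absolutely continuous with respect to Lebesgue measure. $\mathbb{P}\otimes\mu$ is the product measure on $\Omega\times\mathbb{R}^d$ (initial condition $x$ distributed by $\mu$, independent of the noise). $B(x_0,r)$ is the open Euclidean ball and $1_{B}$ the indicator function. *)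

theory Defs
  imports "HOL-Probability.Probability"
begin

definition gauss_density :: "real \<Rightarrow> 'v::euclidean_space \<Rightarrow> ennreal" where
  "gauss_density s y =
     ennreal ((2 * pi * s) powr (- real DIM('v) / 2) * exp (- (norm y)\<^sup>2 / (2 * s)))"

definition brownian_motion :: "'a measure \<Rightarrow> (real \<Rightarrow> 'a \<Rightarrow> 'v::euclidean_space) \<Rightarrow> bool" where
  "brownian_motion P W \<longleftrightarrow>
     prob_space P \<and>
     (\<forall>t\<ge>0. W t \<in> borel_measurable P) \<and>
     (\<forall>\<omega>\<in>space P. W 0 \<omega> = 0 \<and> continuous_on {0..} (\<lambda>t. W t \<omega>)) \<and>
     (\<forall>s t. 0 \<le> s \<and> s < t \<longrightarrow>
        distributed P lborel (\<lambda>\<omega>. W t \<omega> - W s \<omega>) (gauss_density (t - s))) \<and>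
     (\<forall>(n::nat) (ts::nat \<Rightarrow> real). 0 \<le> ts 0 \<and> (\<forall>i<n. ts i < ts (Suc i)) \<longrightarrow>
        prob_space.indep_vars P (\<lambda>_. borel) (\<lambda>i \<omega>. W (ts (Suc i)) \<omega> - W (ts i) \<omega>) {..<n})"

text \<open>X is a (pathwise, continuous) solution of dX_t = b(X_t) dt + dW_t, X_0 = x.
  Since the noise is additive this is the integral equation
  X_t = x + \<integral>_0^t b(X_s) ds + W_t.\<close>
definition sde_solution ::
  "'a measure \<Rightarrow> ('v::euclidean_space \<Rightarrow> 'v) \<Rightarrow> (real \<Rightarrow> 'a \<Rightarrow> 'v) \<Rightarrow> 'v \<Rightarrow> (real \<Rightarrow> 'a \<Rightarrow> 'v) \<Rightarrow> bool"
where
  "sde_solution P b W x X \<longleftrightarrow>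
     (\<forall>\<omega>\<in>space P. continuous_on {0..} (\<lambda>t. X t \<omega>) \<and>
        (\<forall>t\<ge>0. X t \<omega> = x + integral {0..t} (\<lambda>s. b (X s \<omega>)) + W t \<omega>))"

definition invariant_measure ::
  "'a measure \<Rightarrow> ('v::euclidean_space \<Rightarrow> real \<Rightarrow> 'a \<Rightarrow> 'v) \<Rightarrow> 'v measure \<Rightarrow> bool" where
  "invariant_measure P X \<mu> \<longleftrightarrow>
     prob_space \<mu> \<and> sets \<mu> = sets borel \<and>
     (\<forall>t\<ge>0. distr (P \<Otimes>\<^sub>M \<mu>) borel (\<lambda>(\<omega>, x). X x t \<omega>) = \<mu>)"

end

theory Submission
  imports Defs
begin

text \<open>
  Since the noise is additive, \<open>X\<close> is a pathwise limit of Euler schemes driven by independent Gaussian increments.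
  Such increments are, in law, those of a bridge plus \<open>w / N\<close> with an independent Gaussian \<open>w\<close>; for a
  fixed bridge and a short time step the endpoint of the scheme, as a function of \<open>w\<close>, is the identity
  plus a contraction, hence bi-Lipschitz. This replaces Girsanov's theorem: it bounds the transition probabilities of balls from
  above by a multiple of Lebesgue measure, uniformly in the starting point, and from below locally uniformly. Together
  with the Lyapunov function \<open>norm x ^ 2\<close> the lower bound gives Harris mixing of the skeleton \<open>X (i h)\<close>.

  The Poisson limit is Stein's method with test functions \<open>indicator {k}\<close>: if \<open>S\<close> counts the visits, then
  \<open>k * P (S = k)\<close> is the sum over \<open>i\<close> of \<open>P (X (i h) \<in> B n, S = k)\<close>. Discarding a window of times around \<open>i\<close> costs
  little by the upper density bound, and mixing then decouples the visit at time \<open>i\<close> from the rest, so that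
  \<open>k * P (S = k) - \<tau> * P (S = k - 1)\<close> tends to \<open>0\<close>. Tightness of \<open>S\<close> fixes \<open>P (S = 0)\<close>.
\<close>

section \<open>Gaussian measures\<close>

text \<open>The upper kernel bound is a multiple of Lebesgue measure, but the recursion needs a
  multiple of \<open>measure \<mu> B\<close>, since a further visit must cost a factor comparable to
  the visit probability itself. Invariance converts one into the other: integrating the lower kernel
  bound over a ball of \<open>\<mu>\<close>-mass at least 1/2 bounds \<open>measure \<mu> B\<close>
  from below by a multiple of the Lebesgue measure of \<open>B\<close>. No rate of mixing enters.
  The half-width \<open>s\<close> of the discarded window is chosen so that the mixing error is
  small and stays fixed while \<open>n\<close> grows; the window then costs a multiple of
  \<open>s * measure \<mu> B\<close>, which vanishes. The mixing error itself must be proportional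
  to \<open>measure \<mu> B\<close>, because it is incurred about
  \<open>\<tau> / measure \<mu> B\<close> times. Conditional expectations are avoided: the Markov
  property is an identity of integrals over events of the past. It is derived from continuous test
  functions, for which the Euler schemes can be passed to the limit.\<close>

definition gauss :: "real \<Rightarrow> 'v::euclidean_space measure" where
  "gauss s = density lborel (gauss_density s)"

lemma gauss_density_measurable [measurable]: "gauss_density s \<in> borel_measurable borel"
  unfolding gauss_density_def by measurable

lemma sets_gauss [simp, measurable_cong]: "sets (gauss s) = sets borel"
  by (simp add: gauss_def)

lemma space_gauss [simp]: "space (gauss s) = UNIV"
  by (simp add: gauss_def)

lemma nn_integral_gauss:
  "f \<in> borel_measurable borel \<Longrightarrow>
    (\<integral>\<^sup>+ y. f y \<partial>gauss s) = (\<integral>\<^sup>+ y. gauss_density s y * f y \<partial>lborel)"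
  unfolding gauss_def by (subst nn_integral_density) auto

lemma norm_square_eq_sum_Basis: "(norm (y::'v::euclidean_space))\<^sup>2 = (\<Sum>b\<in>Basis. (y \<bullet> b)\<^sup>2)"
  unfolding power2_norm_eq_inner by (subst euclidean_inner) (simp add: power2_eq_square)

lemma gauss_density_eq_prod:
  assumes "s > 0"
  shows "gauss_density s (y::'v::euclidean_space) =
    (\<Prod>b\<in>Basis. ennreal (normal_density 0 (sqrt s) (y \<bullet> b)))"
proof -
  have "(2 * pi * s) powr (- real DIM('v) / 2) = (1 / sqrt (2 * pi * s)) ^ DIM('v)"
    using assms by (simp add: powr_half_sqrt[symmetric] powr_minus_divide[symmetric] powr_powr
        powr_realpow[symmetric] del: powr_realpow)
  moreover have "exp (- (norm y)\<^sup>2 / (2 * s)) = (\<Prod>b\<in>Basis. exp (- (y \<bullet> b)\<^sup>2 / (2 * s)))"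
    by (simp add: norm_square_eq_sum_Basis exp_sum[symmetric] sum_negf sum_divide_distrib)
  ultimately show ?thesis
    using assms
    by (simp add: gauss_density_def normal_density_def prod_ennreal prod.distrib prod_constant
        real_sqrt_mult power_divide prod_dividef)
qed

lemma prob_space_gauss:
  assumes "s > 0" shows "prob_space (gauss s :: 'v::euclidean_space measure)"
proof
  have 1: "(\<integral>\<^sup>+ x. ennreal (normal_density 0 (sqrt s) x) \<partial>lborel) = 1"
    using prob_space.emeasure_space_1[OF prob_space_normal_density[of "sqrt s" 0]] assms
    by (simp add: emeasure_density)
  have "emeasure (gauss s) (space (gauss s :: 'v measure)) = (\<integral>\<^sup>+ y. gauss_density s (y::'v) \<partial>lborel)"
    unfolding gauss_def by (simp add: emeasure_density)
  also have "\<dots> = (\<integral>\<^sup>+ y. (\<Prod>b\<in>Basis. ennreal (normal_density 0 (sqrt s) ((y::'v) \<bullet> b))) \<partial>lborel)"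
    by (simp add: gauss_density_eq_prod[OF assms])
  also have "\<dots> = 1"
    by (subst nn_integral_lborel_prod) (auto simp: 1)
  finally show "emeasure (gauss s) (space (gauss s :: 'v measure)) = 1" .
qed

lemma nn_integral_lborel_translate:
  fixes f :: "'v::euclidean_space \<Rightarrow> ennreal"
  assumes [measurable]: "f \<in> borel_measurable borel"
  shows "(\<integral>\<^sup>+ y. f (c + y) \<partial>lborel) = (\<integral>\<^sup>+ y. f y \<partial>lborel)"
proof -
  have "(\<integral>\<^sup>+ y. f y \<partial>lborel) = (\<integral>\<^sup>+ y. f y \<partial>distr lborel borel ((+) c))"
    by (simp add: lborel_distr_plus)
  then show ?thesis by (simp add: nn_integral_distr)
qed

lemma nn_integral_lborel_uminus:
  fixes f :: "'v::euclidean_space \<Rightarrow> ennreal"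
  assumes [measurable]: "f \<in> borel_measurable borel"
  shows "(\<integral>\<^sup>+ y. f (- y) \<partial>lborel) = (\<integral>\<^sup>+ y. f y \<partial>lborel)"
proof -
  have *: "(lborel :: 'v measure) = density (distr lborel borel (\<lambda>x. 0 + (-1) *\<^sub>R x)) (\<lambda>_. \<bar>-1::real\<bar> ^ DIM('v))"
    by (rule lborel_affine) simp
  have "(\<integral>\<^sup>+ y. f y \<partial>lborel) = (\<integral>\<^sup>+ y. f y \<partial>density (distr lborel borel (\<lambda>x. 0 + (-1) *\<^sub>R x)) (\<lambda>_. \<bar>-1::real\<bar> ^ DIM('v)))"
    by (subst * ) (rule refl)
  also have "\<dots> = (\<integral>\<^sup>+ y. f (- y) \<partial>lborel)"
    by (simp add: nn_integral_density nn_integral_distr)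
  finally show ?thesis ..
qed

text \<open>For independent Gaussian increments of variances \<open>s\<close> and \<open>t\<close>
  with sum \<open>y\<close>, the first has conditional mean \<open>a *\<^sub>R y\<close>. Completing
  the square around it makes the terms mixing \<open>v\<close> and \<open>y\<close> cancel, so the
  joint density is the density of the sum times a density of the deviation \<open>v\<close>. This is
  the independence of a Brownian bridge and its endpoint.\<close>

lemma gauss_density_mult:
  assumes s: "s > 0" and t: "t > 0"
  defines "a \<equiv> s / (s + t)"
  shows "gauss_density s (v + a *\<^sub>R y) * gauss_density t ((1 - a) *\<^sub>R y - v) =
    gauss_density (s + t) y * gauss_density (s * t / (s + t)) (v :: 'v::euclidean_space)"
proof -
  have st: "s + t > 0" "1 - a = t / (s + t)" using s t by (auto simp: a_def field_simps)
  have e: "(norm (v + a *\<^sub>R y))\<^sup>2 / (2 * s) + (norm ((1 - a) *\<^sub>R y - v))\<^sup>2 / (2 * t)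
      = (norm y)\<^sup>2 / (2 * (s + t)) + (norm v)\<^sup>2 / (2 * (s * t / (s + t)))"
  proof -
    define A B D where "A = v \<bullet> v" "B = v \<bullet> y" "D = y \<bullet> y"
    have 1: "(norm (v + a *\<^sub>R y))\<^sup>2 = A + 2 * a * B + a\<^sup>2 * D"
      unfolding power2_norm_eq_inner A_B_D_def by (simp add: inner_add_left inner_add_right inner_commute power2_eq_square algebra_simps)
    have 2: "(norm ((1 - a) *\<^sub>R y - v))\<^sup>2 = A - 2 * (1 - a) * B + (1 - a)\<^sup>2 * D"
      unfolding power2_norm_eq_inner A_B_D_def by (simp add: inner_diff_left inner_diff_right inner_commute power2_eq_square algebra_simps)
    have 3: "(norm v)\<^sup>2 = A" "(norm y)\<^sup>2 = D" by (simp_all add: power2_norm_eq_inner A_B_D_def)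
    have c: "(2 * a * B) / (2 * s) = (2 * (1 - a) * B) / (2 * t)"
    proof -
      have "(2 * a * B) / (2 * s) = B / (s + t)" unfolding a_def using s by simp
      moreover have "(2 * (1 - a) * B) / (2 * t) = B / (s + t)" unfolding st(2) using t by simp
      ultimately show ?thesis by simp
    qed
    have d: "a\<^sup>2 * D / (2 * s) + (1 - a)\<^sup>2 * D / (2 * t) = D / (2 * (s + t))"
    proof -
      have g: "(x / q)\<^sup>2 * D / (2 * x) = D / 2 * (x / q^2)" if "x > 0" for x q :: real
        using that by (simp add: power_divide power2_eq_square mult_ac)
      have "a\<^sup>2 * D / (2 * s) = D / 2 * (s / (s+t)^2)"
        unfolding a_def using g[OF s] .
      moreover have "(1 - a)\<^sup>2 * D / (2 * t) = D / 2 * (t / (s+t)^2)"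
        unfolding st(2) using g[OF t] .
      ultimately have "a\<^sup>2 * D / (2 * s) + (1 - a)\<^sup>2 * D / (2 * t) = D / 2 * (s / (s+t)^2 + t / (s+t)^2)"
        by (simp add: distrib_left)
      also have "s / (s+t)^2 + t / (s+t)^2 = 1 / (s + t)"
        using st by (simp add: add_divide_distrib[symmetric] power2_eq_square)
      finally show ?thesis by simp
    qed
    have f: "A / (2 * s) + A / (2 * t) = A / (2 * (s * t / (s + t)))"
      using s t by (simp add: field_simps)
    show ?thesis unfolding 1 2 3 using c d f by (simp add: add_divide_distrib diff_divide_distrib)
  qed
  have p: "(2 * pi * s) powr r * (2 * pi * t) powr r
      = (2 * pi * (s + t)) powr r * (2 * pi * (s * t / (s + t))) powr r" for r
  proof -
    have "(2 * pi * s) * (2 * pi * t) = (2 * pi * (s + t)) * (2 * pi * (s * t / (s + t)))"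
      using st by simp
    then show ?thesis using s t by (simp only: powr_mult[symmetric])
  qed
  have "exp (- (norm (v + a *\<^sub>R y))\<^sup>2 / (2 * s)) * exp (- (norm ((1 - a) *\<^sub>R y - v))\<^sup>2 / (2 * t))
      = exp (- (norm y)\<^sup>2 / (2 * (s + t))) * exp (- (norm v)\<^sup>2 / (2 * (s * t / (s + t))))"
    using e by (simp add: exp_add[symmetric] del: times_divide_eq_right)
  then show ?thesis
    unfolding gauss_density_def
    using p[of "- real DIM('v) / 2"]
    by (simp add: ennreal_mult[symmetric] mult_ac)
qed

text \<open>The two increments are expressed by their sum \<open>y\<close> and the bridge deviation
  \<open>v\<close>, which are independent. Both substitutions are translations, so no Jacobian
  appears.\<close>

lemma nn_integral_gauss_split:
  fixes F :: "'v::euclidean_space \<Rightarrow> 'v \<Rightarrow> ennreal"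
  assumes s: "s > 0" and t: "t > 0"
    and F [measurable]: "(\<lambda>(w, y). F w y) \<in> borel_measurable (borel \<Otimes>\<^sub>M borel)"
  defines "a \<equiv> s / (s + t)"
  shows "(\<integral>\<^sup>+ w. \<integral>\<^sup>+ y. F w y \<partial>gauss t \<partial>gauss s) =
    (\<integral>\<^sup>+ y. \<integral>\<^sup>+ v. F (a *\<^sub>R y + v) ((1 - a) *\<^sub>R y - v) \<partial>gauss (s * t / (s + t)) \<partial>gauss (s + t))"
proof -
  have "(\<integral>\<^sup>+ w. \<integral>\<^sup>+ y. F w y \<partial>gauss t \<partial>gauss s)
      = (\<integral>\<^sup>+ w. \<integral>\<^sup>+ y. gauss_density s w * (gauss_density t y * F w y) \<partial>lborel \<partial>lborel)"
    by (simp add: nn_integral_gauss nn_integral_cmult)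
  also have "\<dots> = (\<integral>\<^sup>+ w. \<integral>\<^sup>+ y. gauss_density s w * (gauss_density t (- w + y) * F w (- w + y)) \<partial>lborel \<partial>lborel)"
    by (intro nn_integral_cong nn_integral_lborel_translate[symmetric]) simp
  also have "\<dots> = (\<integral>\<^sup>+ y. \<integral>\<^sup>+ w. gauss_density s w * (gauss_density t (- w + y) * F w (- w + y)) \<partial>lborel \<partial>lborel)"
    by (rule lborel_pair.Fubini') simp
  \<comment> \<open>For a fixed sum, the first increment is recentred at its conditional
    mean.\<close>
  also have "\<dots> = (\<integral>\<^sup>+ y. \<integral>\<^sup>+ v. gauss_density s (a *\<^sub>R y + v) * (gauss_density t (- (a *\<^sub>R y + v) + y) * F (a *\<^sub>R y + v) (- (a *\<^sub>R y + v) + y)) \<partial>lborel \<partial>lborel)"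
    by (intro nn_integral_cong nn_integral_lborel_translate[symmetric, where f="\<lambda>w. gauss_density s w * (gauss_density t (- w + _) * F w (- w + _))"]) simp
  also have "\<dots> = (\<integral>\<^sup>+ y. \<integral>\<^sup>+ v. gauss_density (s + t) y * (gauss_density (s * t / (s + t)) v * F (a *\<^sub>R y + v) ((1 - a) *\<^sub>R y - v)) \<partial>lborel \<partial>lborel)"
  proof (intro nn_integral_cong)
    fix y v :: 'v
    have 1: "- (a *\<^sub>R y + v) + y = (1 - a) *\<^sub>R y - v" by (simp add: algebra_simps)
    show "gauss_density s (a *\<^sub>R y + v) * (gauss_density t (- (a *\<^sub>R y + v) + y) * F (a *\<^sub>R y + v) (- (a *\<^sub>R y + v) + y))
       = gauss_density (s + t) y * (gauss_density (s * t / (s + t)) v * F (a *\<^sub>R y + v) ((1 - a) *\<^sub>R y - v))"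
      unfolding 1 using gauss_density_mult[OF s t, of v y] 
      by (simp add: a_def add.commute mult.assoc[symmetric])
  qed
  also have "\<dots> = (\<integral>\<^sup>+ y. \<integral>\<^sup>+ v. F (a *\<^sub>R y + v) ((1 - a) *\<^sub>R y - v) \<partial>gauss (s * t / (s + t)) \<partial>gauss (s + t))"
    by (simp add: nn_integral_gauss nn_integral_cmult)
  finally show ?thesis .
qed

text \<open>From \<open>u \<le> exp u\<close> with \<open>u = (norm y)\<^sup>2 / (4 * s)\<close>,
  the square is absorbed by doubling the variance; \<open>2 powr (DIM('v) / 2)\<close> is the ratio
  of the two normalising constants. What counts later is linearity in \<open>s\<close>, which will
  be a time step.\<close>

lemma nn_integral_gauss_norm_square:
  assumes s: "s > 0"
  shows "(\<integral>\<^sup>+ y. ennreal ((norm (y::'v::euclidean_space))\<^sup>2) \<partial>gauss s) \<le> ennreal (4 * 2 powr (DIM('v) / 2) * s)"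
proof -
  let ?c = "4 * 2 powr (DIM('v) / 2) * s"
  have *: "gauss_density s y * ennreal ((norm y)\<^sup>2) \<le> ennreal ?c * gauss_density (2 * s) y" for y :: 'v
  proof -
    let ?u = "(norm y)\<^sup>2 / (4 * s)"
    have "?u \<le> exp ?u" using exp_ge_add_one_self[of ?u] by linarith
    then have "(norm y)\<^sup>2 \<le> 4 * s * exp ?u" using s by (simp add: field_simps)
    then have "exp (- (norm y)\<^sup>2 / (2 * s)) * (norm y)\<^sup>2 \<le> exp (- (norm y)\<^sup>2 / (2 * s)) * (4 * s * exp ?u)"
      by simp
    also have "\<dots> = 4 * s * exp (- (norm y)\<^sup>2 / (2 * s) + ?u)" by (simp only: exp_add mult_ac)
    also have "- (norm y)\<^sup>2 / (2 * s) + ?u = - (norm y)\<^sup>2 / (2 * (2 * s))" using s by (simp add: field_simps)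
    finally have e: "exp (- (norm y)\<^sup>2 / (2 * s)) * (norm y)\<^sup>2 \<le> 4 * s * exp (- (norm y)\<^sup>2 / (2 * (2 * s)))" .
    have p: "(2 * pi * s) powr (- real DIM('v) / 2) = 2 powr (DIM('v) / 2) * (2 * pi * (2 * s)) powr (- real DIM('v) / 2)"
      using s by (simp add: powr_mult powr_minus field_simps powr_add[symmetric])
    have "(2 * pi * s) powr (- real DIM('v) / 2) * (exp (- (norm y)\<^sup>2 / (2 * s)) * (norm y)\<^sup>2)
      \<le> (2 * pi * s) powr (- real DIM('v) / 2) * (4 * s * exp (- (norm y)\<^sup>2 / (2 * (2 * s))))"
      by (intro mult_left_mono e) auto
    also have "\<dots> = ?c * ((2 * pi * (2 * s)) powr (- real DIM('v) / 2) * exp (- (norm y)\<^sup>2 / (2 * (2 * s))))"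
      unfolding p by simp
    finally show ?thesis
      unfolding gauss_density_def using s
      by (simp add: ennreal_mult[symmetric] mult.assoc)
  qed
  have "(\<integral>\<^sup>+ y. ennreal ((norm (y::'v))\<^sup>2) \<partial>gauss s) \<le> (\<integral>\<^sup>+ y. ennreal ?c * gauss_density (2 * s) (y::'v) \<partial>lborel)"
    by (subst nn_integral_gauss) (auto intro!: nn_integral_mono * )
  also have "\<dots> = ennreal ?c * (\<integral>\<^sup>+ y. 1 \<partial>(gauss (2 * s) :: 'v measure))"
    by (subst nn_integral_gauss) (auto simp: nn_integral_cmult)
  also have "\<dots> = ennreal ?c"
    using prob_space.emeasure_space_1[OF prob_space_gauss[of "2 * s", where 'v='v]] s by simp
  finally show ?thesis .
qed

text \<open>Symmetry of the Gaussian and the parallelogram law remove the cross term, so the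
  coefficient of \<open>(norm z)\<^sup>2\<close> is exactly 1. A larger one would destroy the
  contraction of the Lyapunov function over many small steps.\<close>

lemma nn_integral_gauss_norm_square_add:
  assumes s: "s > 0"
  shows "(\<integral>\<^sup>+ y. ennreal ((norm (z + y::'v::euclidean_space))\<^sup>2) \<partial>gauss s)
    \<le> ennreal ((norm z)\<^sup>2 + 4 * 2 powr (DIM('v) / 2) * s)"
proof -
  let ?I = "\<lambda>f. (\<integral>\<^sup>+ y. ennreal (f (y::'v)) \<partial>gauss s)"
  interpret prob_space "gauss s :: 'v measure" by (rule prob_space_gauss[OF s])
  have even: "gauss_density s (- y) = gauss_density s y" for y :: 'v by (simp add: gauss_density_def)
  have "?I (\<lambda>y. (norm (z + y))\<^sup>2) = ?I (\<lambda>y. (norm (z - y))\<^sup>2)"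
    using nn_integral_lborel_uminus[of "\<lambda>y. gauss_density s y * ennreal ((norm (z - y))\<^sup>2)"]
    by (simp add: nn_integral_gauss even)
  then have "2 * ?I (\<lambda>y. (norm (z + y))\<^sup>2) = ?I (\<lambda>y. (norm (z + y))\<^sup>2) + ?I (\<lambda>y. (norm (z - y))\<^sup>2)"
    by (simp add: mult_2)
  also have "\<dots> = (\<integral>\<^sup>+ y. 2 * (ennreal ((norm z)\<^sup>2) + ennreal ((norm (y::'v))\<^sup>2)) \<partial>gauss s)"
  proof -
    have "ennreal ((norm (z + y))\<^sup>2) + ennreal ((norm (z - y))\<^sup>2) = 2 * (ennreal ((norm z)\<^sup>2) + ennreal ((norm y)\<^sup>2))"
      for y :: 'v
    proof -
      have "(norm (z + y))\<^sup>2 + (norm (z - y))\<^sup>2 = 2 * ((norm z)\<^sup>2 + (norm y)\<^sup>2)"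
        by (simp add: power2_norm_eq_inner inner_add_left inner_add_right inner_diff_left inner_diff_right inner_commute)
      then show ?thesis
        by (simp add: ennreal_plus[symmetric] numeral_mult_ennreal del: ennreal_plus)
    qed
    then show ?thesis
      by (subst nn_integral_add[symmetric]) auto
  qed
  also have "\<dots> = 2 * (ennreal ((norm z)\<^sup>2) + ?I (\<lambda>y. (norm y)\<^sup>2))"
    by (simp add: nn_integral_cmult nn_integral_add emeasure_space_1[simplified])
  finally have "?I (\<lambda>y. (norm (z + y))\<^sup>2) = ennreal ((norm z)\<^sup>2) + ?I (\<lambda>y. (norm y)\<^sup>2)"
    by (simp add: ennreal_mult_cancel_left del: distrib_left_numeral)
  also have "\<dots> \<le> ennreal ((norm z)\<^sup>2) + ennreal (4 * 2 powr (DIM('v) / 2) * s)"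
    by (intro add_left_mono nn_integral_gauss_norm_square s)
  finally show ?thesis using s by (simp add: ennreal_plus)
qed

section \<open>Euler schemes and Brownian bridges\<close>

primrec euler :: "('v::real_vector \<Rightarrow> 'v) \<Rightarrow> real \<Rightarrow> (nat \<Rightarrow> 'v) \<Rightarrow> 'v \<Rightarrow> nat \<Rightarrow> 'v" where
  "euler b d \<xi> z 0 = z"
| "euler b d \<xi> z (Suc k) = euler b d \<xi> z k + d *\<^sub>R b (euler b d \<xi> z k) + \<xi> k"

lemma euler_cong: "(\<And>i. i < k \<Longrightarrow> \<xi> i = \<xi>' i) \<Longrightarrow> euler b d \<xi> z k = euler b d \<xi>' z k"
  by (induction k) auto

lemma discrete_gronwall:
  fixes a :: "nat \<Rightarrow> real"
  assumes step: "\<And>k. k < n \<Longrightarrow> a (Suc k) \<le> (1 + c) * a k + e" and c: "c \<ge> 0" and e: "e \<ge> 0"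
    and k: "k \<le> n" and a0: "a 0 \<ge> 0"
  shows "a k \<le> (a 0 + real k * e) * exp (real k * c)"
  using k
proof (induction k)
  case (Suc k)
  have "a (Suc k) \<le> (1 + c) * a k + e" using Suc by (intro step) auto
  also have "\<dots> \<le> (1 + c) * ((a 0 + real k * e) * exp (real k * c)) + e"
    using Suc c by (intro add_right_mono mult_left_mono) auto
  also have "\<dots> \<le> exp c * ((a 0 + real k * e) * exp (real k * c)) + e * exp (real (Suc k) * c)"
    using e c a0 by (intro add_mono mult_right_mono exp_ge_add_one_self) (auto simp: mult_le_cancel_left1)
  also have "\<dots> = (a 0 + real (Suc k) * e) * exp (real (Suc k) * c)"
    by (simp add: algebra_simps exp_add)
  finally show ?case .
qed simp

text \<open>Spreading \<open>w\<close> evenly over the increments moves the endpoint by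
  \<open>w\<close> plus the response of the drift. Gronwall bounds the distance of the two schemes
  by \<open>norm (w - w') * exp (h * K)\<close> at every step (\<open>ak\<close>); feeding this into
  the Lipschitz bound of the drift over total time \<open>h\<close> gives the factor. It depends
  neither on \<open>N\<close> nor on \<open>\<zeta>\<close>, so it survives the limit, and it is
  small for short \<open>h\<close>.\<close>

lemma euler_shift:
  fixes b :: "'v::euclidean_space \<Rightarrow> 'v" and \<zeta> :: "nat \<Rightarrow> 'v" and z :: 'v
  assumes b: "\<And>x y. norm (b x - b y) \<le> K * norm (x - y)" and K: "K \<ge> 0"
    and d: "d \<ge> 0" and N: "N > 0" and h: "h = real N * d"
  defines "E \<equiv> \<lambda>w. euler b d (\<lambda>i. \<zeta> i + (1 / real N) *\<^sub>R w) z N"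
  shows "norm (E w - E w' - (w - w')) \<le> h * K * exp (h * K) * norm (w - w')"
proof -
  define u v where "u = (\<lambda>i. \<zeta> i + (1 / real N) *\<^sub>R w)" and "v = (\<lambda>i. \<zeta> i + (1 / real N) *\<^sub>R w')"
  define D where "D = norm (w - w') / real N"
  have D: "D \<ge> 0" "norm (u i - v i) = D" for i
    using N by (auto simp: D_def u_def v_def scaleR_diff_right[symmetric])
  define a where "a k = norm (euler b d u z k - euler b d v z k)" for k
  have step: "a (Suc k) \<le> (1 + d * K) * a k + D" for k
  proof -
    let ?x = "euler b d u z k" and ?y = "euler b d v z k"
    have "a (Suc k) = norm ((?x - ?y) + d *\<^sub>R (b ?x - b ?y) + (u k - v k))"
      by (simp add: a_def algebra_simps)
    also have "\<dots> \<le> norm (?x - ?y) + norm (d *\<^sub>R (b ?x - b ?y)) + norm (u k - v k)"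
      by (intro order_trans[OF norm_triangle_ineq] add_right_mono norm_triangle_ineq)
    also have "norm (d *\<^sub>R (b ?x - b ?y)) \<le> d * (K * norm (?x - ?y))"
      using b d by (auto intro!: mult_left_mono)
    finally show ?thesis by (simp add: D a_def algebra_simps)
  qed
  have ak: "a k \<le> norm (w - w') * exp (h * K)" if "k \<le> N" for k
  proof -
    have "a k \<le> (a 0 + real k * D) * exp (real k * (d * K))"
      by (rule discrete_gronwall[where n=N]) (use step d K D that in \<open>auto simp: a_def\<close>)
    also have "\<dots> \<le> (real N * D) * exp (real N * (d * K))"
      using that D d K by (intro mult_mono) (auto simp: a_def intro!: mult_right_mono)
    also have "\<dots> = norm (w - w') * exp (h * K)" using N by (simp add: D_def h)
    finally show ?thesis .
  qed
  have "norm (euler b d u z k - euler b d v z k - (real k / real N) *\<^sub>R (w - w')) \<le> real k * (d * (K * (norm (w - w') * exp (h * K))))"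
    if "k \<le> N" for k
    using that
  proof (induction k)
    case (Suc k)
    let ?x = "euler b d u z k" and ?y = "euler b d v z k"
    have uv: "u k - v k = (1 / real N) *\<^sub>R (w - w')" by (simp add: u_def v_def scaleR_diff_right)
    have "euler b d u z (Suc k) - euler b d v z (Suc k) - (real (Suc k) / real N) *\<^sub>R (w - w')
        = (?x - ?y - (real k / real N) *\<^sub>R (w - w')) + d *\<^sub>R (b ?x - b ?y) + ((u k - v k) - (1 / real N) *\<^sub>R (w - w'))"
      by (simp add: add_divide_distrib algebra_simps)
    also have "\<dots> = (?x - ?y - (real k / real N) *\<^sub>R (w - w')) + d *\<^sub>R (b ?x - b ?y)"
      unfolding uv by simp
    also have "norm \<dots> \<le> real k * (d * (K * (norm (w - w') * exp (h * K)))) + d * (K * (norm (w - w') * exp (h * K)))"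
    proof (rule norm_triangle_mono)
      show "norm (?x - ?y - (real k / real N) *\<^sub>R (w - w')) \<le> real k * (d * (K * (norm (w - w') * exp (h * K))))"
        using Suc by simp
      have "norm (b ?x - b ?y) \<le> K * a k" using b by (simp add: a_def)
      also have "\<dots> \<le> K * (norm (w - w') * exp (h * K))" using ak[of k] Suc K by (intro mult_left_mono) auto
      finally show "norm (d *\<^sub>R (b ?x - b ?y)) \<le> d * (K * (norm (w - w') * exp (h * K)))"
        using d by (simp add: mult_left_mono)
    qed
    finally show ?case by (simp add: algebra_simps)
  qed simp
  from this[of N] show ?thesis using N by (simp add: E_def u_def v_def h mult_ac)
qed

text \<open>Gronwall is applied to the scheme minus the accumulated noise. In this way only the
  partial sums of the noise enter, for which a bound uniform in the mesh is available.\<close>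

lemma euler_bound:
  fixes b :: "'v::euclidean_space \<Rightarrow> 'v"
  assumes b: "\<And>x y. norm (b x - b y) \<le> K * norm (x - y)" and K: "K \<ge> 0" and d: "d \<ge> 0"
    and M: "\<And>k. k \<le> N \<Longrightarrow> norm (\<Sum>i<k. \<zeta> i) \<le> M" and h: "h = real N * d"
  shows "norm (euler b d \<zeta> z N) \<le> (norm z + h * (norm (b 0) + K * M)) * exp (h * K) + M"
proof -
  define a where "a k = norm (euler b d \<zeta> z k - (\<Sum>i<k. \<zeta> i))" for k
  have M0: "M \<ge> 0" using M[of 0] by simp
  have step: "a (Suc k) \<le> (1 + d * K) * a k + d * (norm (b 0) + K * M)" if "k < N" for k
  proof -
    let ?x = "euler b d \<zeta> z k" and ?s = "\<Sum>i<k. \<zeta> i"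
    have "norm ?x \<le> a k + M" using M[of k] that norm_triangle_sub[of ?x ?s] by (simp add: a_def)
    have "norm (b ?x) \<le> norm (b 0) + norm (b ?x - b 0)" by (rule norm_triangle_sub)
    also have "norm (b ?x - b 0) \<le> K * norm ?x" using b[of ?x 0] by simp
    also have "\<dots> \<le> K * (a k + M)" using K \<open>norm ?x \<le> a k + M\<close> by (intro mult_left_mono)
    finally have bx: "norm (b ?x) \<le> norm (b 0) + K * (a k + M)" by simp
    have "a (Suc k) = norm ((?x - ?s) + d *\<^sub>R b ?x)" by (simp add: a_def algebra_simps)
    also have "\<dots> \<le> a k + d * norm (b ?x)" using norm_triangle_ineq[of "?x - ?s" "d *\<^sub>R b ?x"] d by (simp add: a_def)
    also have "\<dots> \<le> a k + d * (norm (b 0) + K * (a k + M))" using bx d by (intro add_left_mono mult_left_mono)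
    finally show ?thesis by (simp add: algebra_simps)
  qed
  have "a N \<le> (a 0 + real N * (d * (norm (b 0) + K * M))) * exp (real N * (d * K))"
    by (rule discrete_gronwall[where n=N]) (use step d K M0 in \<open>auto simp: a_def\<close>)
  also have "\<dots> = (norm z + h * (norm (b 0) + K * M)) * exp (h * K)"
    by (simp add: h a_def mult.assoc)
  finally show ?thesis
    using norm_triangle_sub[of "euler b d \<zeta> z N" "\<Sum>i<N. \<zeta> i"] M[of N] by (simp add: a_def)
qed

text \<open>Solving \<open>\<Phi> w = y\<close> means finding a fixed point of
  \<open>\<lambda>w. y - (\<Phi> w - w)\<close>, which is a contraction by hypothesis.\<close>

lemma near_identity_surj:
  fixes \<Phi> :: "'v::euclidean_space \<Rightarrow> 'v"
  assumes "\<And>w w'. norm (\<Phi> w - \<Phi> w' - (w - w')) \<le> 1/2 * norm (w - w')"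
  obtains w where "\<Phi> w = y"
proof -
  have "\<exists>!w\<in>UNIV. y - (\<Phi> w - w) = w"
  proof (rule Banach_fix[where c="1/2"])
    show "dist (y - (\<Phi> u - u)) (y - (\<Phi> v - v)) \<le> 1/2 * dist u v" for u v
      using assms[of v u] by (simp add: dist_norm norm_minus_commute algebra_simps)
  qed (auto simp: complete_UNIV)
  then obtain w where "y - (\<Phi> w - w) = w" by auto
  then have "\<Phi> w = y" by (simp add: algebra_simps)
  with that show thesis .
qed

text \<open>\<open>\<Phi>\<close> and its inverse stretch distances by at most 2, so the preimage of
  a ball lies between two balls around the preimage \<open>w\<close> of the centre. The bound on
  \<open>norm w\<close> will keep the Gaussian density on them away from 0.\<close>

lemma near_identity_vimage_ball:
  fixes \<Phi> :: "'v::euclidean_space \<Rightarrow> 'v"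
  assumes \<Phi>: "\<And>w w'. norm (\<Phi> w - \<Phi> w' - (w - w')) \<le> 1/2 * norm (w - w')"
  obtains w where "\<Phi> -` ball y r \<subseteq> ball w (2 * r)" "ball w (r / 2) \<subseteq> \<Phi> -` ball y r"
    "norm w \<le> 2 * (norm y + norm (\<Phi> 0))"
proof -
  obtain w where w: "\<Phi> w = y" using near_identity_surj[OF \<Phi>] .
  have 1: "norm (w - v) \<le> 2 * norm (\<Phi> w - \<Phi> v)" for v
    using \<Phi>[of w v] norm_triangle_sub[of "w - v" "\<Phi> w - \<Phi> v"] by (simp add: norm_minus_commute)
  have 2: "norm (\<Phi> w - \<Phi> v) \<le> 2 * norm (w - v)" for v
    using \<Phi>[of w v] norm_triangle_sub[of "\<Phi> w - \<Phi> v" "w - v"] norm_ge_zero[of "w - v"] by linarith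
  show thesis
  proof
    show "\<Phi> -` ball y r \<subseteq> ball w (2 * r)"
    proof
      fix v assume "v \<in> \<Phi> -` ball y r"
      then show "v \<in> ball w (2 * r)" using 1[of v] w by (simp add: dist_norm)
    qed
    show "ball w (r / 2) \<subseteq> \<Phi> -` ball y r"
    proof
      fix v assume "v \<in> ball w (r / 2)"
      then show "v \<in> \<Phi> -` ball y r" using 2[of v] w by (simp add: dist_norm)
    qed
    show "norm w \<le> 2 * (norm y + norm (\<Phi> 0))"
      using 1[of 0] w norm_triangle_ineq4[of y "\<Phi> 0"] by simp
  qed
qed

lemma emeasure_lborel_ball_double:
  "r \<ge> 0 \<Longrightarrow> emeasure lborel (ball (x::'v::euclidean_space) (2 * r)) = ennreal (2 ^ DIM('v)) * emeasure lborel (ball (y::'v) r)"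
  by (simp add: emeasure_ball power_mult_distrib ennreal_mult[symmetric] mult_ac)

text \<open>The density never exceeds its value at 0, wherever the preimage lies; hence the constant
  does not depend on \<open>\<Phi>\<close>.\<close>

lemma emeasure_gauss_near_identity_le:
  fixes \<Phi> :: "'v::euclidean_space \<Rightarrow> 'v"
  assumes \<Phi>: "\<And>w w'. norm (\<Phi> w - \<Phi> w' - (w - w')) \<le> 1/2 * norm (w - w')" and r: "r > 0" and s: "s > 0"
  shows "emeasure (gauss s) (\<Phi> -` ball y r)
    \<le> ennreal ((2 * pi * s) powr (- real DIM('v) / 2) * 2 ^ DIM('v)) * emeasure lborel (ball y r)"
proof -
  let ?c = "(2 * pi * s) powr (- real DIM('v) / 2)"
  obtain w where w: "\<Phi> -` ball y r \<subseteq> ball w (2 * r)" using near_identity_vimage_ball[OF \<Phi>] .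
  have "emeasure (gauss s) (\<Phi> -` ball y r) \<le> emeasure (gauss s) (ball w (2 * r))"
    using w by (intro emeasure_mono) auto
  also have "\<dots> = (\<integral>\<^sup>+ y. gauss_density s y * indicator (ball w (2 * r)) y \<partial>lborel)"
    by (simp add: gauss_def emeasure_density)
  also have "\<dots> \<le> (\<integral>\<^sup>+ y. ennreal ?c * indicator (ball w (2 * r)) y \<partial>lborel)"
    using s by (intro nn_integral_mono mult_right_mono)
       (auto simp: gauss_density_def intro!: ennreal_leI mult_left_le)
  also have "\<dots> = ennreal ?c * emeasure lborel (ball w (2 * r))"
    by (intro nn_integral_cmult_indicator) simp
  finally show ?thesis
    using emeasure_lborel_ball_double[of r w y] r
    by (simp add: ennreal_mult mult.assoc)
qed

text \<open>The preimage contains a ball of radius \<open>r / 2\<close> whose points have norm at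
  most \<open>M\<close>, and there the density is at least its value at radius \<open>M\<close>.
  Dividing by \<open>2 ^ DIM('v)\<close> accounts for the halved radius.\<close>

lemma emeasure_gauss_near_identity_ge:
  fixes \<Phi> :: "'v::euclidean_space \<Rightarrow> 'v"
  assumes \<Phi>: "\<And>w w'. norm (\<Phi> w - \<Phi> w' - (w - w')) \<le> 1/2 * norm (w - w')" and r: "r > 0" and s: "s > 0"
    and meas: "\<Phi> \<in> borel_measurable borel"
    and M: "2 * (norm y + norm (\<Phi> 0)) + r \<le> M"
  shows "ennreal ((2 * pi * s) powr (- real DIM('v) / 2) * exp (- M\<^sup>2 / (2 * s)) / 2 ^ DIM('v)) * emeasure lborel (ball y r)
    \<le> emeasure (gauss s) (\<Phi> -` ball y r)"
proof -
  let ?c = "(2 * pi * s) powr (- real DIM('v) / 2) * exp (- M\<^sup>2 / (2 * s))"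
  obtain w where w: "ball w (r / 2) \<subseteq> \<Phi> -` ball y r" "norm w \<le> 2 * (norm y + norm (\<Phi> 0))"
    using near_identity_vimage_ball[OF \<Phi>] .
  have *: "norm v \<le> M" if "v \<in> ball w (r / 2)" for v
  proof -
    have "norm v \<le> norm w + norm (w - v)" by (metis norm_minus_commute norm_triangle_sub)
    then show ?thesis using that w M r by (auto simp: dist_norm)
  qed
  have [measurable]: "\<Phi> -` ball y r \<in> sets borel"
    using measurable_sets_borel[OF meas, of "ball y r"] by simp
  have "ennreal ?c * emeasure lborel (ball w (r / 2)) = (\<integral>\<^sup>+ v. ennreal ?c * indicator (ball w (r / 2)) v \<partial>lborel)"
    by (intro nn_integral_cmult_indicator[symmetric]) simp
  also have "\<dots> \<le> (\<integral>\<^sup>+ v. gauss_density s v * indicator (ball w (r / 2)) v \<partial>lborel)"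
    using s * by (intro nn_integral_mono)
      (auto simp: gauss_density_def divide_right_mono power_mono intro!: ennreal_leI mult_left_mono split: split_indicator)
  also have "\<dots> = emeasure (gauss s) (ball w (r / 2))"
    by (simp add: gauss_def emeasure_density)
  also have "\<dots> \<le> emeasure (gauss s) (\<Phi> -` ball y r)"
    using w by (intro emeasure_mono) auto
  finally have 1: "ennreal ?c * emeasure lborel (ball w (r / 2)) \<le> emeasure (gauss s) (\<Phi> -` ball y r)" .
  have "ennreal (?c / 2 ^ DIM('v)) * emeasure lborel (ball y r)
      = ennreal (?c / 2 ^ DIM('v)) * (ennreal (2 ^ DIM('v)) * emeasure lborel (ball w (r / 2)))"
    using emeasure_lborel_ball_double[of "r/2" y w] r by simp
  also have "\<dots> = ennreal ?c * emeasure lborel (ball w (r / 2))"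
    unfolding mult.assoc[symmetric] by (subst ennreal_mult[symmetric]) auto
  finally show ?thesis using 1 by simp
qed

text \<open>Induction on the number of increments. The sum \<open>w\<close> of the old increments
  and the new increment are split anew into the total sum and an independent deviation
  \<open>u\<close>. The deviation joins the bridge, evenly over the old increments and with opposite
  sign on the new one. For a single increment the bridge is 0.\<close>

lemma gauss_bridge_decomposition:
  assumes d: "d > 0"
  shows "\<exists>Z. prob_space Z \<and> sets Z = sets (\<Pi>\<^sub>M i\<in>{..<Suc n}. (borel :: 'v::euclidean_space measure)) \<and>
    (\<forall>F \<in> borel_measurable (\<Pi>\<^sub>M i\<in>{..<Suc n}. (borel :: 'v measure)).
      (\<integral>\<^sup>+ \<xi>. F \<xi> \<partial>(\<Pi>\<^sub>M i\<in>{..<Suc n}. gauss d)) =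
      (\<integral>\<^sup>+ \<zeta>. \<integral>\<^sup>+ w. F (\<lambda>i\<in>{..<Suc n}. \<zeta> i + (1 / real (Suc n)) *\<^sub>R w) \<partial>gauss (real (Suc n) * d) \<partial>Z))"
proof (induction n)
  interpret P: product_sigma_finite "\<lambda>_::nat. gauss d :: 'v measure"
    by (intro product_sigma_finite.intro prob_space_imp_sigma_finite prob_space_gauss d)
  case 0
  let ?S = "\<Pi>\<^sub>M i\<in>{..<Suc 0}. (borel :: 'v measure)"
  let ?Z = "return ?S (\<lambda>i\<in>{..<Suc 0}. 0 :: 'v)"
  have [simp]: "(\<lambda>i\<in>{..<Suc 0}. 0 :: 'v) \<in> space ?S" by (auto simp: space_PiM)
  show ?case
  proof (intro exI[of _ ?Z] conjI ballI)
    show "prob_space ?Z" by (rule prob_space_return) simp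
    fix F :: "(nat \<Rightarrow> 'v) \<Rightarrow> ennreal" assume [measurable]: "F \<in> borel_measurable ?S"
    have s: "{..<Suc 0} = insert 0 {}" by auto
    have meas: "(\<lambda>w. F (\<lambda>i\<in>{..<Suc 0}. \<zeta> i + (1 / real (Suc 0)) *\<^sub>R w)) \<in> borel_measurable borel" for \<zeta>
      by measurable
    have "(\<integral>\<^sup>+ \<xi>. F \<xi> \<partial>(\<Pi>\<^sub>M i\<in>{..<Suc 0}. gauss d)) = (\<integral>\<^sup>+ y. F ((\<lambda>_. undefined)(0 := y)) \<partial>gauss d)"
      unfolding s by (subst P.product_nn_integral_insert) (auto simp: PiM_empty nn_integral_count_space_finite s[symmetric] fun_upd_def cong: measurable_cong_sets sets_PiM_cong)
    also have "\<dots> = (\<integral>\<^sup>+ \<zeta>. \<integral>\<^sup>+ w. F (\<lambda>i\<in>{..<Suc 0}. \<zeta> i + (1 / real (Suc 0)) *\<^sub>R w) \<partial>gauss (real (Suc 0) * d) \<partial>?Z)"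
    proof -
      have "(\<lambda>_. undefined)(0 := y) = (\<lambda>i\<in>{..<Suc 0}. (\<lambda>i\<in>{..<Suc 0}. 0) i + (1 / real (Suc 0)) *\<^sub>R y)" for y :: 'v
        by (auto simp: fun_eq_iff)
      moreover have "(\<lambda>\<zeta>. \<integral>\<^sup>+ w. F (\<lambda>i\<in>{..<Suc 0}. \<zeta> i + (1 / real (Suc 0)) *\<^sub>R w) \<partial>gauss (real (Suc 0) * d)) \<in> borel_measurable ?S"
        using d by (intro sigma_finite_measure.borel_measurable_nn_integral prob_space_imp_sigma_finite prob_space_gauss) measurable
      ultimately show ?thesis
        by (subst nn_integral_return) simp_all
    qed
    finally show "(\<integral>\<^sup>+ \<xi>. F \<xi> \<partial>(\<Pi>\<^sub>M i\<in>{..<Suc 0}. gauss d)) =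
      (\<integral>\<^sup>+ \<zeta>. \<integral>\<^sup>+ w. F (\<lambda>i\<in>{..<Suc 0}. \<zeta> i + (1 / real (Suc 0)) *\<^sub>R w) \<partial>gauss (real (Suc 0) * d) \<partial>?Z)" .
  qed simp
next
  case (Suc n)
  interpret P: product_sigma_finite "\<lambda>_::nat. gauss d :: 'v measure"
    by (intro product_sigma_finite.intro prob_space_imp_sigma_finite prob_space_gauss d)
  define I I' where "I = {..<Suc n}" and "I' = {..<Suc (Suc n)}"
  have II': "I' = insert (Suc n) I" "finite I" "Suc n \<notin> I" by (auto simp: I_def I'_def)
  define s where "s = real (Suc n) * d"
  have s: "s > 0" "s + d = real (Suc (Suc n)) * d" using d by (simp_all add: s_def algebra_simps add_pos_nonneg)
  define v where "v = s * d / (s + d)"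
  have v: "v > 0" using s d by (simp add: v_def)
  have a: "s / (s + d) = real (Suc n) / real (Suc (Suc n))" using d by (simp add: s(2)) (simp add: s_def)
  have a': "1 - real (Suc n) / real (Suc (Suc n)) = 1 / real (Suc (Suc n))" by (simp add: field_simps)
  obtain Z where Z: "prob_space Z" "sets Z = sets (\<Pi>\<^sub>M i\<in>I. (borel :: 'v measure))"
    and ZF: "\<And>F. F \<in> borel_measurable (\<Pi>\<^sub>M i\<in>I. (borel :: 'v measure)) \<Longrightarrow>
      (\<integral>\<^sup>+ \<xi>. F \<xi> \<partial>(\<Pi>\<^sub>M i\<in>I. gauss d)) =
      (\<integral>\<^sup>+ \<zeta>. \<integral>\<^sup>+ w. F (\<lambda>i\<in>I. \<zeta> i + (1 / real (Suc n)) *\<^sub>R w) \<partial>gauss s \<partial>Z)"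
    using Suc unfolding I_def s_def by blast
  note [measurable_cong] = Z(2)
  interpret Z: prob_space Z by (rule Z)
  interpret gd: prob_space "gauss d :: 'v measure" by (rule prob_space_gauss d)+
  interpret gs: prob_space "gauss s :: 'v measure" by (rule prob_space_gauss s)+
  interpret gv: prob_space "gauss v :: 'v measure" by (rule prob_space_gauss v)+
  interpret gsd: prob_space "gauss (s + d) :: 'v measure" by (rule prob_space_gauss) (use s d in simp)
  interpret dZ: pair_sigma_finite "gauss d :: 'v measure" Z ..
  interpret sd: pair_sigma_finite "gauss s :: 'v measure" "gauss d :: 'v measure" ..
  interpret vsd: pair_sigma_finite "gauss v :: 'v measure" "gauss (s + d) :: 'v measure" ..
  interpret Zv: pair_prob_space Z "gauss v :: 'v measure" ..
  define T where "T \<zeta> w y = (\<lambda>i\<in>I'. if i = Suc n then y else \<zeta> i + (1 / real (Suc n)) *\<^sub>R w)"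
    for \<zeta> :: "nat \<Rightarrow> 'v" and w y :: 'v
  have T [measurable]: "(\<lambda>x. T (f x) (g x) (k x)) \<in> measurable M (\<Pi>\<^sub>M i\<in>I'. borel)"
    if [measurable]: "f \<in> measurable M (\<Pi>\<^sub>M i\<in>I. borel)" "g \<in> borel_measurable M" "k \<in> borel_measurable M" for f g k and M :: "'b measure"
    unfolding T_def
  proof (rule measurable_restrict)
    fix i assume i: "i \<in> I'"
    show "(\<lambda>x. if i = Suc n then k x else f x i + (1 / real (Suc n)) *\<^sub>R g x) \<in> borel_measurable M"
    proof (cases "i = Suc n")
      case False
      then have [measurable]: "i \<in> I" using i II' by auto
      have "(\<lambda>x. f x i) \<in> borel_measurable M" by measurable
      then show ?thesis using False by simp
    qed simp
  qed
  \<comment> \<open>The part of the configuration that is left when the total sum is 0: the old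
    increments then add \<open>u\<close> and the new one is \<open>- u\<close>.\<close>
  define U where "U = (\<lambda>(\<zeta>, u). T (\<zeta>::nat \<Rightarrow> 'v) u (- u))"
  have U [measurable]: "U \<in> measurable (Z \<Otimes>\<^sub>M gauss v) (\<Pi>\<^sub>M i\<in>I'. borel)" unfolding U_def by measurable
  let ?Z = "distr (Z \<Otimes>\<^sub>M gauss v) (\<Pi>\<^sub>M i\<in>I'. borel) U"
  show ?case
    unfolding I'_def[symmetric] s(2)[symmetric]
  proof (intro exI[of _ ?Z] conjI ballI)
    show "prob_space ?Z" by (rule Zv.prob_space_distr) simp
    fix F :: "(nat \<Rightarrow> 'v) \<Rightarrow> ennreal" assume F [measurable]: "F \<in> borel_measurable (\<Pi>\<^sub>M i\<in>I'. (borel :: 'v measure))"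
    have FT: "(\<lambda>x. F (T \<zeta> (f x) (k x))) \<in> borel_measurable M"
      if "\<zeta> \<in> space Z" and [measurable]: "f \<in> borel_measurable M" "k \<in> borel_measurable M" for \<zeta> f k and M :: "('v \<times> 'v) measure"
    proof -
      have "\<zeta> \<in> space (\<Pi>\<^sub>M i\<in>I. (borel :: 'v measure))" using that sets_eq_imp_space_eq[OF Z(2)] by simp
      then have "(\<lambda>x. T \<zeta> (f x) (k x)) \<in> measurable M (\<Pi>\<^sub>M i\<in>I'. borel)" by (intro T) auto
      from measurable_compose[OF this F] show ?thesis .
    qed
    have F': "F \<in> borel_measurable (\<Pi>\<^sub>M i\<in>insert (Suc n) I. gauss d)"
      using F unfolding II'(1) by (simp cong: measurable_cong_sets sets_PiM_cong)
    have "(\<integral>\<^sup>+ \<xi>. F \<xi> \<partial>(\<Pi>\<^sub>M i\<in>I'. gauss d)) = (\<integral>\<^sup>+ y. \<integral>\<^sup>+ x. F (x(Suc n := y)) \<partial>(\<Pi>\<^sub>M i\<in>I. gauss d) \<partial>gauss d)"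
      unfolding II'(1) by (rule P.product_nn_integral_insert_rev[OF II'(2,3) F'])
    also have "\<dots> = (\<integral>\<^sup>+ y. \<integral>\<^sup>+ \<zeta>. \<integral>\<^sup>+ w. F (T \<zeta> w y) \<partial>gauss s \<partial>Z \<partial>gauss d)"
    proof (rule nn_integral_cong)
      fix y :: 'v
      have "(\<lambda>x. x(Suc n := y)) \<in> measurable (\<Pi>\<^sub>M i\<in>I. borel) (\<Pi>\<^sub>M i\<in>I'. borel)"
        unfolding II'(1) by measurable
      from measurable_compose[OF this F]
      have "(\<integral>\<^sup>+ x. F (x(Suc n := y)) \<partial>(\<Pi>\<^sub>M i\<in>I. gauss d)) =
        (\<integral>\<^sup>+ \<zeta>. \<integral>\<^sup>+ w. F ((\<lambda>i\<in>I. \<zeta> i + (1 / real (Suc n)) *\<^sub>R w)(Suc n := y)) \<partial>gauss s \<partial>Z)"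
        by (rule ZF)
      moreover have "(\<lambda>i\<in>I. \<zeta> i + (1 / real (Suc n)) *\<^sub>R w)(Suc n := y) = T \<zeta> w y" for \<zeta> w
        using II' by (auto simp: T_def fun_eq_iff)
      ultimately show "(\<integral>\<^sup>+ x. F (x(Suc n := y)) \<partial>(\<Pi>\<^sub>M i\<in>I. gauss d)) = (\<integral>\<^sup>+ \<zeta>. \<integral>\<^sup>+ w. F (T \<zeta> w y) \<partial>gauss s \<partial>Z)" by simp
    qed
    also have "\<dots> = (\<integral>\<^sup>+ \<zeta>. \<integral>\<^sup>+ y. \<integral>\<^sup>+ w. F (T \<zeta> w y) \<partial>gauss s \<partial>gauss d \<partial>Z)"
      by (rule dZ.Fubini'[symmetric]) measurable
    also have "\<dots> = (\<integral>\<^sup>+ \<zeta>. \<integral>\<^sup>+ w. \<integral>\<^sup>+ y. F (T \<zeta> w y) \<partial>gauss d \<partial>gauss s \<partial>Z)"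
      by (intro nn_integral_cong sd.Fubini') (auto simp: split_beta' intro!: FT)
    also have "\<dots> = (\<integral>\<^sup>+ \<zeta>. \<integral>\<^sup>+ y. \<integral>\<^sup>+ u. F (T \<zeta> ((s / (s + d)) *\<^sub>R y + u) ((1 - s / (s + d)) *\<^sub>R y - u)) \<partial>gauss v \<partial>gauss (s + d) \<partial>Z)"
      unfolding v_def using s d by (intro nn_integral_cong nn_integral_gauss_split) (auto simp: split_beta' intro!: FT)
    also have "\<dots> = (\<integral>\<^sup>+ \<zeta>. \<integral>\<^sup>+ u. \<integral>\<^sup>+ y. F (T \<zeta> ((s / (s + d)) *\<^sub>R y + u) ((1 - s / (s + d)) *\<^sub>R y - u)) \<partial>gauss (s + d) \<partial>gauss v \<partial>Z)"
      by (intro nn_integral_cong vsd.Fubini') (auto simp: split_beta' intro!: FT)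
    also have "\<dots> = (\<integral>\<^sup>+ \<zeta>. \<integral>\<^sup>+ u. \<integral>\<^sup>+ y. F (\<lambda>i\<in>I'. U (\<zeta>, u) i + (1 / real (Suc (Suc n))) *\<^sub>R y) \<partial>gauss (s + d) \<partial>gauss v \<partial>Z)"
    proof -
      \<comment> \<open>Since \<open>s / (s + d)\<close> is \<open>(n + 1) / (n + 2)\<close>, each
        old increment receives the share \<open>1 / (n + 2)\<close> of the total sum, and so does
        the new one.\<close>
      have "T \<zeta> ((s / (s + d)) *\<^sub>R y + u) ((1 - s / (s + d)) *\<^sub>R y - u) = (\<lambda>i\<in>I'. U (\<zeta>, u) i + (1 / real (Suc (Suc n))) *\<^sub>R y)" for \<zeta> y u
        unfolding a a' U_def T_def by (auto simp: fun_eq_iff scaleR_add_right simp del: of_nat_Suc)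
      then show ?thesis by simp
    qed
    also have "\<dots> = (\<integral>\<^sup>+ x. \<integral>\<^sup>+ y. F (\<lambda>i\<in>I'. U x i + (1 / real (Suc (Suc n))) *\<^sub>R y) \<partial>gauss (s + d) \<partial>(Z \<Otimes>\<^sub>M gauss v))"
      by (subst gv.nn_integral_fst[symmetric]) auto
    also have "\<dots> = (\<integral>\<^sup>+ \<zeta>. \<integral>\<^sup>+ w. F (\<lambda>i\<in>I'. \<zeta> i + (1 / real (Suc (Suc n))) *\<^sub>R w) \<partial>gauss (s + d) \<partial>?Z)"
      by (subst nn_integral_distr) auto
    finally show "(\<integral>\<^sup>+ \<xi>. F \<xi> \<partial>(\<Pi>\<^sub>M i\<in>I'. gauss d)) = (\<integral>\<^sup>+ \<zeta>. \<integral>\<^sup>+ w. F (\<lambda>i\<in>I'. \<zeta> i + (1 / real (Suc (Suc n))) *\<^sub>R w) \<partial>gauss (s + d) \<partial>?Z)" .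
  qed simp
qed

section \<open>Dyadic filtration of Brownian motion\<close>

lemma measure_eqI_continuous:
  fixes M N :: "'v::metric_space measure"
  assumes M: "finite_measure M" "sets M = sets borel" and N: "finite_measure N" "sets N = sets borel"
    and eq: "\<And>g. continuous_on UNIV g \<Longrightarrow> (\<And>x. 0 \<le> g x) \<Longrightarrow> (\<And>x. g x \<le> (1::real)) \<Longrightarrow>
      (\<integral>\<^sup>+ x. ennreal (g x) \<partial>M) = (\<integral>\<^sup>+ x. ennreal (g x) \<partial>N)"
  shows "M = N"
proof (rule measure_eqI_generator_eq[where E="{S. open S}" and \<Omega>=UNIV and A="\<lambda>_::nat. UNIV"])
  interpret M: finite_measure M by fact
  interpret N: finite_measure N by fact
  note [measurable_cong] = M(2) N(2)
  fix U :: "'v set" assume "U \<in> {S. open S}"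
  then have U: "open U" and [measurable]: "U \<in> sets borel" by auto
  show "emeasure M U = emeasure N U"
  \<comment> \<open>\<open>infdist\<close> to the empty set is 0 by convention, so the approximating
    functions below would vanish for \<open>U = UNIV\<close>.\<close>
  proof (cases "U = UNIV")
    case True
    then show ?thesis using eq[of "\<lambda>_. 1"] M(2) N(2) by (simp add: sets_eq_imp_space_eq)
  next
    case False
    define g where "g n x = min 1 (real n * infdist x (- U))" for n x
    have g: "continuous_on UNIV (g n)" "0 \<le> g n x" "g n x \<le> 1" for n x
      by (auto simp: g_def infdist_nonneg intro!: continuous_intros)
    have [measurable]: "g n \<in> borel_measurable borel" for n
      using g(1) by (rule borel_measurable_continuous_onI)
    have lim: "(\<lambda>n. ennreal (g n x)) \<longlonglongrightarrow> indicator U x" for x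
    proof (cases "x \<in> U")
      case True
      then have "infdist x (- U) > 0"
        using False U by (intro infdist_pos_not_in_closed) auto
      then obtain n0 where "1 / infdist x (- U) < real n0" using reals_Archimedean2 by blast
      then have n0: "1 < real n0 * infdist x (- U)" using \<open>infdist x (- U) > 0\<close> by (simp add: field_simps)
      have "g n x = 1" if "n \<ge> n0" for n
      proof -
        have "real n0 * infdist x (- U) \<le> real n * infdist x (- U)"
          using that by (intro mult_right_mono) (auto simp: infdist_nonneg)
        then show ?thesis using n0 by (simp add: g_def)
      qed
      then have "\<forall>\<^sub>F n in sequentially. ennreal (g n x) = 1"
        unfolding eventually_sequentially by (auto intro!: exI[of _ n0])
      then show ?thesis using True by (auto intro: tendsto_eventually)
    next
      case False
      then have "g n x = 0" for n by (simp add: g_def)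
      then show ?thesis using False by simp
    qed
    have "(\<lambda>n. \<integral>\<^sup>+ x. ennreal (g n x) \<partial>M) \<longlonglongrightarrow> (\<integral>\<^sup>+ x. indicator U x \<partial>M)"
      by (rule nn_integral_dominated_convergence[where w="\<lambda>_. 1"])
         (auto simp: lim g M.emeasure_finite less_top[symmetric])
    moreover have "(\<lambda>n. \<integral>\<^sup>+ x. ennreal (g n x) \<partial>N) \<longlonglongrightarrow> (\<integral>\<^sup>+ x. indicator U x \<partial>N)"
      by (rule nn_integral_dominated_convergence[where w="\<lambda>_. 1"])
         (auto simp: lim g N.emeasure_finite less_top[symmetric])
    ultimately have "(\<integral>\<^sup>+ x. indicator U x \<partial>M) = (\<integral>\<^sup>+ x. indicator U x \<partial>N)"
      using eq[OF g] by (auto intro: LIMSEQ_unique)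
    then show ?thesis by simp
  qed
next
  have "sets (borel :: 'v measure) = sigma_sets UNIV {S. open S}" unfolding borel_def by (rule sets_measure_of) simp
  then show "sets M = sigma_sets UNIV {S. open S}" "sets N = sigma_sets UNIV {S. open S}" using M N by simp_all
  show "emeasure M UNIV \<noteq> \<infinity>" using finite_measure.emeasure_finite[OF M(1)] by simp
qed (simp_all add: Int_stable_def open_Int)

section \<open>Increments of Brownian motion on nested grids\<close>

locale brownian =
  fixes P :: "'a measure" and W :: "real \<Rightarrow> 'a \<Rightarrow> 'v::euclidean_space"
  assumes BM: "brownian_motion P W"
begin

sublocale prob_space P
  using BM by (simp add: brownian_motion_def)

lemma W_measurable [measurable]: "t \<ge> 0 \<Longrightarrow> W t \<in> borel_measurable P"
  using BM by (simp add: brownian_motion_def)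

lemma W_0: "\<omega> \<in> space P \<Longrightarrow> W 0 \<omega> = 0"
  and W_continuous: "\<omega> \<in> space P \<Longrightarrow> continuous_on {0..} (\<lambda>t. W t \<omega>)"
  using BM by (simp_all add: brownian_motion_def)

definition incr :: "real \<Rightarrow> real \<Rightarrow> nat \<Rightarrow> 'a \<Rightarrow> 'v" where
  "incr t d i \<omega> = W (t + real (Suc i) * d) \<omega> - W (t + real i * d) \<omega>"

lemma incr_measurable [measurable]: "t \<ge> 0 \<Longrightarrow> d \<ge> 0 \<Longrightarrow> incr t d i \<in> borel_measurable P"
  unfolding incr_def by (intro borel_measurable_diff W_measurable) auto

lemma indep_incr: "t \<ge> 0 \<Longrightarrow> d > 0 \<Longrightarrow> indep_vars (\<lambda>_. borel) (incr t d) {..<n}"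
proof -
  assume t: "t \<ge> 0" "d > 0"
  then have "indep_vars (\<lambda>_. borel) (\<lambda>i \<omega>. W (t + real (Suc i) * d) \<omega> - W (t + real i * d) \<omega>) {..<n}"
    using BM unfolding brownian_motion_def
    by (elim conjE allE[of _ n] allE[of _ "\<lambda>i. t + real i * d"] impE) auto
  then show ?thesis by (simp add: incr_def[abs_def])
qed

lemma distr_incr: "t \<ge> 0 \<Longrightarrow> d > 0 \<Longrightarrow> distr P borel (incr t d i) = gauss d"
proof -
  assume t: "t \<ge> 0" "d > 0"
  have *: "\<And>s t. 0 \<le> s \<and> s < t \<Longrightarrow> distributed P lborel (\<lambda>\<omega>. W t \<omega> - W s \<omega>) (gauss_density (t - s))"
    using BM by (simp add: brownian_motion_def)
  have "distributed P lborel (\<lambda>\<omega>. W (t + real (Suc i) * d) \<omega> - W (t + real i * d) \<omega>)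
      (gauss_density ((t + real (Suc i) * d) - (t + real i * d)))"
    using t by (intro *) simp
  moreover have "(t + real (Suc i) * d) - (t + real i * d) = d" by (simp add: algebra_simps)
  ultimately have "distr P lborel (incr t d i) = gauss d"
    by (simp add: distributed_def gauss_def incr_def[abs_def])
  then show ?thesis by (metis distr_cong sets_lborel)
qed

definition incrs :: "real \<Rightarrow> real \<Rightarrow> nat \<Rightarrow> 'a \<Rightarrow> nat \<Rightarrow> 'v" where
  "incrs t d n \<omega> = (\<lambda>i\<in>{..<n}. incr t d i \<omega>)"

lemma incrs_measurable [measurable]:
  "t \<ge> 0 \<Longrightarrow> d \<ge> 0 \<Longrightarrow> incrs t d n \<in> measurable P (\<Pi>\<^sub>M i\<in>{..<n}. borel)"
  unfolding incrs_def[abs_def] by (intro measurable_restrict incr_measurable)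

lemma distr_incrs:
  assumes "t \<ge> 0" "d > 0" "n > 0"
  shows "distr P (\<Pi>\<^sub>M i\<in>{..<n}. borel) (incrs t d n) = (\<Pi>\<^sub>M i\<in>{..<n}. gauss d)"
proof -
  have "distr P (\<Pi>\<^sub>M i\<in>{..<n}. borel) (\<lambda>\<omega>. \<lambda>i\<in>{..<n}. incr t d i \<omega>) = (\<Pi>\<^sub>M i\<in>{..<n}. distr P borel (incr t d i))"
    using indep_incr[OF assms(1,2), of n] assms
    by (subst indep_vars_iff_distr_eq_PiM'[symmetric]) (simp_all add: lessThan_empty_iff)
  then show ?thesis using assms by (simp only: distr_incr incrs_def[abs_def])
qed

text \<open>A coarse increment is the sum of two adjacent fine ones, so what is decided by the
  coarse grid is decided by the fine one.\<close>

lemma incrs_refine: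
  assumes "t \<ge> 0" "d \<ge> 0" "A \<in> sets (\<Pi>\<^sub>M i\<in>{..<n}. (borel :: 'v measure))"
  obtains B where "B \<in> sets (\<Pi>\<^sub>M i\<in>{..<2 * n}. (borel :: 'v measure))"
    "incrs t d n -` A \<inter> space P = incrs t (d / 2) (2 * n) -` B \<inter> space P"
proof -
  define g where "g = (\<lambda>\<xi> :: nat \<Rightarrow> 'v. \<lambda>i\<in>{..<n}. \<xi> (2 * i) + \<xi> (2 * i + 1))"
  have g: "g \<in> measurable (\<Pi>\<^sub>M i\<in>{..<2 * n}. borel) (\<Pi>\<^sub>M i\<in>{..<n}. borel)"
    unfolding g_def by (intro measurable_restrict borel_measurable_add measurable_component_singleton) auto
  have eq: "incrs t d n \<omega> = g (incrs t (d / 2) (2 * n) \<omega>)" for \<omega>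
  proof
    fix i
    have "incr t d i \<omega> = incr t (d / 2) (2 * i) \<omega> + incr t (d / 2) (2 * i + 1) \<omega>"
    proof -
      have 1: "t + real (Suc (2 * i + 1)) * (d / 2) = t + real (Suc i) * d" by (simp add: field_simps)
      have 2: "t + real (2 * i) * (d / 2) = t + real i * d" by simp
      define M where "M = W (t + real (Suc (2 * i)) * (d / 2)) \<omega>"
      have "incr t (d / 2) (2 * i) \<omega> = M - W (t + real i * d) \<omega>" unfolding incr_def M_def 2 ..
      moreover have "incr t (d / 2) (2 * i + 1) \<omega> = W (t + real (Suc i) * d) \<omega> - M"
        unfolding incr_def 1 M_def by (simp only: Suc_eq_plus1)
      ultimately show ?thesis by (simp only: incr_def[of t d]) simp
    qed
    then show "incrs t d n \<omega> i = g (incrs t (d / 2) (2 * n) \<omega>) i"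
      by (simp add: incrs_def g_def)
  qed
  have sp: "incrs t (d / 2) (2 * n) \<omega> \<in> space (\<Pi>\<^sub>M i\<in>{..<2 * n}. borel)" for \<omega>
    by (simp add: space_PiM incrs_def)
  show thesis
  proof (rule that)
    show "g -` A \<inter> space (\<Pi>\<^sub>M i\<in>{..<2 * n}. borel) \<in> sets (\<Pi>\<^sub>M i\<in>{..<2 * n}. borel)"
      using measurable_sets[OF g assms(3)] .
    show "incrs t d n -` A \<inter> space P = incrs t (d / 2) (2 * n) -` (g -` A \<inter> space (\<Pi>\<^sub>M i\<in>{..<2 * n}. borel)) \<inter> space P"
      using sp by (auto simp: eq)
  qed
qed

text \<open>Events decided by the increments between \<open>t\<close> and \<open>t + n * h\<close>
  at mesh \<open>h / 2 ^ m\<close>. Halving the mesh makes the grids nested, so these families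
  increase with \<open>m\<close> and their union is an intersection-stable generator.\<close>

definition dyadic_events :: "real \<Rightarrow> real \<Rightarrow> nat \<Rightarrow> nat \<Rightarrow> 'a set set" where
  "dyadic_events t h n m =
    {incrs t (h / 2 ^ m) (n * 2 ^ m) -` A \<inter> space P | A. A \<in> sets (\<Pi>\<^sub>M i\<in>{..<n * 2 ^ m}. borel)}"

lemma dyadic_events_mono:
  assumes "t \<ge> 0" "h \<ge> 0" "m \<le> m'" shows "dyadic_events t h n m \<subseteq> dyadic_events t h n m'"
  using assms(3)
proof (induction m' rule: dec_induct)
  case (step k)
  have "dyadic_events t h n k \<subseteq> dyadic_events t h n (Suc k)"
  proof
    fix E assume "E \<in> dyadic_events t h n k"
    then obtain A where A: "A \<in> sets (\<Pi>\<^sub>M i\<in>{..<n * 2 ^ k}. borel)"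
      "E = incrs t (h / 2 ^ k) (n * 2 ^ k) -` A \<inter> space P"
      by (auto simp: dyadic_events_def)
    have "h / 2 ^ k \<ge> 0" using assms by simp
    then obtain B where B: "B \<in> sets (\<Pi>\<^sub>M i\<in>{..<2 * (n * 2 ^ k)}. borel)"
      "E = incrs t (h / 2 ^ k / 2) (2 * (n * 2 ^ k)) -` B \<inter> space P"
      unfolding A(2) using incrs_refine[OF assms(1) _ A(1)] by metis
    have "2 * (n * 2 ^ k) = n * 2 ^ Suc k" "h / 2 ^ k / 2 = h / 2 ^ Suc k" by simp_all
    then show "E \<in> dyadic_events t h n (Suc k)"
      unfolding dyadic_events_def using B by (metis (mono_tags, lifting) mem_Collect_eq)
  qed
  with step show ?case by auto
qed simp

text \<open>Dyadic times carry enough information: by \<open>euler_tendsto\<close> below, \<open>X\<close> is a limit of Euler schemes along them.\<close>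
definition filt :: "real \<Rightarrow> nat \<Rightarrow> 'a measure" where
  "filt h j = sigma (space P) (\<Union>m. dyadic_events 0 h j m)"

lemma dyadic_events_subset_sets: "t \<ge> 0 \<Longrightarrow> h \<ge> 0 \<Longrightarrow> dyadic_events t h n m \<subseteq> sets P"
  unfolding dyadic_events_def by (auto intro!: measurable_sets[OF incrs_measurable])

lemma space_filt [simp]: "space (filt h j) = space P"
  by (simp add: filt_def space_measure_of_conv)

lemma sets_filt: "sets (filt h j) = sigma_sets (space P) (\<Union>m. dyadic_events 0 h j m)"
  unfolding filt_def by (rule sets_measure_of) (auto simp: dyadic_events_def)

lemma sets_filt_subset: "h \<ge> 0 \<Longrightarrow> sets (filt h j) \<subseteq> sets P"
  unfolding sets_filt using dyadic_events_subset_sets[of 0 h] by (intro sets.sigma_sets_subset) auto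

lemma incr_measurable_filt:
  assumes h: "h \<ge> 0" and i: "i < j * 2 ^ m"
  shows "incr 0 (h / 2 ^ m) i \<in> borel_measurable (filt h j)"
proof (rule measurableI)
  fix A :: "'v set" assume A: "A \<in> sets borel"
  let ?S = "\<Pi>\<^sub>M i\<in>{..<j * 2 ^ m}. (borel :: 'v measure)"
  have "(\<lambda>\<xi>. \<xi> i) -` A \<inter> space ?S \<in> sets ?S"
    using i A by (intro measurable_sets[OF measurable_component_singleton]) auto
  moreover have "incr 0 (h / 2 ^ m) i -` A \<inter> space P
      = incrs 0 (h / 2 ^ m) (j * 2 ^ m) -` ((\<lambda>\<xi>. \<xi> i) -` A \<inter> space ?S) \<inter> space P"
    using i by (auto simp: incrs_def space_PiM)
  ultimately have "incr 0 (h / 2 ^ m) i -` A \<inter> space P \<in> dyadic_events 0 h j m"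
    unfolding dyadic_events_def by blast
  then show "incr 0 (h / 2 ^ m) i -` A \<inter> space (filt h j) \<in> sets (filt h j)"
    by (auto simp: sets_filt)
qed simp

lemma sets_filt_mono:
  assumes h: "h \<ge> 0" and ij: "i \<le> j" shows "sets (filt h i) \<subseteq> sets (filt h j)"
proof -
  have "dyadic_events 0 h i m \<subseteq> sets (filt h j)" for m
  proof -
    have "incrs 0 (h / 2 ^ m) (i * 2 ^ m) \<in> measurable (filt h j) (\<Pi>\<^sub>M i\<in>{..<i * 2 ^ m}. borel)"
      unfolding incrs_def[abs_def]
      using h ij by (intro measurable_restrict incr_measurable_filt) (auto intro: less_le_trans)
    from measurable_sets[OF this] show ?thesis by (auto simp: dyadic_events_def)
  qed
  then show ?thesis
    unfolding sets_filt[of h i] using sets.sigma_sets_subset[of _ "filt h j"] by (simp add: UN_least)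
qed

text \<open>At a common mesh, past and future are read off from disjoint blocks of indices of a
  single independent family of increments started at time 0.\<close>

lemma indep_past_future_level:
  assumes h: "h > 0" and A: "A \<in> dyadic_events 0 h j m" and B: "B \<in> dyadic_events (real j * h) h 1 m"
  shows "prob (A \<inter> B) = prob A * prob B"
proof -
  let ?d = "h / 2 ^ m" and ?n = "j * 2 ^ m"
  let ?I = "{..<?n}" and ?J = "{?n..<?n + 2 ^ m}"
  obtain A' where A': "A' \<in> sets (\<Pi>\<^sub>M i\<in>?I. borel)" "A = incrs 0 ?d ?n -` A' \<inter> space P"
    using A by (auto simp: dyadic_events_def)
  obtain B' where B': "B' \<in> sets (\<Pi>\<^sub>M i\<in>{..<2 ^ m}. borel)" "B = incrs (real j * h) ?d (2 ^ m) -` B' \<inter> space P"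
    using B by (auto simp: dyadic_events_def)
  define g where "g = (\<lambda>\<xi> :: nat \<Rightarrow> 'v. \<lambda>i\<in>{..<2 ^ m}. \<xi> (?n + i))"
  have g: "g \<in> measurable (\<Pi>\<^sub>M i\<in>?J. borel) (\<Pi>\<^sub>M i\<in>{..<2 ^ m}. borel)"
    unfolding g_def by (intro measurable_restrict measurable_component_singleton) auto
  have "indep_vars (\<lambda>_. borel) (incr 0 ?d) {..<?n + 2 ^ m}" using h by (intro indep_incr) auto
  then have ind: "indep_var (PiM ?I (\<lambda>_. borel)) (\<lambda>\<omega>. restrict (\<lambda>i. incr 0 ?d i \<omega>) ?I)
      (PiM ?J (\<lambda>_. borel)) (\<lambda>\<omega>. restrict (\<lambda>i. incr 0 ?d i \<omega>) ?J)"
    by (rule indep_var_restrict) auto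
  have eq: "incrs (real j * h) ?d (2 ^ m) \<omega> = g (restrict (\<lambda>i. incr 0 ?d i \<omega>) ?J)" for \<omega>
  proof -
    \<comment> \<open>The grid started at \<open>j * h\<close> is the grid started at 0 with indices
      shifted by \<open>j * 2 ^ m\<close>.\<close>
    have "real j * h + real i * ?d = 0 + real (?n + i) * ?d" for i by (simp add: field_simps)
    from this[of "Suc _"] this show ?thesis unfolding incrs_def g_def incr_def by (auto simp: fun_eq_iff simp del: of_nat_add)
  qed
  define U V where "U \<omega> = restrict (\<lambda>i. incr 0 ?d i \<omega>) ?I" and "V \<omega> = restrict (\<lambda>i. incr 0 ?d i \<omega>) ?J" for \<omega>
  define S where "S = (\<Pi>\<^sub>M i\<in>?J. (borel :: 'v measure))"
  have UV: "V \<omega> \<in> space S" for \<omega> by (simp add: S_def space_PiM V_def)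
  have A'': "A = U -` A' \<inter> space P" by (simp add: A'(2) U_def[abs_def] incrs_def[abs_def])
  have B'': "B = V -` (g -` B' \<inter> space S) \<inter> space P" using UV unfolding B'(2) eq V_def[symmetric] by auto
  have "prob ((\<lambda>\<omega>. (U \<omega>, V \<omega>)) -` (A' \<times> (g -` B' \<inter> space S)) \<inter> space P)
    = prob (U -` A' \<inter> space P) * prob (V -` (g -` B' \<inter> space S) \<inter> space P)"
    using indep_varD[OF ind A'(1) measurable_sets[OF g B'(1)]] unfolding U_def V_def S_def .
  moreover have "(\<lambda>\<omega>. (U \<omega>, V \<omega>)) -` (A' \<times> (g -` B' \<inter> space S)) \<inter> space P = A \<inter> B"
    unfolding A'' B'' by auto
  ultimately show ?thesis unfolding A'' B'' by (simp only:)
qed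

lemma Int_stable_dyadic_events: "Int_stable (dyadic_events t h n m)"
proof (rule Int_stableI)
  fix A B assume "A \<in> dyadic_events t h n m" "B \<in> dyadic_events t h n m"
  then obtain A' B' where *: "A' \<in> sets (\<Pi>\<^sub>M i\<in>{..<n * 2 ^ m}. borel)" "B' \<in> sets (\<Pi>\<^sub>M i\<in>{..<n * 2 ^ m}. borel)"
    "A = incrs t (h / 2 ^ m) (n * 2 ^ m) -` A' \<inter> space P" "B = incrs t (h / 2 ^ m) (n * 2 ^ m) -` B' \<inter> space P"
    by (auto simp: dyadic_events_def)
  then have "A' \<inter> B' \<in> sets (\<Pi>\<^sub>M i\<in>{..<n * 2 ^ m}. borel)" "A \<inter> B = incrs t (h / 2 ^ m) (n * 2 ^ m) -` (A' \<inter> B') \<inter> space P"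
    by auto
  then show "A \<inter> B \<in> dyadic_events t h n m" unfolding dyadic_events_def by blast
qed

text \<open>Events of two different meshes are both events of the finer one, which gives
  independence on generators; intersection stability extends it to the generated past. The future is
  kept at one mesh, since it will drive one Euler scheme at a time.\<close>

lemma indep_past_future:
  assumes h: "h > 0"
  shows "indep_set (sets (filt h j)) (dyadic_events (real j * h) h 1 m)"
proof -
  let ?G = "\<Union>m. dyadic_events 0 h j m" and ?H = "dyadic_events (real j * h) h 1 m"
  have "indep_set ?G ?H"
  proof (rule indep_setI)
    show "?G \<subseteq> sets P" using h dyadic_events_subset_sets[of 0 h] by auto
    show "?H \<subseteq> sets P" using h by (intro dyadic_events_subset_sets) auto
    fix A B assume "A \<in> ?G" "B \<in> ?H"
    then obtain m' where A: "A \<in> dyadic_events 0 h j m'" and B: "B \<in> ?H" by auto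
    have "A \<in> dyadic_events 0 h j (max m m')" "B \<in> dyadic_events (real j * h) h 1 (max m m')"
      using A B dyadic_events_mono[of 0 h m' "max m m'" j] dyadic_events_mono[of "real j * h" h m "max m m'" 1] h by auto
    then show "prob (A \<inter> B) = prob A * prob B" using indep_past_future_level[OF h] by blast
  qed
  moreover have "Int_stable ?G"
  proof (rule Int_stableI)
    fix A B assume "A \<in> ?G" "B \<in> ?G"
    then obtain k l where "A \<in> dyadic_events 0 h j k" "B \<in> dyadic_events 0 h j l" by auto
    then have "A \<in> dyadic_events 0 h j (max k l)" "B \<in> dyadic_events 0 h j (max k l)"
      using dyadic_events_mono[of 0 h k "max k l" j] dyadic_events_mono[of 0 h l "max k l" j] h by auto
    then have "A \<inter> B \<in> dyadic_events 0 h j (max k l)"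
      by (rule Int_stableD[OF Int_stable_dyadic_events])
    then show "A \<inter> B \<in> ?G" by (rule UN_I[OF UNIV_I])
  qed
  ultimately have *: "indep_set (sigma_sets (space P) ?G) (sigma_sets (space P) ?H)"
    using Int_stable_dyadic_events by (intro indep_set_sigma_sets)
  then show ?thesis
    unfolding indep_sets2_eq sets_filt by (auto intro: sigma_sets.Basic)
qed

text \<open>The first component is the sample point itself, seen only through events of the past, so
  that any functional of the past can be substituted later.\<close>

lemma distr_past_future:
  fixes j m :: nat
  assumes h: "h > 0"
  defines "V \<equiv> incrs (real j * h) (h / 2 ^ m) (2 ^ m)" and "S \<equiv> \<Pi>\<^sub>M i\<in>{..<2 ^ m :: nat}. (borel :: 'v measure)"
  shows "distr P (filt h j \<Otimes>\<^sub>M S) (\<lambda>\<omega>. (\<omega>, V \<omega>)) = distr P (filt h j) (\<lambda>\<omega>. \<omega>) \<Otimes>\<^sub>M (\<Pi>\<^sub>M i\<in>{..<2 ^ m}. gauss (h / 2 ^ m))"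
proof -
  have id: "(\<lambda>\<omega>. \<omega>) \<in> measurable P (filt h j)"
    using h sets_filt_subset[of h j] by (auto intro!: measurableI)
  have V: "V \<in> measurable P S" unfolding V_def S_def using h by (intro incrs_measurable) auto
  have D: "(\<Pi>\<^sub>M i\<in>{..<2 ^ m}. gauss (h / 2 ^ m)) = distr P S V"
    unfolding V_def S_def using h by (intro distr_incrs[symmetric]) auto
  interpret X: prob_space "distr P (filt h j) (\<lambda>\<omega>. \<omega>)" by (rule prob_space_distr[OF id])
  interpret Y: prob_space "distr P S V" by (rule prob_space_distr[OF V])
  have pair: "(\<lambda>\<omega>. (\<omega>, V \<omega>)) \<in> measurable P (filt h j \<Otimes>\<^sub>M S)" using id V by measurable
  show ?thesis unfolding D
  proof (rule pair_measure_eqI[symmetric])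
    show "sigma_finite_measure (distr P (filt h j) (\<lambda>\<omega>. \<omega>))" "sigma_finite_measure (distr P S V)" ..
    fix A B assume "A \<in> sets (distr P (filt h j) (\<lambda>\<omega>. \<omega>))" "B \<in> sets (distr P S V)"
    then have A: "A \<in> sets (filt h j)" and B: "B \<in> sets S" by auto
    have A': "A \<in> sets P" "A \<subseteq> space P" using A h sets_filt_subset[of h j] sets.sets_into_space[OF A] by auto
    have B': "V -` B \<inter> space P \<in> dyadic_events (real j * h) h 1 m"
      using B unfolding dyadic_events_def V_def S_def by auto
    have "prob (A \<inter> (V -` B \<inter> space P)) = prob A * prob (V -` B \<inter> space P)"
      using indep_past_future[OF h] A B' by (auto simp: indep_sets2_eq)
    moreover have "(\<lambda>\<omega>. (\<omega>, V \<omega>)) -` (A \<times> B) \<inter> space P = A \<inter> (V -` B \<inter> space P)"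
      using A' by auto
    moreover have "(\<lambda>\<omega>. \<omega>) -` A \<inter> space P = A" using A' by auto
    ultimately show "emeasure (distr P (filt h j) (\<lambda>\<omega>. \<omega>)) A * emeasure (distr P S V) B =
        emeasure (distr P (filt h j \<Otimes>\<^sub>M S) (\<lambda>\<omega>. (\<omega>, V \<omega>))) (A \<times> B)"
      using A B id V pair by (simp add: emeasure_distr emeasure_eq_measure ennreal_mult'')
  qed (simp add: S_def)
qed

text \<open>The past is frozen and the future increments are integrated out, which takes the place
  of conditioning on the past.\<close>

lemma nn_integral_past_future:
  assumes h: "h > 0"
    and G [measurable]: "G \<in> borel_measurable (filt h j \<Otimes>\<^sub>M (\<Pi>\<^sub>M i\<in>{..<2 ^ m :: nat}. (borel :: 'v measure)))"
  shows "(\<integral>\<^sup>+ \<omega>. G (\<omega>, incrs (real j * h) (h / 2 ^ m) (2 ^ m) \<omega>) \<partial>P)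
    = (\<integral>\<^sup>+ \<omega>. \<integral>\<^sup>+ \<xi>. G (\<omega>, \<xi>) \<partial>(\<Pi>\<^sub>M i\<in>{..<2 ^ m}. gauss (h / 2 ^ m)) \<partial>P)"
proof -
  let ?S = "\<Pi>\<^sub>M i\<in>{..<2 ^ m :: nat}. (borel :: 'v measure)" and ?V = "incrs (real j * h) (h / 2 ^ m) (2 ^ m)"
  let ?N = "\<Pi>\<^sub>M i\<in>{..<2 ^ m :: nat}. (gauss (h / 2 ^ m) :: 'v measure)"
  have id: "(\<lambda>\<omega>. \<omega>) \<in> measurable P (filt h j)"
    using h sets_filt_subset[of h j] by (auto intro!: measurableI)
  have V: "?V \<in> measurable P ?S" using h by (intro incrs_measurable) auto
  have N: "sets ?N = sets ?S" by (intro sets_PiM_cong) auto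
  interpret N: prob_space ?N using h by (intro prob_space_PiM prob_space_gauss) auto
  have pair: "(\<lambda>\<omega>. (\<omega>, ?V \<omega>)) \<in> measurable P (filt h j \<Otimes>\<^sub>M ?S)" by (rule measurable_Pair[OF id V])
  have GN: "G \<in> borel_measurable (filt h j \<Otimes>\<^sub>M ?N)"
    using G measurable_cong_sets[OF sets_pair_measure_cong[OF refl[of "sets (filt h j)"] N] refl[of "sets borel"]] by auto
  have GD: "G \<in> borel_measurable (distr P (filt h j) (\<lambda>\<omega>. \<omega>) \<Otimes>\<^sub>M ?N)"
    using GN measurable_cong_sets[OF sets_pair_measure_cong[OF sets_distr[of P "filt h j" "\<lambda>\<omega>. \<omega>"] refl[of "sets ?N"]] refl[of "sets borel"]] by auto
  have "(\<integral>\<^sup>+ \<omega>. G (\<omega>, ?V \<omega>) \<partial>P) = (\<integral>\<^sup>+ x. G x \<partial>distr P (filt h j \<Otimes>\<^sub>M ?S) (\<lambda>\<omega>. (\<omega>, ?V \<omega>)))"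
    by (subst nn_integral_distr[OF pair]) (simp_all add: G)
  also have "\<dots> = (\<integral>\<^sup>+ x. G x \<partial>(distr P (filt h j) (\<lambda>\<omega>. \<omega>) \<Otimes>\<^sub>M ?N))"
    by (simp only: distr_past_future[OF h])
  also have "\<dots> = (\<integral>\<^sup>+ \<omega>. \<integral>\<^sup>+ \<xi>. G (\<omega>, \<xi>) \<partial>?N \<partial>distr P (filt h j) (\<lambda>\<omega>. \<omega>))"
    by (rule N.nn_integral_fst[symmetric, OF GD])
  also have "\<dots> = (\<integral>\<^sup>+ \<omega>. \<integral>\<^sup>+ \<xi>. G (\<omega>, \<xi>) \<partial>?N \<partial>P)"
    using N.borel_measurable_nn_integral_fst[OF GN] by (subst nn_integral_distr[OF id]) simp_all
  finally show ?thesis .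
qed

end

section \<open>Markov property of the solution\<close>

lemma borel_measurable_euler:
  fixes b :: "'v::euclidean_space \<Rightarrow> 'v"
  assumes b [measurable]: "b \<in> borel_measurable borel" and z [measurable]: "z \<in> borel_measurable M"
    and \<xi>: "\<And>i. i < k \<Longrightarrow> (\<lambda>x. \<xi> x i) \<in> borel_measurable M"
  shows "(\<lambda>x. euler b d (\<xi> x) (z x) k) \<in> borel_measurable M"
  using \<xi>
proof (induction k)
  case (Suc k)
  have [measurable]: "(\<lambda>x. euler b d (\<xi> x) (z x) k) \<in> borel_measurable M" "(\<lambda>x. \<xi> x k) \<in> borel_measurable M"
    using Suc by auto
  show ?case by simp
qed simp

section \<open>Pathwise Euler approximation and its consequences\<close>

locale lipschitz_sde = brownian P W
  for P :: "'a measure" and W :: "real \<Rightarrow> 'a \<Rightarrow> 'v::euclidean_space" +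
  fixes b :: "'v \<Rightarrow> 'v" and K :: real and X :: "'v \<Rightarrow> real \<Rightarrow> 'a \<Rightarrow> 'v"
  assumes lip: "\<And>x y. norm (b x - b y) \<le> K * norm (x - y)"
    and K: "K \<ge> 0"
    and sol: "\<And>x. sde_solution P b W x (X x)"
begin

lemma b_continuous: "continuous_on S b"
  by (rule continuous_on_subset[OF lipschitz_on_continuous_on[of K UNIV b]])
     (auto simp: lipschitz_on_def dist_norm lip K)

lemma b_measurable [measurable]: "b \<in> borel_measurable borel"
  by (rule borel_measurable_continuous_onI[OF b_continuous])

lemma X_continuous: "\<omega> \<in> space P \<Longrightarrow> continuous_on {0..} (\<lambda>t. X x t \<omega>)"
  using sol[of x] by (simp add: sde_solution_def)

lemma X_eq: "\<omega> \<in> space P \<Longrightarrow> t \<ge> 0 \<Longrightarrow> X x t \<omega> = x + integral {0..t} (\<lambda>s. b (X x s \<omega>)) + W t \<omega>"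
  using sol[of x] by (simp add: sde_solution_def)

lemma X_0: "\<omega> \<in> space P \<Longrightarrow> X x 0 \<omega> = x"
  by (simp add: X_eq W_0)

lemma drift_continuous: "\<omega> \<in> space P \<Longrightarrow> S \<subseteq> {0..} \<Longrightarrow> continuous_on S (\<lambda>s. b (X x s \<omega>))"
  by (rule continuous_on_compose2[OF b_continuous continuous_on_subset[OF X_continuous]]) auto

lemma X_increment:
  assumes \<omega>: "\<omega> \<in> space P" and st: "0 \<le> s" "s \<le> t"
  shows "X x t \<omega> - X x s \<omega> = integral {s..t} (\<lambda>r. b (X x r \<omega>)) + (W t \<omega> - W s \<omega>)"
proof -
  have "integral {0..s} (\<lambda>r. b (X x r \<omega>)) + integral {s..t} (\<lambda>r. b (X x r \<omega>)) = integral {0..t} (\<lambda>r. b (X x r \<omega>))"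
    using st by (intro Henstock_Kurzweil_Integration.integral_combine integrable_continuous_interval drift_continuous[OF \<omega>]) auto
  then show ?thesis using X_eq[OF \<omega>, of s x] X_eq[OF \<omega>, of t x] st by (simp add: algebra_simps)
qed

text \<open>The additive noise cancels exactly in the difference. The only error source is freezing
  the drift over one step, which is controlled by the oscillation \<open>e\<close> of the solution
  path itself; Gronwall accumulates it.\<close>

lemma euler_error:
  assumes \<omega>: "\<omega> \<in> space P" and t: "t \<ge> 0" and d: "d \<ge> 0"
    and e: "\<And>r s. r \<in> {t..t + real N * d} \<Longrightarrow> s \<in> {t..t + real N * d} \<Longrightarrow> \<bar>r - s\<bar> \<le> d \<Longrightarrow> norm (X x r \<omega> - X x s \<omega>) \<le> e"
    and e0: "e \<ge> 0"
  shows "norm (X x (t + real N * d) \<omega> - euler b d (\<lambda>i. incr t d i \<omega>) (X x t \<omega>) N) \<le> real N * d * K * e * exp (real N * d * K)"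
proof -
  define y where "y k = euler b d (\<lambda>i. incr t d i \<omega>) (X x t \<omega>) k" for k
  define a where "a k = norm (X x (t + real k * d) \<omega> - y k)" for k
  have step: "a (Suc k) \<le> (1 + d * K) * a k + d * (K * e)" if k: "k < N" for k
  proof -
    let ?s = "t + real k * d" and ?r = "t + real (Suc k) * d"
    have sr: "0 \<le> ?s" "?s \<le> ?r" "?r - ?s = d" using t d by (auto simp: algebra_simps)
    have rN: "?r \<le> t + real N * d" using k d by (intro add_left_mono mult_right_mono) auto
    have ts: "t \<le> ?s" using d by simp
    have int: "(\<lambda>r. b (X x r \<omega>)) integrable_on {?s..?r}"
      using sr by (intro integrable_continuous_interval drift_continuous[OF \<omega>]) auto
    have eq: "X x ?r \<omega> - y (Suc k) = (X x ?s \<omega> - y k) + integral {?s..?r} (\<lambda>r. b (X x r \<omega>) - b (y k))"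
    proof -
      have "integral {?s..?r} (\<lambda>r. b (X x r \<omega>) - b (y k)) = integral {?s..?r} (\<lambda>r. b (X x r \<omega>)) - d *\<^sub>R b (y k)"
        using int sr by (subst Henstock_Kurzweil_Integration.integral_diff) auto
      moreover have "X x ?r \<omega> - X x ?s \<omega> = integral {?s..?r} (\<lambda>r. b (X x r \<omega>)) + (W ?r \<omega> - W ?s \<omega>)"
        using \<omega> sr by (intro X_increment) auto
      ultimately show ?thesis by (simp add: y_def incr_def algebra_simps)
    qed
    have "norm (integral {?s..?r} (\<lambda>r. b (X x r \<omega>) - b (y k))) \<le> (K * (e + a k)) * (?r - ?s)"
    proof (rule integral_bound)
      show "continuous_on {?s..?r} (\<lambda>r. b (X x r \<omega>) - b (y k))"
        using sr by (intro continuous_on_diff drift_continuous[OF \<omega>] continuous_on_const) auto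
      fix r assume r: "r \<in> {?s..?r}"
      have "norm (b (X x r \<omega>) - b (y k)) \<le> K * norm (X x r \<omega> - y k)" by (rule lip)
      also have "norm (X x r \<omega> - y k) \<le> norm (X x r \<omega> - X x ?s \<omega>) + norm (X x ?s \<omega> - y k)"
        using norm_triangle_ineq[of "X x r \<omega> - X x ?s \<omega>" "X x ?s \<omega> - y k"] by simp
      also have "norm (X x r \<omega> - X x ?s \<omega>) \<le> e"
      proof (rule e)
        have "?s \<le> r" "r \<le> ?r" using r by simp_all
        then show "r \<in> {t..t + real N * d}" "?s \<in> {t..t + real N * d}"
          using order_trans[OF ts \<open>?s \<le> r\<close>] order_trans[OF \<open>r \<le> ?r\<close> rN] order_trans[OF sr(2) rN] ts by simp_all
        show "\<bar>r - ?s\<bar> \<le> d" using \<open>?s \<le> r\<close> \<open>r \<le> ?r\<close> sr(3) by linarith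
      qed
      finally show "norm (b (X x r \<omega>) - b (y k)) \<le> K * (e + a k)"
        using K by (simp add: a_def mult_left_mono)
    qed (use sr in auto)
    then have "norm (integral {?s..?r} (\<lambda>r. b (X x r \<omega>) - b (y k))) \<le> d * (K * (e + a k))"
      unfolding sr(3) by (simp only: mult_ac)
    moreover have "a (Suc k) \<le> a k + norm (integral {?s..?r} (\<lambda>r. b (X x r \<omega>) - b (y k)))"
      unfolding a_def eq by (rule norm_triangle_ineq)
    ultimately show ?thesis by (simp add: algebra_simps)
  qed
  have a0: "a 0 = 0" by (simp add: a_def y_def)
  have "a N \<le> (a 0 + real N * (d * (K * e))) * exp (real N * (d * K))"
    by (rule discrete_gronwall[where n=N]) (use step d K e0 a0 in auto)
  then show ?thesis by (simp add: a0 a_def y_def mult_ac)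
qed

text \<open>A path is uniformly continuous on the compact time interval, so its oscillation over one
  step vanishes with the mesh. The argument works for every path, without an exceptional null
  set.\<close>

lemma euler_tendsto:
  assumes \<omega>: "\<omega> \<in> space P" and t: "t \<ge> 0" and h: "h \<ge> 0"
  shows "(\<lambda>m. euler b (h / 2 ^ m) (\<lambda>i. incr t (h / 2 ^ m) i \<omega>) (X x t \<omega>) (n * 2 ^ m)) \<longlonglongrightarrow> X x (t + real n * h) \<omega>"
proof (rule LIMSEQ_I)
  fix r :: real assume r: "r > 0"
  define T where "T = real n * h"
  have T: "T \<ge> 0" using h by (simp add: T_def)
  define C where "C = T * K * exp (T * K)"
  have C: "C \<ge> 0" using T K by (simp add: C_def)
  define e where "e = r / (C + 1)"
  have e: "e > 0" "C * e < r" using r C by (auto simp: e_def field_simps)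
  have "uniformly_continuous_on {t..t + T} (\<lambda>s. X x s \<omega>)"
    using t by (intro compact_uniformly_continuous continuous_on_subset[OF X_continuous[OF \<omega>]]) auto
  then obtain \<delta> where \<delta>: "\<delta> > 0" "\<And>s s'. s \<in> {t..t + T} \<Longrightarrow> s' \<in> {t..t + T} \<Longrightarrow> dist s' s < \<delta> \<Longrightarrow> dist (X x s' \<omega>) (X x s \<omega>) < e"
    using e(1) unfolding uniformly_continuous_on_def by metis
  have "(\<lambda>m. h * (1 / 2) ^ m) \<longlonglongrightarrow> h * 0"
    by (intro tendsto_mult_left LIMSEQ_power_zero) simp
  then have "\<forall>\<^sub>F m in sequentially. h / 2 ^ m < \<delta>"
    using \<delta>(1) by (auto simp: power_one_over dest!: order_tendstoD(2))
  then obtain m0 where m0: "\<And>m. m \<ge> m0 \<Longrightarrow> h / 2 ^ m < \<delta>" by (auto simp: eventually_sequentially)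
  show "\<exists>m0. \<forall>m\<ge>m0. norm (euler b (h / 2 ^ m) (\<lambda>i. incr t (h / 2 ^ m) i \<omega>) (X x t \<omega>) (n * 2 ^ m) - X x (t + real n * h) \<omega>) < r"
  proof (intro exI allI impI)
    fix m assume "m \<ge> m0"
    let ?d = "h / 2 ^ m" and ?N = "n * 2 ^ m"
    have N: "real ?N * ?d = T" by (simp add: T_def)
    have "norm (X x (t + real ?N * ?d) \<omega> - euler b ?d (\<lambda>i. incr t ?d i \<omega>) (X x t \<omega>) ?N) \<le> real ?N * ?d * K * e * exp (real ?N * ?d * K)"
    proof (rule euler_error[OF \<omega> t])
      fix s s' assume "s \<in> {t..t + real ?N * ?d}" "s' \<in> {t..t + real ?N * ?d}" "\<bar>s - s'\<bar> \<le> ?d"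
      then show "norm (X x s \<omega> - X x s' \<omega>) \<le> e"
        using \<delta>(2)[of s' s] m0[OF \<open>m \<ge> m0\<close>] unfolding N by (simp add: dist_norm)
    qed (use h e in auto)
    also have "\<dots> = C * e" unfolding N C_def by simp
    also have "\<dots> < r" by (rule e)
    finally show "norm (euler b ?d (\<lambda>i. incr t ?d i \<omega>) (X x t \<omega>) ?N - X x (t + real n * h) \<omega>) < r"
      unfolding N T_def by (simp add: norm_minus_commute)
  qed
qed

lemma euler_tendsto_start:
  "\<omega> \<in> space P \<Longrightarrow> h \<ge> 0 \<Longrightarrow>
    (\<lambda>m. euler b (h / 2 ^ m) (\<lambda>i. incr 0 (h / 2 ^ m) i \<omega>) x (n * 2 ^ m)) \<longlonglongrightarrow> X x (real n * h) \<omega>"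
  using euler_tendsto[of \<omega> 0 h x n] by (simp add: X_0)

text \<open>\<open>sde_solution\<close> says nothing about measurability, neither in the sample
  point nor in the starting point. Both are inherited from the Euler schemes, together with
  adaptedness to \<open>filt\<close>.\<close>

lemma X_measurable_filt_pair:
  assumes h: "h \<ge> 0"
  shows "(\<lambda>(\<omega>, x). X x (real j * h) \<omega>) \<in> borel_measurable (filt h j \<Otimes>\<^sub>M borel)"
proof (rule borel_measurable_LIMSEQ_metric)
  show "(\<lambda>(\<omega>, x). euler b (h / 2 ^ m) (\<lambda>i. incr 0 (h / 2 ^ m) i \<omega>) x (j * 2 ^ m)) \<in> borel_measurable (filt h j \<Otimes>\<^sub>M borel)" for m
    unfolding split_beta'
    by (intro borel_measurable_euler b_measurable measurable_snd measurable_compose[OF measurable_fst incr_measurable_filt[OF h]])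
  show "(\<lambda>m. (case p of (\<omega>, x) \<Rightarrow> euler b (h / 2 ^ m) (\<lambda>i. incr 0 (h / 2 ^ m) i \<omega>) x (j * 2 ^ m)))
      \<longlonglongrightarrow> (case p of (\<omega>, x) \<Rightarrow> X x (real j * h) \<omega>)"
    if "p \<in> space (filt h j \<Otimes>\<^sub>M borel)" for p
    using that h by (auto simp: space_pair_measure intro!: euler_tendsto_start)
qed

lemma X_measurable_pair:
  assumes t: "t \<ge> 0"
  shows "(\<lambda>(\<omega>, x). X x t \<omega>) \<in> borel_measurable (P \<Otimes>\<^sub>M borel)"
proof -
  \<comment> \<open>Every time \<open>t\<close> is a grid time: take \<open>t\<close> itself as the
    step and \<open>j = 1\<close>.\<close>
  have id: "(\<lambda>\<omega>. \<omega>) \<in> measurable P (filt t 1)"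
    using sets_filt_subset[OF t, of 1] by (auto intro!: measurableI)
  have "(\<lambda>p. (fst p, snd p)) \<in> measurable (P \<Otimes>\<^sub>M borel) (filt t 1 \<Otimes>\<^sub>M (borel :: 'v measure))"
    by (intro measurable_Pair measurable_compose[OF measurable_fst id] measurable_snd)
  from measurable_compose[OF this X_measurable_filt_pair[OF t, of 1]] show ?thesis by (simp add: split_beta')
qed

lemma X_measurable [measurable (raw)]:
  assumes "f \<in> measurable M P" "g \<in> borel_measurable M" "t \<ge> 0"
  shows "(\<lambda>x. X (g x) t (f x)) \<in> borel_measurable M"
  using measurable_compose[OF measurable_Pair[OF assms(1,2)] X_measurable_pair[OF assms(3)]] by simp

lemma X_measurable_filt: "h \<ge> 0 \<Longrightarrow> X x (real j * h) \<in> borel_measurable (filt h j)"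
  using measurable_compose[OF measurable_Pair2'[of x borel "filt h j"] X_measurable_filt_pair[of h j]] by simp

lemma nn_integral_euler:
  assumes t: "t \<ge> 0" and d: "d > 0" and N: "N > 0" and f [measurable]: "f \<in> borel_measurable borel"
  shows "(\<integral>\<^sup>+ \<omega>. f (euler b d (\<lambda>i. incr t d i \<omega>) z N) \<partial>P) = (\<integral>\<^sup>+ \<xi>. f (euler b d \<xi> z N) \<partial>(\<Pi>\<^sub>M i\<in>{..<N}. gauss d))"
proof -
  have "(\<lambda>\<xi>. euler b d \<xi> z N) \<in> borel_measurable (\<Pi>\<^sub>M i\<in>{..<N}. borel)"
    by (rule borel_measurable_euler) auto
  from measurable_compose[OF this f]
  have "(\<integral>\<^sup>+ \<xi>. f (euler b d \<xi> z N) \<partial>distr P (\<Pi>\<^sub>M i\<in>{..<N}. borel) (incrs t d N)) = (\<integral>\<^sup>+ \<omega>. f (euler b d (incrs t d N \<omega>) z N) \<partial>P)"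
    using t d by (subst nn_integral_distr[OF incrs_measurable]) auto
  moreover have "euler b d (incrs t d N \<omega>) z N = euler b d (\<lambda>i. incr t d i \<omega>) z N" for \<omega>
    by (rule euler_cong) (simp add: incrs_def)
  ultimately show ?thesis by (simp only: distr_incrs[OF t d N])
qed

lemma euler_integral_tendsto:
  assumes h: "h > 0" and g: "continuous_on UNIV g" "\<And>x. 0 \<le> g x" "\<And>x. g x \<le> (1::real)"
  shows "(\<lambda>m. \<integral>\<^sup>+ \<omega>. ennreal (g (euler b (h / 2 ^ m) (\<lambda>i. incr 0 (h / 2 ^ m) i \<omega>) z (2 ^ m))) \<partial>P)
    \<longlonglongrightarrow> (\<integral>\<^sup>+ \<omega>. ennreal (g (X z h \<omega>)) \<partial>P)"
proof (rule nn_integral_dominated_convergence[where w="\<lambda>_. 1"])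
  have ic: "isCont g y" for y using g(1) by (simp add: continuous_on_eq_continuous_at)
  have [measurable]: "g \<in> borel_measurable borel" using g(1) by (rule borel_measurable_continuous_onI)
  have [measurable]: "(\<lambda>\<omega>. euler b (h / 2 ^ m) (\<lambda>i. incr 0 (h / 2 ^ m) i \<omega>) z (2 ^ m)) \<in> borel_measurable P" for m
    using h by (intro borel_measurable_euler b_measurable incr_measurable) auto
  show "(\<lambda>\<omega>. ennreal (g (euler b (h / 2 ^ m) (\<lambda>i. incr 0 (h / 2 ^ m) i \<omega>) z (2 ^ m)))) \<in> borel_measurable P" for m
    by measurable
  show "(\<lambda>\<omega>. ennreal (g (X z h \<omega>))) \<in> borel_measurable P" using h by simp
  show "AE \<omega> in P. (\<lambda>m. ennreal (g (euler b (h / 2 ^ m) (\<lambda>i. incr 0 (h / 2 ^ m) i \<omega>) z (2 ^ m)))) \<longlonglongrightarrow> ennreal (g (X z h \<omega>))"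
  proof (rule AE_I2)
    fix \<omega> assume "\<omega> \<in> space P"
    then have "(\<lambda>m. euler b (h / 2 ^ m) (\<lambda>i. incr 0 (h / 2 ^ m) i \<omega>) z (2 ^ m)) \<longlonglongrightarrow> X z h \<omega>"
      using euler_tendsto_start[of \<omega> h z 1] h by simp
    then show "(\<lambda>m. ennreal (g (euler b (h / 2 ^ m) (\<lambda>i. incr 0 (h / 2 ^ m) i \<omega>) z (2 ^ m)))) \<longlonglongrightarrow> ennreal (g (X z h \<omega>))"
      by (intro tendsto_ennrealI isCont_tendsto_compose[OF ic])
  qed
qed (use g in \<open>auto simp: emeasure_space_1\<close>)

text \<open>Over the last step \<open>X\<close> is replaced by the Euler scheme started at
  \<open>Y\<close>. At each mesh the identity is an instance of
  \<open>nn_integral_past_future\<close>; continuity and boundedness of \<open>g\<close> let both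
  sides converge by dominated convergence.\<close>

lemma markov_continuous:
  assumes h: "h > 0" and A: "A \<in> sets (filt h j)"
    and g: "continuous_on UNIV g" "\<And>x. 0 \<le> g x" "\<And>x. g x \<le> (1::real)"
  shows "(\<integral>\<^sup>+ \<omega>. indicator A \<omega> * ennreal (g (X x (real (Suc j) * h) \<omega>)) \<partial>P)
    = (\<integral>\<^sup>+ \<omega>. indicator A \<omega> * (\<integral>\<^sup>+ \<omega>'. ennreal (g (X (X x (real j * h) \<omega>) h \<omega>')) \<partial>P) \<partial>P)"
proof -
  define Y where "Y = X x (real j * h)"
  have Y [measurable]: "Y \<in> borel_measurable (filt h j)" unfolding Y_def using h by (intro X_measurable_filt) simp
  have A' [measurable]: "A \<in> sets P" using A h sets_filt_subset[of h j] by auto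
  note A [measurable]
  have YP [measurable]: "Y \<in> borel_measurable P" unfolding Y_def using h by simp
  have [measurable]: "g \<in> borel_measurable borel" using g(1) by (rule borel_measurable_continuous_onI)
  define d where "d m = h / 2 ^ m" for m :: nat
  have d: "d m > 0" for m using h by (simp add: d_def)
  have ic: "isCont g y" for y using g(1) by (simp add: continuous_on_eq_continuous_at)
  have jh: "real (Suc j) * h = real j * h + real 1 * h" by (simp add: algebra_simps)
  have E1 [measurable]: "(\<lambda>\<omega>. euler b (d m) (\<lambda>i. incr (real j * h) (d m) i \<omega>) (Y \<omega>) (2 ^ m)) \<in> borel_measurable P" for m
    using h d[of m] by (intro borel_measurable_euler b_measurable incr_measurable YP) auto
  have "(\<lambda>m. \<integral>\<^sup>+ \<omega>. indicator A \<omega> * ennreal (g (euler b (d m) (\<lambda>i. incr (real j * h) (d m) i \<omega>) (Y \<omega>) (2 ^ m))) \<partial>P)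
     \<longlonglongrightarrow> (\<integral>\<^sup>+ \<omega>. indicator A \<omega> * ennreal (g (X x (real (Suc j) * h) \<omega>)) \<partial>P)"
  proof (rule nn_integral_dominated_convergence[where w="\<lambda>_. 1"])
    show "AE \<omega> in P. (\<lambda>m. indicator A \<omega> * ennreal (g (euler b (d m) (\<lambda>i. incr (real j * h) (d m) i \<omega>) (Y \<omega>) (2 ^ m))))
        \<longlonglongrightarrow> indicator A \<omega> * ennreal (g (X x (real (Suc j) * h) \<omega>))"
    proof (rule AE_I2)
      fix \<omega> assume "\<omega> \<in> space P"
      then have "(\<lambda>m. euler b (d m) (\<lambda>i. incr (real j * h) (d m) i \<omega>) (Y \<omega>) (2 ^ m)) \<longlonglongrightarrow> X x (real (Suc j) * h) \<omega>"
        using euler_tendsto[of \<omega> "real j * h" h x 1] h unfolding jh Y_def d_def by simp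
      then show "(\<lambda>m. indicator A \<omega> * ennreal (g (euler b (d m) (\<lambda>i. incr (real j * h) (d m) i \<omega>) (Y \<omega>) (2 ^ m))))
        \<longlonglongrightarrow> indicator A \<omega> * ennreal (g (X x (real (Suc j) * h) \<omega>))"
        by (intro ennreal_tendsto_cmult tendsto_ennrealI isCont_tendsto_compose[OF ic]) (auto split: split_indicator)
    qed
  qed (use h g in \<open>auto simp: emeasure_space_1 split: split_indicator\<close>)
  moreover have "(\<lambda>m. \<integral>\<^sup>+ \<omega>. indicator A \<omega> * (\<integral>\<^sup>+ \<omega>'. ennreal (g (euler b (d m) (\<lambda>i. incr 0 (d m) i \<omega>') (Y \<omega>) (2 ^ m))) \<partial>P) \<partial>P)
     \<longlonglongrightarrow> (\<integral>\<^sup>+ \<omega>. indicator A \<omega> * (\<integral>\<^sup>+ \<omega>'. ennreal (g (X (Y \<omega>) h \<omega>')) \<partial>P) \<partial>P)"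
  proof (rule nn_integral_dominated_convergence[where w="\<lambda>_. 1"])
    show "AE \<omega> in P. (\<lambda>m. indicator A \<omega> * (\<integral>\<^sup>+ \<omega>'. ennreal (g (euler b (d m) (\<lambda>i. incr 0 (d m) i \<omega>') (Y \<omega>) (2 ^ m))) \<partial>P))
        \<longlonglongrightarrow> indicator A \<omega> * (\<integral>\<^sup>+ \<omega>'. ennreal (g (X (Y \<omega>) h \<omega>')) \<partial>P)"
    proof (rule AE_I2, rule ennreal_tendsto_cmult)
      fix \<omega> assume "\<omega> \<in> space P"
      show "(\<lambda>m. \<integral>\<^sup>+ \<omega>'. ennreal (g (euler b (d m) (\<lambda>i. incr 0 (d m) i \<omega>') (Y \<omega>) (2 ^ m))) \<partial>P)
        \<longlonglongrightarrow> (\<integral>\<^sup>+ \<omega>'. ennreal (g (X (Y \<omega>) h \<omega>')) \<partial>P)"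
        using euler_integral_tendsto[OF h g, of "Y \<omega>"] unfolding d_def .
    qed (auto split: split_indicator)
    have 1: "(\<integral>\<^sup>+ \<omega>'. ennreal (g (f \<omega>')) \<partial>P) \<le> 1" for f
    proof -
      have "(\<integral>\<^sup>+ \<omega>'. ennreal (g (f \<omega>')) \<partial>P) \<le> (\<integral>\<^sup>+ \<omega>'. 1 \<partial>P)" using g by (intro nn_integral_mono) auto
      then show ?thesis by (simp add: emeasure_space_1)
    qed
    show "AE \<omega> in P. indicator A \<omega> * (\<integral>\<^sup>+ \<omega>'. ennreal (g (euler b (d m) (\<lambda>i. incr 0 (d m) i \<omega>') (Y \<omega>) (2 ^ m))) \<partial>P) \<le> 1" for m
      by (rule AE_I2) (use 1 in \<open>auto split: split_indicator\<close>)
    have [measurable]: "(\<lambda>p. euler b (d m) (\<lambda>i. incr 0 (d m) i (snd p)) (Y (fst p)) (2 ^ m)) \<in> borel_measurable (P \<Otimes>\<^sub>M P)" for m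
      using d[of m] by (intro borel_measurable_euler b_measurable measurable_compose[OF measurable_snd incr_measurable] measurable_compose[OF measurable_fst YP]) auto
    have [measurable]: "(\<lambda>\<omega>. \<integral>\<^sup>+ \<omega>'. ennreal (g (euler b (d m) (\<lambda>i. incr 0 (d m) i \<omega>') (Y \<omega>) (2 ^ m))) \<partial>P) \<in> borel_measurable P" for m
      by (intro borel_measurable_nn_integral) (simp add: split_beta')
    have [measurable]: "(\<lambda>\<omega>. \<integral>\<^sup>+ \<omega>'. ennreal (g (X (Y \<omega>) h \<omega>')) \<partial>P) \<in> borel_measurable P"
      using h by (intro borel_measurable_nn_integral) (simp add: split_beta')
    show "(\<lambda>\<omega>. indicator A \<omega> * (\<integral>\<^sup>+ \<omega>'. ennreal (g (euler b (d m) (\<lambda>i. incr 0 (d m) i \<omega>') (Y \<omega>) (2 ^ m))) \<partial>P)) \<in> borel_measurable P" for m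
      by measurable
    show "(\<lambda>\<omega>. indicator A \<omega> * (\<integral>\<^sup>+ \<omega>'. ennreal (g (X (Y \<omega>) h \<omega>')) \<partial>P)) \<in> borel_measurable P"
      by measurable
  qed (auto simp: emeasure_space_1)
  \<comment> \<open>The increments after time \<open>j * h\<close> are independent of
    \<open>filt h j\<close> and have the law of those of a fresh copy \<open>\<omega>'\<close> of
    the noise started at time 0.\<close>
  moreover have "(\<integral>\<^sup>+ \<omega>. indicator A \<omega> * ennreal (g (euler b (d m) (\<lambda>i. incr (real j * h) (d m) i \<omega>) (Y \<omega>) (2 ^ m))) \<partial>P)
    = (\<integral>\<^sup>+ \<omega>. indicator A \<omega> * (\<integral>\<^sup>+ \<omega>'. ennreal (g (euler b (d m) (\<lambda>i. incr 0 (d m) i \<omega>') (Y \<omega>) (2 ^ m))) \<partial>P) \<partial>P)" for m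
  proof -
    define G where "G = (\<lambda>p. indicator A (fst p) * ennreal (g (euler b (d m) (snd p) (Y (fst p)) (2 ^ m))))"
    have [measurable]: "(\<lambda>p. euler b (d m) (snd p) (Y (fst p)) (2 ^ m)) \<in> borel_measurable (filt h j \<Otimes>\<^sub>M (\<Pi>\<^sub>M i\<in>{..<2 ^ m :: nat}. borel))"
      by (intro borel_measurable_euler b_measurable measurable_compose[OF measurable_fst Y] measurable_compose[OF measurable_snd measurable_component_singleton]) simp
    have G: "G \<in> borel_measurable (filt h j \<Otimes>\<^sub>M (\<Pi>\<^sub>M i\<in>{..<2 ^ m :: nat}. borel))"
      unfolding G_def by measurable
    have c: "euler b (d m) (incrs (real j * h) (d m) (2 ^ m) \<omega>) y (2 ^ m) = euler b (d m) (\<lambda>i. incr (real j * h) (d m) i \<omega>) y (2 ^ m)" for \<omega> y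
      by (rule euler_cong) (simp add: incrs_def)
    have [measurable]: "(\<lambda>\<xi>. euler b (d m) \<xi> y (2 ^ m)) \<in> borel_measurable (\<Pi>\<^sub>M i\<in>{..<2 ^ m :: nat}. gauss (d m))" for y
      by (intro borel_measurable_euler b_measurable borel_measurable_const) (simp add: measurable_component_singleton[of _ _ "\<lambda>_. gauss (d m)", simplified])
    have "(\<integral>\<^sup>+ \<omega>. G (\<omega>, incrs (real j * h) (d m) (2 ^ m) \<omega>) \<partial>P) = (\<integral>\<^sup>+ \<omega>. \<integral>\<^sup>+ \<xi>. G (\<omega>, \<xi>) \<partial>(\<Pi>\<^sub>M i\<in>{..<2 ^ m}. gauss (d m)) \<partial>P)"
      unfolding d_def by (rule nn_integral_past_future[OF h G])
    then have "(\<integral>\<^sup>+ \<omega>. indicator A \<omega> * ennreal (g (euler b (d m) (\<lambda>i. incr (real j * h) (d m) i \<omega>) (Y \<omega>) (2 ^ m))) \<partial>P)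
      = (\<integral>\<^sup>+ \<omega>. indicator A \<omega> * (\<integral>\<^sup>+ \<xi>. ennreal (g (euler b (d m) \<xi> (Y \<omega>) (2 ^ m))) \<partial>(\<Pi>\<^sub>M i\<in>{..<2 ^ m}. gauss (d m))) \<partial>P)"
      unfolding G_def by (simp add: c nn_integral_cmult)
    also have "\<dots> = (\<integral>\<^sup>+ \<omega>. indicator A \<omega> * (\<integral>\<^sup>+ \<omega>'. ennreal (g (euler b (d m) (\<lambda>i. incr 0 (d m) i \<omega>') (Y \<omega>) (2 ^ m))) \<partial>P) \<partial>P)"
      using d[of m] by (subst nn_integral_euler[where f="\<lambda>y. ennreal (g y)"]) auto
    finally show ?thesis .
  qed
  ultimately show ?thesis unfolding Y_def by (simp add: LIMSEQ_unique)
qed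

text \<open>With \<open>P\<close> restricted to \<open>A\<close>, both sides are integrals of
  \<open>g\<close> against finite measures on the state space. These agree on continuous functions,
  hence coincide.\<close>

lemma markov_step:
  assumes h: "h > 0" and A: "A \<in> sets (filt h j)" and g [measurable]: "g \<in> borel_measurable borel"
  shows "(\<integral>\<^sup>+ \<omega>. indicator A \<omega> * g (X x (real (Suc j) * h) \<omega>) \<partial>P)
    = (\<integral>\<^sup>+ \<omega>. indicator A \<omega> * (\<integral>\<^sup>+ \<omega>'. g (X (X x (real j * h) \<omega>) h \<omega>') \<partial>P) \<partial>P)"
proof -
  have A' [measurable]: "A \<in> sets P" using A h sets_filt_subset[of h j] by auto
  define Z where "Z = X x (real (Suc j) * h)"
  define D where "D = density P (indicator A)"
  have D [measurable_cong]: "sets D = sets P" by (simp add: D_def)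
  have "emeasure D (space D) \<le> 1" by (simp add: D_def emeasure_density nn_integral_indicator emeasure_le_1)
  then interpret D: finite_measure D by (intro finite_measureI) (auto simp: top_unique)
  interpret DP: pair_sigma_finite D P ..
  interpret DPf: finite_measure "D \<Otimes>\<^sub>M P" by (intro finite_measure_pair_measure D.finite_measure_axioms finite_measure_axioms)
  have Y [measurable]: "X x (real j * h) \<in> borel_measurable P" "Z \<in> borel_measurable P" unfolding Z_def using h by simp_all
  define \<nu> where "\<nu> = distr (D \<Otimes>\<^sub>M P) borel (\<lambda>(\<omega>, \<omega>'). X (X x (real j * h) \<omega>) h \<omega>')"
  have m [measurable]: "(\<lambda>(\<omega>, \<omega>'). X (X x (real j * h) \<omega>) h \<omega>') \<in> borel_measurable (D \<Otimes>\<^sub>M P)"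
    using h by (simp add: split_beta')
  have i1: "(\<integral>\<^sup>+ y. f y \<partial>distr D borel Z) = (\<integral>\<^sup>+ \<omega>. indicator A \<omega> * f (Z \<omega>) \<partial>P)"
    if [measurable]: "f \<in> borel_measurable borel" for f
    unfolding D_def by (simp add: nn_integral_distr nn_integral_density)
  have i2: "(\<integral>\<^sup>+ y. f y \<partial>\<nu>) = (\<integral>\<^sup>+ \<omega>. indicator A \<omega> * (\<integral>\<^sup>+ \<omega>'. f (X (X x (real j * h) \<omega>) h \<omega>') \<partial>P) \<partial>P)"
    if [measurable]: "f \<in> borel_measurable borel" for f
  proof -
    have [measurable]: "(\<lambda>\<omega>. \<integral>\<^sup>+ \<omega>'. f (X (X x (real j * h) \<omega>) h \<omega>') \<partial>P) \<in> borel_measurable P"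
      using h by (intro borel_measurable_nn_integral) (simp add: split_beta')
    have "(\<integral>\<^sup>+ y. f y \<partial>\<nu>) = (\<integral>\<^sup>+ p. f (case p of (\<omega>, \<omega>') \<Rightarrow> X (X x (real j * h) \<omega>) h \<omega>') \<partial>(D \<Otimes>\<^sub>M P))"
      unfolding \<nu>_def by (subst nn_integral_distr) simp_all
    also have "\<dots> = (\<integral>\<^sup>+ \<omega>. \<integral>\<^sup>+ \<omega>'. f (X (X x (real j * h) \<omega>) h \<omega>') \<partial>P \<partial>D)"
      by (subst nn_integral_fst[symmetric]) simp_all
    also have "\<dots> = (\<integral>\<^sup>+ \<omega>. indicator A \<omega> * (\<integral>\<^sup>+ \<omega>'. f (X (X x (real j * h) \<omega>) h \<omega>') \<partial>P) \<partial>P)"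
      unfolding D_def by (subst nn_integral_density) simp_all
    finally show ?thesis .
  qed
  have "distr D borel Z = \<nu>"
  proof (rule measure_eqI_continuous)
    show "finite_measure (distr D borel Z)" by (rule D.finite_measure_distr) simp
    show "finite_measure \<nu>" unfolding \<nu>_def by (rule DPf.finite_measure_distr[OF m])
    fix f :: "'v \<Rightarrow> real" assume f: "continuous_on UNIV f" "\<And>x. 0 \<le> f x" "\<And>x. f x \<le> 1"
    have [measurable]: "f \<in> borel_measurable borel" using f(1) by (rule borel_measurable_continuous_onI)
    have fe: "(\<lambda>y. ennreal (f y)) \<in> borel_measurable borel" by simp
    show "(\<integral>\<^sup>+ y. ennreal (f y) \<partial>distr D borel Z) = (\<integral>\<^sup>+ y. ennreal (f y) \<partial>\<nu>)"
      unfolding i1[OF fe] i2[OF fe] unfolding Z_def by (rule markov_continuous[OF h A f])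
  qed (simp_all add: \<nu>_def)
  then show ?thesis using i1[OF g] i2[OF g] unfolding Z_def[symmetric] by simp
qed

end

section \<open>Stationary Markov chains\<close>

text \<open>A class of test functions that contains indicators, is stable under the kernel and
  consists of functions integrable for every probability measure.\<close>

definition unit_funs :: "('s::topological_space \<Rightarrow> real) set" where
  "unit_funs = {g \<in> borel_measurable borel. \<forall>x. 0 \<le> g x \<and> g x \<le> 1}"

lemma unit_funsD:
  "g \<in> unit_funs \<Longrightarrow> g \<in> borel_measurable borel" "g \<in> unit_funs \<Longrightarrow> 0 \<le> g x" "g \<in> unit_funs \<Longrightarrow> g x \<le> 1"
  by (auto simp: unit_funs_def)

lemma unit_funs_const: "0 \<le> c \<Longrightarrow> c \<le> 1 \<Longrightarrow> (\<lambda>_. c) \<in> unit_funs"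
  by (simp add: unit_funs_def)

lemma unit_funs_indicator: "B \<in> sets borel \<Longrightarrow> indicator B \<in> unit_funs"
  by (auto simp: unit_funs_def indicator_def)

lemma (in prob_space) integrable_unit_fun:
  assumes "g \<in> unit_funs" "Y \<in> borel_measurable M"
  shows "integrable M (\<lambda>\<omega>. g (Y \<omega>))"
  using assms by (intro integrable_const_bound[where B=1])
    (auto simp: unit_funsD intro!: measurable_compose[OF assms(2)])

lemma (in prob_space) abs_prob_diff_le:
  assumes "A \<in> events" "B \<in> events" "D \<in> events" "A \<subseteq> B \<union> D" "B \<subseteq> A \<union> D"
  shows "\<bar>prob A - prob B\<bar> \<le> prob D"
proof -
  have "prob A \<le> prob (B \<union> D)" "prob B \<le> prob (A \<union> D)" using assms by (auto intro!: finite_measure_mono)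
  then show ?thesis
    using measure_Un_le[of B M D] measure_Un_le[of A M D] assms by auto
qed

locale markov_kernel =
  fixes \<kappa> :: "'s::topological_space \<Rightarrow> 's measure"
  assumes prob_kernel: "\<And>y. prob_space (\<kappa> y)"
    and sets_kernel [simp, measurable_cong]: "\<And>y. sets (\<kappa> y) = sets borel"
    and measurable_kernel: "\<And>g. g \<in> unit_funs \<Longrightarrow> (\<lambda>y. \<integral>z. g z \<partial>\<kappa> y) \<in> borel_measurable borel"
begin

definition Q :: "('s \<Rightarrow> real) \<Rightarrow> 's \<Rightarrow> real" where
  "Q g y = (\<integral>z. g z \<partial>\<kappa> y)"

lemma integrable_kernel: "g \<in> unit_funs \<Longrightarrow> integrable (\<kappa> y) g"
  using prob_space.integrable_unit_fun[OF prob_kernel, of g "\<lambda>x. x" y] by simp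

lemma Q_unit_funs: "g \<in> unit_funs \<Longrightarrow> Q g \<in> unit_funs"
proof -
  assume g: "g \<in> unit_funs"
  have "Q g y \<le> 1" for y
  proof -
    interpret prob_space "\<kappa> y" by (rule prob_kernel)
    have "Q g y \<le> (\<integral>z. 1 \<partial>\<kappa> y)"
      unfolding Q_def using g integrable_kernel[OF g] by (intro integral_mono) (auto simp: unit_funsD)
    then show ?thesis by (simp add: prob_space)
  qed
  moreover have "0 \<le> Q g y" for y
    unfolding Q_def using g by (intro integral_nonneg_AE) (auto simp: unit_funsD)
  ultimately show "Q g \<in> unit_funs"
    using measurable_kernel[OF g] by (simp add: unit_funs_def Q_def[abs_def])
qed

lemma Q_pow_unit_funs: "g \<in> unit_funs \<Longrightarrow> (Q ^^ m) g \<in> unit_funs"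
  by (induction m) (auto intro: Q_unit_funs)

lemma Q_pow_cmult: "(Q ^^ m) (\<lambda>x. c * g x) = (\<lambda>x. c * (Q ^^ m) g x)"
  by (induction m) (auto simp: Q_def)

lemma Q_pow_mono_const:
  assumes "g \<in> unit_funs" "\<And>y. g y \<le> c" shows "(Q ^^ m) g y \<le> c"
  using assms
proof (induction m arbitrary: y)
  case (Suc m)
  interpret prob_space "\<kappa> y" by (rule prob_kernel)
  have "(\<integral>z. (Q ^^ m) g z \<partial>\<kappa> y) \<le> (\<integral>z. c \<partial>\<kappa> y)"
    using Suc integrable_kernel[OF Q_pow_unit_funs] by (intro integral_mono) auto
  then show ?case by (simp add: Q_def[of "(Q ^^ m) g"] prob_space)
qed simp

end

locale stationary_markov_chain = markov_kernel \<kappa> + prob_space M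
  for \<kappa> :: "'s::topological_space \<Rightarrow> 's measure" and M :: "'a measure" +
  fixes F :: "nat \<Rightarrow> 'a measure" and Y :: "nat \<Rightarrow> 'a \<Rightarrow> 's" and \<mu> :: "'s measure"
  assumes sets_F: "\<And>j. sets (F j) \<subseteq> sets M" and space_F [simp]: "\<And>j. space (F j) = space M"
    and F_mono: "\<And>j. sets (F j) \<subseteq> sets (F (Suc j))"
    and Y_adapted: "\<And>j. Y j \<in> borel_measurable (F j)"
    and distr_Y: "\<And>j. distr M borel (Y j) = \<mu>"
    and markov: "\<And>j A g. A \<in> sets (F j) \<Longrightarrow> g \<in> unit_funs \<Longrightarrow>
      (\<integral>\<omega>. indicator A \<omega> * g (Y (Suc j) \<omega>) \<partial>M) = (\<integral>\<omega>. indicator A \<omega> * Q g (Y j \<omega>) \<partial>M)"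
begin

lemma F_mono': "i \<le> j \<Longrightarrow> sets (F i) \<subseteq> sets (F j)"
  using F_mono by (rule lift_Suc_mono_le)

lemma Y_F: "i \<le> j \<Longrightarrow> Y i \<in> borel_measurable (F j)"
  using Y_adapted[of i] F_mono'[of i j] by (auto simp: measurable_def)

lemma Y_measurable [measurable]: "Y j \<in> borel_measurable M"
  using Y_adapted[of j] sets_F[of j] by (auto simp: measurable_def)

lemma prob_space_\<mu>: "prob_space \<mu>"
  using prob_space_distr[OF Y_measurable[of 0]] by (simp add: distr_Y)

lemma sets_\<mu> [simp, measurable_cong]: "sets \<mu> = sets borel"
  using distr_Y[of 0, symmetric] by simp

lemma integral_Y: "g \<in> borel_measurable borel \<Longrightarrow> (\<integral>\<omega>. g (Y j \<omega>) \<partial>M) = (\<integral>y. (g y :: real) \<partial>\<mu>)"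
  by (subst distr_Y[of j, symmetric]) (simp add: integral_distr)

lemma prob_Y: "B \<in> sets borel \<Longrightarrow> prob (Y j -` B \<inter> space M) = measure \<mu> B"
  by (subst distr_Y[of j, symmetric]) (simp add: measure_distr)

lemma integrable_mult_indicator_unit:
  assumes "A \<in> events" "g \<in> unit_funs"
  shows "integrable M (\<lambda>\<omega>. indicator A \<omega> * g (Y j \<omega>))"
  using integrable_mult_indicator[OF assms(1) integrable_unit_fun[OF assms(2) Y_measurable[of j]]] by simp

lemma markov_pow:
  assumes "A \<in> sets (F j)" "g \<in> unit_funs"
  shows "(\<integral>\<omega>. indicator A \<omega> * g (Y (j + m) \<omega>) \<partial>M) = (\<integral>\<omega>. indicator A \<omega> * (Q ^^ m) g (Y j \<omega>) \<partial>M)"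
  using assms(1)
proof (induction m arbitrary: j)
  case (Suc m)
  have "(\<integral>\<omega>. indicator A \<omega> * g (Y (Suc j + m) \<omega>) \<partial>M) = (\<integral>\<omega>. indicator A \<omega> * (Q ^^ m) g (Y (Suc j) \<omega>) \<partial>M)"
    using Suc F_mono by blast
  also have "\<dots> = (\<integral>\<omega>. indicator A \<omega> * Q ((Q ^^ m) g) (Y j \<omega>) \<partial>M)"
    by (rule markov[OF Suc(2) Q_pow_unit_funs[OF assms(2)]])
  finally show ?case by simp
qed simp

definition visits :: "'s set \<Rightarrow> nat \<Rightarrow> nat \<Rightarrow> 'a \<Rightarrow> nat" where
  "visits B i l \<omega> = (\<Sum>r = i..<i + l. indicator B (Y r \<omega>))"

lemma visits_measurable_F:
  assumes B: "B \<in> sets borel" and j: "i + l \<le> Suc j"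
  shows "visits B i l \<in> measurable (F j) (count_space UNIV)"
proof -
  have "(\<lambda>\<omega>. indicator B (Y r \<omega>) :: nat) \<in> measurable (F j) (count_space UNIV)" if "r < i + l" for r
  proof (rule measurable_compose[OF Y_F[of r j]])
    show "(indicator B :: 's \<Rightarrow> nat) \<in> measurable borel (count_space UNIV)"
    proof -
      have "(\<lambda>x. if x \<in> B then 1 else 0 :: nat) \<in> measurable borel (count_space UNIV)"
        using B by (intro measurable_If) auto
      moreover have "(\<lambda>x. if x \<in> B then 1 else 0 :: nat) = indicator B" by (auto simp: indicator_def fun_eq_iff)
      ultimately show ?thesis by simp
    qed
  qed (use that j in simp)
  then show ?thesis unfolding visits_def[abs_def] by (intro measurable_sum_nat) auto
qed

lemma visits_measurable [measurable]: "B \<in> sets borel \<Longrightarrow> visits B i l \<in> measurable M (count_space UNIV)"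
  using visits_measurable_F[of B i l "i + l"] sets_F by (auto simp: measurable_def)

lemma visits_Suc_left: "visits B i (Suc l) \<omega> = indicator B (Y i \<omega>) + visits B (Suc i) l \<omega>"
  unfolding visits_def by (subst sum.atLeast_Suc_lessThan) auto

lemma visits_add: "visits B i (k + l) \<omega> = visits B i k \<omega> + visits B (i + k) l \<omega>"
  unfolding visits_def by (subst sum.atLeastLessThan_concat[symmetric, of i "i + k"]) (auto simp: add.assoc)

text \<open>Given the past, the law of the future count depends only on the present state, and by
  homogeneity the same function \<open>c\<close> serves for all times \<open>i\<close>. Induction on
  the length of the time interval, distinguishing whether the chain is in \<open>B\<close>
  now.\<close>

lemma prob_future:
  assumes B: "B \<in> sets borel"
  shows "\<exists>c \<in> unit_funs. \<forall>i. \<forall>A \<in> sets (F i). prob {\<omega> \<in> A. visits B i l \<omega> = a} = (\<integral>\<omega>. indicator A \<omega> * c (Y i \<omega>) \<partial>M)"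
proof (induction l arbitrary: a)
  case 0
  let ?c = "\<lambda>_. if a = 0 then 1 else 0 :: real"
  show ?case
  proof (intro bexI[of _ ?c] allI ballI)
    fix i A assume "A \<in> sets (F i)"
    then have "A \<in> sets M" using sets_F by auto
    then show "prob {\<omega> \<in> A. visits B i 0 \<omega> = a} = (\<integral>\<omega>. indicator A \<omega> * ?c (Y i \<omega>) \<partial>M)"
      by (simp add: visits_def sets.sets_into_space Int_absorb2)
  qed (simp add: unit_funs_const)
next
  case (Suc l)
  from Suc[of "a - 1"] obtain c1 where c1: "c1 \<in> unit_funs"
    "\<And>i A. A \<in> sets (F i) \<Longrightarrow> prob {\<omega> \<in> A. visits B i l \<omega> = a - 1} = (\<integral>\<omega>. indicator A \<omega> * c1 (Y i \<omega>) \<partial>M)" by auto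
  from Suc[of a] obtain c2 where c2: "c2 \<in> unit_funs"
    "\<And>i A. A \<in> sets (F i) \<Longrightarrow> prob {\<omega> \<in> A. visits B i l \<omega> = a} = (\<integral>\<omega>. indicator A \<omega> * c2 (Y i \<omega>) \<partial>M)" by auto
  \<comment> \<open>If the chain is in \<open>B\<close> now, one visit is used up. For
    \<open>a = 0\<close> this is impossible, and the case distinction suppresses the term in which
    \<open>a - 1\<close> would be 0 again.\<close>
  define c where "c y = indicator B y * ((if a = 0 then 0 else 1) * Q c1 y) + (1 - indicator B y) * Q c2 y" for y
  have Qc: "Q c1 \<in> unit_funs" "Q c2 \<in> unit_funs" using c1 c2 by (auto intro: Q_unit_funs)
  note [measurable] = unit_funsD(1)[OF Qc(1)] unit_funsD(1)[OF Qc(2)] B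
  have "c \<in> unit_funs"
    using unit_funsD[OF Qc(1)] unit_funsD[OF Qc(2)] by (auto simp: unit_funs_def c_def[abs_def] indicator_def)
  then show ?case
  proof (intro bexI[of _ c] allI ballI)
    fix i A assume A: "A \<in> sets (F i)"
    define A1 A2 where "A1 = A \<inter> (Y i -` B \<inter> space M)" and "A2 = A - (Y i -` B \<inter> space M)"
    have YB: "Y i -` B \<inter> space M \<in> sets (F i)" using measurable_sets[OF Y_adapted[of i] B] by simp
    then have A12: "A1 \<in> sets (F i)" "A2 \<in> sets (F i)" using A by (auto simp: A1_def A2_def)
    then have A12': "A1 \<in> sets (F (Suc i))" "A2 \<in> sets (F (Suc i))" using F_mono by auto
    have ev [measurable]: "A \<in> sets M" "A1 \<in> sets M" "A2 \<in> sets M" using A A12 sets_F by auto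
    have sp: "A \<subseteq> space M" by (rule sets.sets_into_space[OF ev(1)])
    have "{\<omega> \<in> A. visits B i (Suc l) \<omega> = a} =
      (if a = 0 then {} else {\<omega> \<in> A1. visits B (Suc i) l \<omega> = a - 1}) \<union> {\<omega> \<in> A2. visits B (Suc i) l \<omega> = a}"
      using sp by (auto simp: visits_Suc_left A1_def A2_def indicator_def split: if_splits)
    moreover have m: "{\<omega> \<in> A1. visits B (Suc i) l \<omega> = a - 1} \<in> events" "{\<omega> \<in> A2. visits B (Suc i) l \<omega> = a} \<in> events"
      using ev by measurable
    ultimately have "prob {\<omega> \<in> A. visits B i (Suc l) \<omega> = a} =
      (if a = 0 then 0 else 1) * prob {\<omega> \<in> A1. visits B (Suc i) l \<omega> = a - 1} + prob {\<omega> \<in> A2. visits B (Suc i) l \<omega> = a}"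
      by (cases "a = 0") (auto simp: A1_def A2_def intro!: finite_measure_Union)
    also have "\<dots> = (if a = 0 then 0 else 1) * (\<integral>\<omega>. indicator A1 \<omega> * Q c1 (Y i \<omega>) \<partial>M) + (\<integral>\<omega>. indicator A2 \<omega> * Q c2 (Y i \<omega>) \<partial>M)"
      using c1 c2 A12 A12' by (simp add: markov)
    also have "\<dots> = (\<integral>\<omega>. (if a = 0 then 0 else 1) * (indicator A1 \<omega> * Q c1 (Y i \<omega>)) + indicator A2 \<omega> * Q c2 (Y i \<omega>) \<partial>M)"
      using ev Qc by (subst Bochner_Integration.integral_add)
        (auto intro!: integrable_mult_indicator_unit)
    also have "\<dots> = (\<integral>\<omega>. indicator A \<omega> * c (Y i \<omega>) \<partial>M)"
      by (intro Bochner_Integration.integral_cong) (auto simp: c_def A1_def A2_def indicator_def)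
    finally show "prob {\<omega> \<in> A. visits B i (Suc l) \<omega> = a} = (\<integral>\<omega>. indicator A \<omega> * c (Y i \<omega>) \<partial>M)" .
  qed
qed

end

section \<open>Poisson recursion for the number of visits\<close>

context stationary_markov_chain
begin

text \<open>Whatever happened before, the last step enters \<open>B\<close> with probability at most
  \<open>c\<close>. Since \<open>c\<close> will be a multiple of \<open>measure \<mu> B\<close>, two
  visits at given times are negligible compared with one.\<close>

lemma prob_two_visits:
  assumes B: "B \<in> sets borel" and c: "\<And>y. Q (indicator B) y \<le> c" and ij: "i \<noteq> j"
  shows "prob ((Y i -` B \<inter> space M) \<inter> (Y j -` B \<inter> space M)) \<le> c * measure \<mu> B"
proof -
  have *: "prob ((Y i -` B \<inter> space M) \<inter> (Y j -` B \<inter> space M)) \<le> c * measure \<mu> B" if ij: "i < j" for i j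
  proof -
    let ?A = "Y i -` B \<inter> space M"
    obtain d where d: "j = i + Suc d" using less_imp_Suc_add[OF ij] by auto
    have A: "?A \<in> sets (F i)" using measurable_sets[OF Y_adapted[of i] B] by simp
    have [measurable]: "?A \<in> events" using A sets_F by auto
    have B': "indicator B \<in> unit_funs" by (rule unit_funs_indicator[OF B])
    have "prob (?A \<inter> (Y j -` B \<inter> space M)) = (\<integral>\<omega>. indicator (?A \<inter> (Y j -` B \<inter> space M)) \<omega> \<partial>M)"
      using B by simp
    also have "\<dots> = (\<integral>\<omega>. indicator ?A \<omega> * indicator B (Y (i + Suc d) \<omega>) \<partial>M)"
      by (intro Bochner_Integration.integral_cong) (auto simp: d indicator_def)
    also have "\<dots> = (\<integral>\<omega>. indicator ?A \<omega> * (Q ^^ Suc d) (indicator B) (Y i \<omega>) \<partial>M)"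
      by (rule markov_pow[OF A B'])
    also have "\<dots> \<le> (\<integral>\<omega>. c * indicator ?A \<omega> \<partial>M)"
    proof (rule integral_mono)
      show "integrable M (\<lambda>\<omega>. indicator ?A \<omega> * (Q ^^ Suc d) (indicator B) (Y i \<omega>))"
        by (intro integrable_mult_indicator_unit Q_pow_unit_funs B') simp
      fix \<omega>
      have "(Q ^^ Suc d) (indicator B) (Y i \<omega>) \<le> c"
        unfolding funpow_Suc_right o_apply by (intro Q_pow_mono_const Q_unit_funs B' c)
      then show "indicator ?A \<omega> * (Q ^^ Suc d) (indicator B) (Y i \<omega>) \<le> c * indicator ?A \<omega>"
        by (auto simp: indicator_def)
    qed (simp add: emeasure_eq_measure)
    also have "\<dots> = c * measure \<mu> B" using B by (simp add: prob_Y)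
    finally show ?thesis .
  qed
  show ?thesis using *[of i j] *[of j i] ij by (cases "i < j") (auto simp: Int_commute)
qed

text \<open>The pointwise error is evaluated at a variable of law \<open>\<mu>\<close>, so after
  dropping the indicator only its \<open>\<mu>\<close>-integral remains, whatever the event
  \<open>A\<close> is.\<close>

lemma expectation_approx:
  assumes A: "A \<in> events" and f: "f \<in> unit_funs" and e: "\<And>y. \<bar>f y - c\<bar> \<le> e y" "integrable \<mu> e"
  shows "\<bar>(\<integral>\<omega>. indicator A \<omega> * f (Y j \<omega>) \<partial>M) - c * prob A\<bar> \<le> (\<integral>y. e y \<partial>\<mu>)"
proof -
  have em [measurable]: "e \<in> borel_measurable borel" using borel_measurable_integrable[OF e(2)] by simp
  have eY: "integrable M (\<lambda>\<omega>. e (Y j \<omega>))"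
    using e(2) by (subst (asm) distr_Y[of j, symmetric]) (simp add: integrable_distr_eq)
  have fi: "integrable M (\<lambda>\<omega>. indicator A \<omega> * f (Y j \<omega>))" by (rule integrable_mult_indicator_unit[OF A f])
  have ci: "integrable M (\<lambda>\<omega>. indicator A \<omega> * c)" using A by (simp add: emeasure_eq_measure)
  have "(\<integral>\<omega>. indicator A \<omega> * f (Y j \<omega>) \<partial>M) - c * prob A = (\<integral>\<omega>. indicator A \<omega> * f (Y j \<omega>) - indicator A \<omega> * c \<partial>M)"
    using A by (subst Bochner_Integration.integral_diff[OF fi ci]) simp
  also have "\<bar>\<dots>\<bar> \<le> (\<integral>\<omega>. e (Y j \<omega>) \<partial>M)"
  proof (rule order_trans[OF integral_abs_bound integral_mono])
    show "integrable M (\<lambda>\<omega>. \<bar>indicator A \<omega> * f (Y j \<omega>) - indicator A \<omega> * c\<bar>)"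
      using fi ci by auto
    show "\<bar>indicator A \<omega> * f (Y j \<omega>) - indicator A \<omega> * c\<bar> \<le> e (Y j \<omega>)" for \<omega>
      using e(1)[of "Y j \<omega>"] by (auto simp: indicator_def intro: order_trans[OF abs_ge_zero])
  qed (rule eY)
  also have "\<dots> = (\<integral>y. e y \<partial>\<mu>)" by (rule integral_Y[OF em])
  finally show ?thesis .
qed

lemma integral_\<mu>_unit: "g \<in> unit_funs \<Longrightarrow> 0 \<le> (\<integral>y. g y \<partial>\<mu>) \<and> (\<integral>y. g y \<partial>\<mu>) \<le> 1"
proof -
  interpret \<mu>: prob_space \<mu> by (rule prob_space_\<mu>)
  assume g: "g \<in> unit_funs"
  have "(\<integral>y. g y \<partial>\<mu>) \<le> (\<integral>y. 1 \<partial>\<mu>)"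
    using g \<mu>.integrable_unit_fun[OF g, of "\<lambda>x. x"] by (intro integral_mono) (auto simp: unit_funsD)
  moreover have "0 \<le> (\<integral>y. g y \<partial>\<mu>)" using g by (intro integral_nonneg_AE) (auto simp: unit_funsD)
  ultimately show ?thesis by (simp add: \<mu>.prob_space)
qed

lemma invariant_\<mu>: "g \<in> unit_funs \<Longrightarrow> (\<integral>y. Q g y \<partial>\<mu>) = (\<integral>y. g y \<partial>\<mu>)"
proof -
  assume g: "g \<in> unit_funs"
  have i: "(\<integral>\<omega>. indicator (space M) \<omega> * f \<omega> \<partial>M) = (\<integral>\<omega>. f \<omega> \<partial>M)" for f :: "'a \<Rightarrow> real"
    by (rule Bochner_Integration.integral_cong) auto
  have "space M \<in> sets (F 0)" using sets.top[of "F 0"] by simp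
  from markov[OF this g] show ?thesis
    using integral_Y[OF unit_funsD(1)[OF Q_unit_funs[OF g]], of 0] integral_Y[OF unit_funsD(1)[OF g], of 1] by (simp add: i)
qed

section \<open>Decoupling one visit from the remaining count\<close>

context
  fixes B p C e \<epsilon> s
  assumes B: "B \<in> sets borel" and p: "p = measure \<mu> B" "p > 0" and C: "C > 0"
    and QB: "\<And>y. Q (indicator B) y \<le> C * p"
    and e: "\<And>m g y. g \<in> unit_funs \<Longrightarrow> \<bar>(Q ^^ m) g y - (\<integral>y. g y \<partial>\<mu>)\<bar> \<le> e m y" "\<And>m. integrable \<mu> (e m)"
    and s: "s > 0" and eB: "\<And>y. y \<in> B \<Longrightarrow> e s y \<le> \<epsilon>"
begin

text \<open>A visit at time \<open>i + s\<close> is decoupled from the event \<open>A\<close> before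
  it and from the future \<open>g\<close> after it. Given the visit, \<open>s\<close> more steps
  forget where in \<open>B\<close> it took place, up to \<open>\<epsilon>\<close>; the visit itself
  has probability about \<open>p * prob A\<close>; and \<open>2 * s\<close> steps without the visit
  make \<open>g\<close> nearly independent of \<open>A\<close>. Every error carries the factor
  \<open>p\<close>.\<close>

lemma mixing_block:
  assumes A: "A \<in> sets (F i)" and g: "g \<in> unit_funs"
  shows "\<bar>(\<integral>\<omega>. indicator A \<omega> * (indicator B (Y (i + s) \<omega>) * (Q ^^ s) g (Y (i + s) \<omega>)) \<partial>M)
      - p * (\<integral>\<omega>. indicator A \<omega> * (Q ^^ (2 * s)) g (Y i \<omega>) \<partial>M)\<bar>
    \<le> p * (\<epsilon> + C * (\<integral>y. e (s - 1) y \<partial>\<mu>) + (\<integral>y. e (2 * s) y \<partial>\<mu>))"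
proof -
  define \<gamma> where "\<gamma> = (\<integral>y. g y \<partial>\<mu>)"
  have \<gamma>: "0 \<le> \<gamma>" "\<gamma> \<le> 1" using integral_\<mu>_unit[OF g] by (auto simp: \<gamma>_def)
  have AM: "A \<in> events" using A sets_F by auto
  have iB: "indicator B \<in> unit_funs" by (rule unit_funs_indicator[OF B])
  let ?G = "(Q ^^ s) g" and ?Y = "Y (i + s)"
  have G: "?G \<in> unit_funs" by (rule Q_pow_unit_funs[OF g])
  note [measurable] = unit_funsD(1)[OF G] B AM
  have BG: "(\<lambda>y. indicator B y * ?G y) \<in> unit_funs"
    using unit_funsD[OF G] by (auto simp: unit_funs_def indicator_def)
  define L1 where "L1 = (\<integral>\<omega>. indicator A \<omega> * (indicator B (?Y \<omega>) * ?G (?Y \<omega>)) \<partial>M)"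
  define a :: real where "a = (\<integral>\<omega>. indicator A \<omega> * indicator B (?Y \<omega>) \<partial>M)"
  define L3 where "L3 = (\<integral>\<omega>. indicator A \<omega> * (Q ^^ (2 * s)) g (Y i \<omega>) \<partial>M)"
  have 1: "\<bar>L1 - \<gamma> * a\<bar> \<le> \<epsilon> * p"
  proof -
    have i1: "integrable M (\<lambda>\<omega>. indicator A \<omega> * (indicator B (?Y \<omega>) * ?G (?Y \<omega>)))"
      using integrable_mult_indicator_unit[OF AM BG] .
    have i2: "integrable M (\<lambda>\<omega>. \<gamma> * (indicator A \<omega> * indicator B (?Y \<omega>)))"
      using integrable_mult_indicator_unit[OF AM iB] by (intro integrable_mult_right)
    have "L1 - \<gamma> * a = (\<integral>\<omega>. indicator A \<omega> * (indicator B (?Y \<omega>) * ?G (?Y \<omega>)) - \<gamma> * (indicator A \<omega> * indicator B (?Y \<omega>)) \<partial>M)"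
      unfolding L1_def a_def by (subst Bochner_Integration.integral_diff[OF i1 i2]) simp
    also have "\<bar>\<dots>\<bar> \<le> (\<integral>\<omega>. \<epsilon> * indicator B (?Y \<omega>) \<partial>M)"
    proof (rule order_trans[OF integral_abs_bound integral_mono])
      show "integrable M (\<lambda>\<omega>. \<bar>indicator A \<omega> * (indicator B (?Y \<omega>) * ?G (?Y \<omega>)) - \<gamma> * (indicator A \<omega> * indicator B (?Y \<omega>))\<bar>)"
        using i1 i2 by auto
      show "integrable M (\<lambda>\<omega>. \<epsilon> * indicator B (?Y \<omega>))"
        using integrable_unit_fun[OF iB Y_measurable[of "i + s"]] by (intro integrable_mult_right)
      show "\<bar>indicator A \<omega> * (indicator B (?Y \<omega>) * ?G (?Y \<omega>)) - \<gamma> * (indicator A \<omega> * indicator B (?Y \<omega>))\<bar> \<le> \<epsilon> * indicator B (?Y \<omega>)" for \<omega>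
        using order_trans[OF e(1)[OF g, of s "?Y \<omega>"] eB[of "?Y \<omega>"]]
        by (auto simp: indicator_def \<gamma>_def intro: order_trans[OF abs_ge_zero])
    qed
    also have "\<dots> = \<epsilon> * p" using integral_Y[of "indicator B" "i + s"] B by (simp add: p)
    finally show ?thesis .
  qed
  have 2: "\<bar>a - p * prob A\<bar> \<le> C * p * (\<integral>y. e (s - 1) y \<partial>\<mu>)"
  proof -
    \<comment> \<open>Mixing applied to the indicator of \<open>B\<close> itself would give an error
      that is not small relative to \<open>p\<close>. One step is spent to pass to
      \<open>Q (indicator B)\<close>, which is at most \<open>C * p\<close>; after normalisation the
      error for the remaining \<open>s - 1\<close> steps is multiplied by
      \<open>C * p\<close>.\<close>
    define g1 where "g1 y = (1 / (C * p)) * Q (indicator B) y" for y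
    have QBu: "Q (indicator B) \<in> unit_funs" by (rule Q_unit_funs[OF iB])
    have g1: "g1 \<in> unit_funs"
      using unit_funsD[OF QBu] QB C p(2) by (auto simp: unit_funs_def g1_def[abs_def] field_simps)
    have Qg1: "Q (indicator B) = (\<lambda>y. (C * p) * g1 y)" using C p(2) by (auto simp: g1_def)
    have ig1: "C * p * (\<integral>y. g1 y \<partial>\<mu>) = p"
    proof -
      have "C * p * (\<integral>y. g1 y \<partial>\<mu>) = (\<integral>y. Q (indicator B) y \<partial>\<mu>)" unfolding Qg1 by simp
      also have "\<dots> = p" using invariant_\<mu>[OF iB] B by (simp add: p)
      finally show ?thesis .
    qed
    have Qs: "(Q ^^ s) (indicator B) = (\<lambda>y. (C * p) * (Q ^^ (s - 1)) g1 y)"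
    proof -
      have "(Q ^^ s) (indicator B) = (Q ^^ (s - 1)) (Q (indicator B))"
        using s by (cases s) (simp_all add: funpow_swap1)
      then show ?thesis unfolding Qg1 Q_pow_cmult .
    qed
    have "a = (\<integral>\<omega>. indicator A \<omega> * (Q ^^ s) (indicator B) (Y i \<omega>) \<partial>M)"
      unfolding a_def by (rule markov_pow[OF A iB])
    also have "\<bar>\<dots> - p * prob A\<bar> \<le> (\<integral>y. C * p * e (s - 1) y \<partial>\<mu>)"
    proof (rule expectation_approx[OF AM Q_pow_unit_funs[OF iB]])
      fix y
      have "\<bar>(Q ^^ s) (indicator B) y - p\<bar> = \<bar>C * p * ((Q ^^ (s - 1)) g1 y - (\<integral>y. g1 y \<partial>\<mu>))\<bar>"
        unfolding Qs by (simp only: right_diff_distrib ig1)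
      also have "\<dots> \<le> C * p * e (s - 1) y"
        using e(1)[OF g1, of "s - 1" y] C p(2) by (simp add: abs_mult)
      finally show "\<bar>(Q ^^ s) (indicator B) y - p\<bar> \<le> C * p * e (s - 1) y" .
    qed (use e(2) in simp)
    finally show ?thesis by simp
  qed
  have 3: "\<bar>L3 - \<gamma> * prob A\<bar> \<le> (\<integral>y. e (2 * s) y \<partial>\<mu>)"
    unfolding L3_def \<gamma>_def by (rule expectation_approx[OF AM Q_pow_unit_funs[OF g] e(1)[OF g] e(2)])
  have "L1 - p * L3 = (L1 - \<gamma> * a) + \<gamma> * (a - p * prob A) - p * (L3 - \<gamma> * prob A)"
    by (simp add: algebra_simps)
  also have "\<bar>\<dots>\<bar> \<le> \<bar>L1 - \<gamma> * a\<bar> + \<bar>\<gamma> * (a - p * prob A)\<bar> + \<bar>p * (L3 - \<gamma> * prob A)\<bar>" by linarith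
  also have "\<bar>\<gamma> * (a - p * prob A)\<bar> \<le> \<bar>a - p * prob A\<bar>"
    using \<gamma> by (simp add: abs_mult mult_left_le_one_le)
  also have "\<bar>p * (L3 - \<gamma> * prob A)\<bar> \<le> p * (\<integral>y. e (2 * s) y \<partial>\<mu>)"
    using 3 p(2) by (simp add: abs_mult)
  finally have "\<bar>L1 - p * L3\<bar> \<le> p * (\<epsilon> + C * (\<integral>y. e (s - 1) y \<partial>\<mu>) + (\<integral>y. e (2 * s) y \<partial>\<mu>))"
    using 1 2 by (simp add: algebra_simps)
  then show ?thesis unfolding L1_def L3_def .
qed

text \<open>The count \<open>k - 1\<close> is shared between past and future in \<open>k\<close>
  ways. For each of them the past count is an event up to time \<open>i - s\<close>, and the future
  count is represented through the state at time \<open>i + s\<close>, which is the setting of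
  \<open>mixing_block\<close>.\<close>

lemma prob_past_future:
  fixes l :: nat
  assumes i: "s \<le> i" and k: "k > 0"
  defines "past \<equiv> visits B 0 (Suc (i - s))" and "fut \<equiv> visits B (i + s) l"
  shows "\<bar>prob {\<omega> \<in> space M. Y i \<omega> \<in> B \<and> past \<omega> + fut \<omega> = k - 1} - p * prob {\<omega> \<in> space M. past \<omega> + fut \<omega> = k - 1}\<bar>
    \<le> real k * (p * (\<epsilon> + C * (\<integral>y. e (s - 1) y \<partial>\<mu>) + (\<integral>y. e (2 * s) y \<partial>\<mu>)))"
proof -
  let ?\<eta> = "p * (\<epsilon> + C * (\<integral>y. e (s - 1) y \<partial>\<mu>) + (\<integral>y. e (2 * s) y \<partial>\<mu>))"
  have [measurable]: "past \<in> measurable M (count_space UNIV)" "fut \<in> measurable M (count_space UNIV)"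
    unfolding past_def fut_def using B by auto
  note B [measurable]
  define E1 E2 where "E1 a = {\<omega> \<in> space M. Y i \<omega> \<in> B \<and> past \<omega> = a \<and> fut \<omega> = k - 1 - a}"
    and "E2 a = {\<omega> \<in> space M. past \<omega> = a \<and> fut \<omega> = k - 1 - a}" for a
  have [measurable]: "E1 a \<in> events" "E2 a \<in> events" for a unfolding E1_def E2_def by measurable
  have "prob {\<omega> \<in> space M. Y i \<omega> \<in> B \<and> past \<omega> + fut \<omega> = k - 1} = prob (\<Union>a\<in>{..<k}. E1 a)"
    using k by (intro arg_cong[where f=prob]) (auto simp: E1_def)
  also have "\<dots> = (\<Sum>a<k. prob (E1 a))"
    by (rule finite_measure_finite_Union) (auto simp: disjoint_family_on_def E1_def)
  finally have e1: "prob {\<omega> \<in> space M. Y i \<omega> \<in> B \<and> past \<omega> + fut \<omega> = k - 1} = (\<Sum>a<k. prob (E1 a))" .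
  have "prob {\<omega> \<in> space M. past \<omega> + fut \<omega> = k - 1} = prob (\<Union>a\<in>{..<k}. E2 a)"
    using k by (intro arg_cong[where f=prob]) (auto simp: E2_def)
  also have "\<dots> = (\<Sum>a<k. prob (E2 a))"
    by (rule finite_measure_finite_Union) (auto simp: disjoint_family_on_def E2_def)
  finally have e2: "prob {\<omega> \<in> space M. past \<omega> + fut \<omega> = k - 1} = (\<Sum>a<k. prob (E2 a))" .
  have term_le: "\<bar>prob (E1 a) - p * prob (E2 a)\<bar> \<le> ?\<eta>" for a
  proof -
    obtain c where c: "c \<in> unit_funs"
      "\<And>i A. A \<in> sets (F i) \<Longrightarrow> prob {\<omega> \<in> A. visits B i l \<omega> = k - 1 - a} = (\<integral>\<omega>. indicator A \<omega> * c (Y i \<omega>) \<partial>M)"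
      using prob_future[OF B, of l "k - 1 - a"] by auto
    let ?j = "i - s"
    define A where "A = {\<omega> \<in> space M. past \<omega> = a}"
    have A: "A \<in> sets (F ?j)"
    proof -
      have "past \<in> measurable (F ?j) (count_space UNIV)" unfolding past_def using B by (intro visits_measurable_F) auto
      from measurable_sets[OF this, of "{a}"] show ?thesis by (simp add: A_def vimage_def Int_def conj_commute)
    qed
    define A' where "A' = A \<inter> (Y i -` B \<inter> space M)"
    have A': "A' \<in> sets (F i)"
      using A F_mono'[of ?j i] measurable_sets[OF Y_adapted[of i] B] by (auto simp: A'_def)
    have AA: "A \<in> sets (F (i + s))" "A' \<in> sets (F (i + s))"
      using A A' F_mono'[OF trans_le_add1[OF diff_le_self], of i s s] F_mono'[of i "i + s"] by auto
    have "E1 a = {\<omega> \<in> A'. visits B (i + s) l \<omega> = k - 1 - a}" by (auto simp: E1_def A'_def A_def fut_def)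
    then have "prob (E1 a) = (\<integral>\<omega>. indicator A' \<omega> * c (Y (i + s) \<omega>) \<partial>M)" using c(2)[OF AA(2)] by simp
    also have "\<dots> = (\<integral>\<omega>. indicator A' \<omega> * (Q ^^ s) c (Y i \<omega>) \<partial>M)" by (rule markov_pow[OF A' c(1)])
    also have "\<dots> = (\<integral>\<omega>. indicator A \<omega> * (indicator B (Y (?j + s) \<omega>) * (Q ^^ s) c (Y (?j + s) \<omega>)) \<partial>M)"
      using i by (intro Bochner_Integration.integral_cong) (auto simp: A'_def indicator_def)
    finally have 1: "prob (E1 a) = \<dots>" .
    have "E2 a = {\<omega> \<in> A. visits B (i + s) l \<omega> = k - 1 - a}" by (auto simp: E2_def A_def fut_def)
    then have "prob (E2 a) = (\<integral>\<omega>. indicator A \<omega> * c (Y (i + s) \<omega>) \<partial>M)" using c(2)[OF AA(1)] by simp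
    also have "i + s = ?j + 2 * s" using i by simp
    also have "(\<integral>\<omega>. indicator A \<omega> * c (Y (?j + 2 * s) \<omega>) \<partial>M) = (\<integral>\<omega>. indicator A \<omega> * (Q ^^ (2 * s)) c (Y ?j \<omega>) \<partial>M)"
      by (rule markov_pow[OF A c(1)])
    finally have 2: "prob (E2 a) = \<dots>" .
    show ?thesis unfolding 1 2 by (rule mixing_block[OF A c(1)])
  qed
  have "\<bar>(\<Sum>a<k. prob (E1 a)) - p * (\<Sum>a<k. prob (E2 a))\<bar> = \<bar>\<Sum>a<k. (prob (E1 a) - p * prob (E2 a))\<bar>"
    by (simp add: sum_subtractf sum_distrib_left)
  also have "\<dots> \<le> (\<Sum>a<k. \<bar>prob (E1 a) - p * prob (E2 a)\<bar>)" by (rule sum_abs)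
  also have "\<dots> \<le> (\<Sum>a<k. ?\<eta>)" by (intro sum_mono term_le)
  finally show ?thesis unfolding e1 e2 by simp
qed

text \<open>Replacing the full count by \<open>past + fut\<close> alters the first event only if
  there is a second visit close to \<open>i\<close>, at a cost of order \<open>p\<^sup>2\<close> by
  \<open>prob_two_visits\<close>. It alters the second event with probability of order
  \<open>p\<close>, but that event is multiplied by \<open>p\<close>. The comparison that remains is
  \<open>prob_past_future\<close>.\<close>

lemma visit_term:
  assumes i: "s \<le> i" "i + s < n" and k: "k > 0"
  shows "\<bar>prob {\<omega> \<in> space M. Y i \<omega> \<in> B \<and> visits B 0 n \<omega> = k} - p * prob {\<omega> \<in> space M. visits B 0 n \<omega> = k - 1}\<bar>
    \<le> p * (2 * real s * (C + 1) * p + real k * (\<epsilon> + C * (\<integral>y. e (s - 1) y \<partial>\<mu>) + (\<integral>y. e (2 * s) y \<partial>\<mu>)))"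
proof -
  define past fut where "past = visits B 0 (Suc (i - s))" and "fut = visits B (i + s) (n - i - s)"
  define mid1 mid2 where "mid1 = visits B (Suc (i - s)) (s - 1)" and "mid2 = visits B (Suc i) (s - 1)"
  have dec: "visits B 0 n \<omega> = past \<omega> + mid1 \<omega> + indicator B (Y i \<omega>) + mid2 \<omega> + fut \<omega>" for \<omega>
  proof -
    have n: "n = Suc (i - s) + ((s - 1) + Suc ((s - 1) + (n - i - s)))" using i s by simp
    have "Suc (i - s) + (s - 1) = i" "Suc i + (s - 1) = i + s" using i s by auto
    then show ?thesis
      by (subst n, unfold visits_add visits_Suc_left)
         (simp add: past_def fut_def mid1_def mid2_def visits_add visits_Suc_left del: add_Suc)
  qed
  define V where "V r = Y r -` B \<inter> space M" for r
  have [measurable]: "V r \<in> events" for r using B unfolding V_def by measurable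
  have PV: "prob (V r) = p" for r unfolding V_def p(1) by (rule prob_Y[OF B])
  \<comment> \<open>The window around \<open>i\<close> without \<open>i\<close> itself:
    \<open>s - 1\<close> times on either side.\<close>
  define R where "R = {Suc (i - s)..<i} \<union> {Suc i..<i + s}"
  have R: "finite R" "i \<notin> R" by (auto simp: R_def)
  have cR: "card R \<le> 2 * s - 2"
    unfolding R_def using i s by (intro order_trans[OF card_Un_le]) auto
  have mid0: "mid1 \<omega> = 0 \<and> mid2 \<omega> = 0" if "\<And>r. r \<in> R \<Longrightarrow> Y r \<omega> \<notin> B" for \<omega>
    using that i s unfolding mid1_def mid2_def visits_def R_def by auto
  have [measurable]: "past \<in> measurable M (count_space UNIV)" "fut \<in> measurable M (count_space UNIV)"
    unfolding past_def fut_def using B by auto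
  note B [measurable]
  define D D' where "D = (\<Union>r\<in>R. V r \<inter> V i)" and "D' = (\<Union>r\<in>insert i R. V r)"
  have [measurable]: "D \<in> events" "D' \<in> events" unfolding D_def D'_def using R by auto
  have PD: "prob D \<le> 2 * real s * (C * p * p)"
  proof -
    have "prob D \<le> (\<Sum>r\<in>R. prob (V r \<inter> V i))" unfolding D_def using R by (intro measure_UNION_le) auto
    also have "\<dots> \<le> (\<Sum>r\<in>R. C * p * p)"
    proof (rule sum_mono)
      fix r assume "r \<in> R"
      then have "r \<noteq> i" using R by auto
      then show "prob (V r \<inter> V i) \<le> C * p * p" unfolding V_def using prob_two_visits[OF B QB, of r i] by (simp add: p(1))
    qed
    also have "\<dots> = real (card R) * (C * p * p)" by simp
    also have "\<dots> \<le> 2 * real s * (C * p * p)" using cR C p(2) by (intro mult_right_mono) auto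
    finally show ?thesis .
  qed
  have PD': "prob D' \<le> 2 * real s * p"
  proof -
    have "prob D' \<le> (\<Sum>r\<in>insert i R. prob (V r))" unfolding D'_def using R by (intro measure_UNION_le) auto
    also have "\<dots> = real (card (insert i R)) * p" by (simp add: PV)
    also have "\<dots> \<le> 2 * real s * p" using cR R s p(2) by (intro mult_right_mono) auto
    finally show ?thesis .
  qed
  have VD: "Y r \<omega> \<in> B \<Longrightarrow> \<omega> \<in> space M \<Longrightarrow> \<omega> \<in> V r" for r \<omega> by (simp add: V_def)
  have 1: "\<bar>prob {\<omega> \<in> space M. Y i \<omega> \<in> B \<and> visits B 0 n \<omega> = k} - prob {\<omega> \<in> space M. Y i \<omega> \<in> B \<and> past \<omega> + fut \<omega> = k - 1}\<bar> \<le> prob D"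
  proof (rule abs_prob_diff_le)
    have *: "visits B 0 n \<omega> = k \<longleftrightarrow> past \<omega> + fut \<omega> = k - 1" if "Y i \<omega> \<in> B" "\<omega> \<in> space M" "\<omega> \<notin> D" for \<omega>
    proof -
      have "Y r \<omega> \<notin> B" if "r \<in> R" for r
        using \<open>\<omega> \<notin> D\<close> that VD[OF \<open>Y i \<omega> \<in> B\<close> \<open>\<omega> \<in> space M\<close>] VD[OF _ \<open>\<omega> \<in> space M\<close>, of r] by (auto simp: D_def)
      from mid0[OF this] show ?thesis using dec[of \<omega>] that k by auto
    qed
    show "{\<omega> \<in> space M. Y i \<omega> \<in> B \<and> visits B 0 n \<omega> = k} \<subseteq> {\<omega> \<in> space M. Y i \<omega> \<in> B \<and> past \<omega> + fut \<omega> = k - 1} \<union> D"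
      "{\<omega> \<in> space M. Y i \<omega> \<in> B \<and> past \<omega> + fut \<omega> = k - 1} \<subseteq> {\<omega> \<in> space M. Y i \<omega> \<in> B \<and> visits B 0 n \<omega> = k} \<union> D"
      using * by blast+
  qed (use B in measurable)
  have 2: "\<bar>prob {\<omega> \<in> space M. visits B 0 n \<omega> = k - 1} - prob {\<omega> \<in> space M. past \<omega> + fut \<omega> = k - 1}\<bar> \<le> prob D'"
  proof (rule abs_prob_diff_le)
    have *: "visits B 0 n \<omega> = past \<omega> + fut \<omega>" if "\<omega> \<in> space M" "\<omega> \<notin> D'" for \<omega>
    proof -
      have *: "Y r \<omega> \<notin> B" if "r \<in> insert i R" for r
        using \<open>\<omega> \<notin> D'\<close> that VD[OF _ \<open>\<omega> \<in> space M\<close>, of r] by (auto simp: D'_def)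
      from mid0[of \<omega>] * show ?thesis using dec[of \<omega>] by auto
    qed
    show "{\<omega> \<in> space M. visits B 0 n \<omega> = k - 1} \<subseteq> {\<omega> \<in> space M. past \<omega> + fut \<omega> = k - 1} \<union> D'"
      "{\<omega> \<in> space M. past \<omega> + fut \<omega> = k - 1} \<subseteq> {\<omega> \<in> space M. visits B 0 n \<omega> = k - 1} \<union> D'"
      using * by auto
  qed (use B in measurable)
  have 3: "\<bar>prob {\<omega> \<in> space M. Y i \<omega> \<in> B \<and> past \<omega> + fut \<omega> = k - 1} - p * prob {\<omega> \<in> space M. past \<omega> + fut \<omega> = k - 1}\<bar>
    \<le> real k * (p * (\<epsilon> + C * (\<integral>y. e (s - 1) y \<partial>\<mu>) + (\<integral>y. e (2 * s) y \<partial>\<mu>)))"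
    unfolding past_def fut_def by (rule prob_past_future[OF i(1) k])
  define x y x' y' \<eta> where "x = prob {\<omega> \<in> space M. Y i \<omega> \<in> B \<and> visits B 0 n \<omega> = k}"
    and "y = prob {\<omega> \<in> space M. visits B 0 n \<omega> = k - 1}"
    and "x' = prob {\<omega> \<in> space M. Y i \<omega> \<in> B \<and> past \<omega> + fut \<omega> = k - 1}"
    and "y' = prob {\<omega> \<in> space M. past \<omega> + fut \<omega> = k - 1}"
    and "\<eta> = \<epsilon> + C * (\<integral>y. e (s - 1) y \<partial>\<mu>) + (\<integral>y. e (2 * s) y \<partial>\<mu>)"
  have "\<bar>x - p * y\<bar> \<le> \<bar>x - x'\<bar> + \<bar>x' - p * y'\<bar> + \<bar>p * (y - y')\<bar>" by (simp add: right_diff_distrib)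
  also have "\<bar>p * (y - y')\<bar> \<le> p * (2 * real s * p)"
    using 2 PD' p(2) unfolding y_def[symmetric] y'_def[symmetric] by (simp add: abs_mult)
  also have "\<bar>x - x'\<bar> \<le> 2 * real s * (C * p * p)" using 1 PD unfolding x_def x'_def by linarith
  also have "\<bar>x' - p * y'\<bar> \<le> real k * (p * \<eta>)" using 3 unfolding x'_def y'_def \<eta>_def .
  finally have "\<bar>x - p * y\<bar> \<le> p * (2 * real s * (C + 1) * p + real k * \<eta>)"
    by (simp add: algebra_simps)
  then show ?thesis unfolding x_def y_def \<eta>_def .
qed

text \<open>Weighting the event that there are \<open>k\<close> visits by the number of visits gives
  \<open>k\<close> times its probability; expanding the number of visits as a sum over times
  produces the terms of \<open>visit_term\<close>.\<close>

lemma poisson_recursion: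
  assumes k: "k > 0"
  shows "\<bar>real k * prob {\<omega> \<in> space M. visits B 0 n \<omega> = k} - real n * p * prob {\<omega> \<in> space M. visits B 0 n \<omega> = k - 1}\<bar>
    \<le> 2 * real s * p + real n * (p * (2 * real s * (C + 1) * p + real k * (\<epsilon> + C * (\<integral>y. e (s - 1) y \<partial>\<mu>) + (\<integral>y. e (2 * s) y \<partial>\<mu>))))"
    (is "_ \<le> _ + _ * ?T")
proof -
  note B [measurable]
  define q where "q = prob {\<omega> \<in> space M. visits B 0 n \<omega> = k - 1}"
  define x where "x i = prob {\<omega> \<in> space M. Y i \<omega> \<in> B \<and> visits B 0 n \<omega> = k}" for i
  have sumx: "(\<Sum>i<n. x i) = real k * prob {\<omega> \<in> space M. visits B 0 n \<omega> = k}"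
  proof -
    have "(\<Sum>i<n. x i) = (\<Sum>i<n. \<integral>\<omega>. indicator {\<omega> \<in> space M. Y i \<omega> \<in> B \<and> visits B 0 n \<omega> = k} \<omega> \<partial>M)"
      unfolding x_def by simp
    also have "\<dots> = (\<integral>\<omega>. (\<Sum>i<n. indicator {\<omega> \<in> space M. Y i \<omega> \<in> B \<and> visits B 0 n \<omega> = k} \<omega>) \<partial>M)"
      by (intro Bochner_Integration.integral_sum[symmetric]) (simp add: emeasure_eq_measure)
    also have "\<dots> = (\<integral>\<omega>. real k * indicator {\<omega> \<in> space M. visits B 0 n \<omega> = k} \<omega> \<partial>M)"
    proof (intro Bochner_Integration.integral_cong refl)
      fix \<omega> assume \<omega>: "\<omega> \<in> space M"
      have "(\<Sum>i<n. indicator {\<omega> \<in> space M. Y i \<omega> \<in> B \<and> visits B 0 n \<omega> = k} \<omega> :: real)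
         = (\<Sum>i<n. real (indicator B (Y i \<omega>)) * indicator {\<omega> \<in> space M. visits B 0 n \<omega> = k} \<omega>)"
        using \<omega> by (intro sum.cong) (auto simp: indicator_def)
      also have "\<dots> = real (visits B 0 n \<omega>) * indicator {\<omega> \<in> space M. visits B 0 n \<omega> = k} \<omega>"
        by (simp add: visits_def sum_distrib_right atLeast0LessThan)
      finally show "(\<Sum>i<n. indicator {\<omega> \<in> space M. Y i \<omega> \<in> B \<and> visits B 0 n \<omega> = k} \<omega> :: real)
         = real k * indicator {\<omega> \<in> space M. visits B 0 n \<omega> = k} \<omega>" by (simp add: indicator_def)
    qed
    also have "\<dots> = real k * prob {\<omega> \<in> space M. visits B 0 n \<omega> = k}" by simp
    finally show ?thesis .
  qed
  have q: "0 \<le> q" "q \<le> 1" by (auto simp: q_def)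
  have x: "0 \<le> x i" "x i \<le> p" for i
  proof -
    have "x i \<le> prob (Y i -` B \<inter> space M)" unfolding x_def by (intro finite_measure_mono) auto
    then show "x i \<le> p" by (simp add: prob_Y[OF B] p(1))
  qed (simp add: x_def)
  \<comment> \<open>Near the two ends the window does not fit. These at most \<open>2 * s\<close>
    indices are estimated trivially by \<open>p\<close> each.\<close>
  define bad where "bad = {i. i < n \<and> (i < s \<or> n \<le> i + s)}"
  define good where "good = {i. s \<le> i \<and> i + s < n}"
  have bg: "{..<n} = bad \<union> good" "bad \<inter> good = {}" "finite bad" "finite good"
    by (auto simp: bad_def good_def intro: finite_subset[of _ "{..<n}"])
  have cb: "card bad \<le> 2 * s"
  proof -
    have "bad \<subseteq> {..<s} \<union> {n - s..<n}" by (auto simp: bad_def)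
    then have "card bad \<le> card ({..<s} \<union> {n - s..<n})" by (intro card_mono) auto
    also have "\<dots> \<le> s + s" by (intro order_trans[OF card_Un_le]) auto
    finally show ?thesis by simp
  qed
  have cg: "card good \<le> n" using card_mono[of "{..<n}" good] by (simp add: good_def subset_eq)
  have "real k * prob {\<omega> \<in> space M. visits B 0 n \<omega> = k} - real n * p * q = (\<Sum>i<n. (x i - p * q))"
    by (simp add: sum_subtractf sumx)
  also have "\<bar>\<dots>\<bar> \<le> (\<Sum>i<n. \<bar>x i - p * q\<bar>)" by (rule sum_abs)
  also have "\<dots> = (\<Sum>i\<in>bad. \<bar>x i - p * q\<bar>) + (\<Sum>i\<in>good. \<bar>x i - p * q\<bar>)"
    unfolding bg(1) using bg by (intro sum.union_disjoint) auto
  also have "(\<Sum>i\<in>bad. \<bar>x i - p * q\<bar>) \<le> (\<Sum>i\<in>bad. p)"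
  proof (rule sum_mono)
    fix i
    have "0 \<le> p * q" "p * q \<le> p" using q p(2) by (auto simp: mult_left_le)
    then show "\<bar>x i - p * q\<bar> \<le> p" using x[of i] by auto
  qed
  also have "(\<Sum>i\<in>bad. p) = real (card bad) * p" by simp
  also have "\<dots> \<le> 2 * real s * p" using cb p(2) by (intro mult_right_mono) auto
  also have "(\<Sum>i\<in>good. \<bar>x i - p * q\<bar>) \<le> (\<Sum>i\<in>good. ?T)"
    unfolding x_def q_def by (intro sum_mono visit_term k) (auto simp: good_def)
  also have "\<dots> = real (card good) * ?T" by simp
  also have "\<dots> \<le> real n * ?T"
  \<comment> \<open>Replacing the number of good indices by \<open>n\<close> requires a nonnegative
    bound. A good index provides this through \<open>visit_term\<close>; without one it is read off
    from the hypotheses.\<close>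
  proof (cases "good = {}")
    case False
    then obtain i where "i \<in> good" by auto
    then have "0 \<le> ?T" using order_trans[OF abs_ge_zero visit_term[of i n k]] k by (auto simp: good_def)
    then show ?thesis using cg by (intro mult_right_mono) auto
  next
    case True
    have "0 \<le> ?T"
    proof -
      have "0 \<le> e m y" for m y
        using e(1)[OF unit_funs_const[of 0], of m y] abs_ge_zero order_trans by fastforce
      then have "0 \<le> (\<integral>y. e m y \<partial>\<mu>)" for m by (intro integral_nonneg_AE) auto
      moreover have "B \<noteq> {}" using p by auto
      then have "0 \<le> \<epsilon>" using eB \<open>\<And>y m. 0 \<le> e m y\<close> order_trans by blast
      ultimately show ?thesis using C p(2) by (intro mult_nonneg_nonneg add_nonneg_nonneg) auto
    qed
    then show ?thesis using True by simp
  qed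
  finally show ?thesis unfolding q_def by simp
qed

end

end

text \<open>The recursion makes \<open>q n k\<close> asymptotic to \<open>c k * q n 0\<close>, so
  for fixed \<open>m\<close> the partial sum is close to \<open>S m * q n 0\<close>. That sum lies
  between \<open>1 - T / (m + 1)\<close> and 1, while \<open>S m\<close> tends to
  \<open>exp \<tau>\<close>. Choosing \<open>m\<close> before \<open>n\<close> pins
  \<open>q n 0\<close> to \<open>exp (- \<tau>)\<close>.\<close>

lemma tendsto_poisson_of_recursion:
  fixes q :: "nat \<Rightarrow> nat \<Rightarrow> real"
  assumes rec: "\<And>k. (\<lambda>n. real (Suc k) * q n (Suc k) - \<tau> * q n k) \<longlonglongrightarrow> 0"
    and le: "\<And>n m. (\<Sum>k\<le>m. q n k) \<le> 1"
    and tight: "\<And>m. \<forall>\<^sub>F n in sequentially. 1 - T / real (Suc m) \<le> (\<Sum>k\<le>m. q n k)"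
    and \<tau>: "\<tau> \<ge> 0"
  shows "(\<lambda>n. q n k) \<longlonglongrightarrow> exp (- \<tau>) * \<tau> ^ k / fact k"
proof -
  define c where "c k = \<tau> ^ k / fact k" for k
  have d: "(\<lambda>n. q n k - c k * q n 0) \<longlonglongrightarrow> 0" for k
  proof (induction k)
    case (Suc k)
    have "(\<lambda>n. (1 / real (Suc k)) * ((real (Suc k) * q n (Suc k) - \<tau> * q n k) + \<tau> * (q n k - c k * q n 0))) \<longlonglongrightarrow> (1 / real (Suc k)) * (0 + \<tau> * 0)"
      by (intro tendsto_intros rec Suc)
    moreover have "(1 / real (Suc k)) * ((real (Suc k) * q n (Suc k) - \<tau> * q n k) + \<tau> * (q n k - c k * q n 0)) = q n (Suc k) - c (Suc k) * q n 0" for n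
    proof -
      have c: "c (Suc k) = \<tau> * c k / real (Suc k)" by (simp add: c_def)
      show ?thesis unfolding c by (simp add: field_simps del: of_nat_Suc)
    qed
    ultimately show ?case by (simp only: mult_zero_right add_0)
  qed (simp add: c_def)
  define S where "S m = (\<Sum>k\<le>m. c k)" for m
  have S: "S \<longlonglongrightarrow> exp \<tau>"
    using exp_converges[of \<tau>] unfolding sums_def_le S_def c_def by (simp add: divide_inverse mult.commute scaleR_conv_of_real)
  have Spos: "S m > 0" for m
  proof -
    have "c 0 \<le> S m" unfolding S_def using \<tau> by (intro member_le_sum) (auto simp: c_def)
    then show ?thesis by (simp add: c_def)
  qed
  have dS: "(\<lambda>n. (\<Sum>k\<le>m. q n k) - S m * q n 0) \<longlonglongrightarrow> 0" for m
    using tendsto_sum[of "{..m}" "\<lambda>k n. q n k - c k * q n 0" "\<lambda>_. 0", OF d]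
    by (simp add: S_def sum_subtractf sum_distrib_right)
  have q0: "(\<lambda>n. q n 0) \<longlonglongrightarrow> exp (- \<tau>)"
  proof (rule order_tendstoI)
    fix a assume a: "a < exp (- \<tau>)"
    have "(\<lambda>m. (1 - T / real (Suc m)) - a * S m) \<longlonglongrightarrow> (1 - 0) - a * exp \<tau>"
      by (intro tendsto_intros S LIMSEQ_Suc lim_const_over_n)
    moreover have "(1 - 0) - a * exp \<tau> > 0" using a by (simp add: exp_minus field_simps)
    ultimately have "\<forall>\<^sub>F m in sequentially. (1 - T / real (Suc m)) - a * S m > 0" by (rule order_tendstoD)
    then obtain m where m: "(1 - T / real (Suc m)) - a * S m > 0" by (auto simp: eventually_sequentially)
    from tight[of m] order_tendstoD(2)[OF dS[of m] m]
    show "\<forall>\<^sub>F n in sequentially. a < q n 0"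
    proof eventually_elim
      case (elim n)
      then have "a * S m < q n 0 * S m" by (simp add: mult.commute)
      then show ?case using Spos[of m] by simp
    qed
  next
    fix a assume a: "exp (- \<tau>) < a"
    have "(\<lambda>m. 1 - a * S m) \<longlonglongrightarrow> 1 - a * exp \<tau>" by (intro tendsto_intros S)
    moreover have "1 - a * exp \<tau> < 0" using a by (simp add: exp_minus field_simps)
    ultimately have "\<forall>\<^sub>F m in sequentially. 1 - a * S m < 0" by (rule order_tendstoD)
    then obtain m where m: "1 - a * S m < 0" by (auto simp: eventually_sequentially)
    from order_tendstoD(1)[OF dS[of m] m]
    show "\<forall>\<^sub>F n in sequentially. q n 0 < a"
    proof eventually_elim
      case (elim n)
      then have "q n 0 * S m < a * S m" using le[where n=n and m=m] by (simp add: mult.commute)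
      then show ?case using Spos[of m] by simp
    qed
  qed
  have "(\<lambda>n. (q n k - c k * q n 0) + c k * q n 0) \<longlonglongrightarrow> 0 + c k * exp (- \<tau>)"
    by (intro tendsto_add d tendsto_mult_left q0)
  then show ?thesis by (simp add: c_def mult.commute)
qed

section \<open>Tightness and the Poisson limit for a chain\<close>

context stationary_markov_chain
begin

text \<open>By stationarity the mean number of visits is \<open>n * measure \<mu> B\<close>, and the
  lower bound is Markov's inequality.\<close>

lemma sum_prob_visits_bounds:
  assumes B: "B \<in> sets borel"
  shows "1 - real n * measure \<mu> B / real (Suc m) \<le> (\<Sum>k\<le>m. prob {\<omega> \<in> space M. visits B 0 n \<omega> = k})"
    and "(\<Sum>k\<le>m. prob {\<omega> \<in> space M. visits B 0 n \<omega> = k}) \<le> 1"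
proof -
  note B [measurable]
  have eq: "(\<Sum>k\<le>m. prob {\<omega> \<in> space M. visits B 0 n \<omega> = k}) = prob {\<omega> \<in> space M. visits B 0 n \<omega> \<le> m}"
  proof -
    have "(\<Sum>k\<le>m. prob {\<omega> \<in> space M. visits B 0 n \<omega> = k}) = prob (\<Union>k\<in>{..m}. {\<omega> \<in> space M. visits B 0 n \<omega> = k})"
      by (rule finite_measure_finite_Union[symmetric]) (auto simp: disjoint_family_on_def)
    also have "(\<Union>k\<in>{..m}. {\<omega> \<in> space M. visits B 0 n \<omega> = k}) = {\<omega> \<in> space M. visits B 0 n \<omega> \<le> m}" by auto
    finally show ?thesis .
  qed
  show "(\<Sum>k\<le>m. prob {\<omega> \<in> space M. visits B 0 n \<omega> = k}) \<le> 1" unfolding eq by simp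
  have iB: "indicator B \<in> unit_funs" by (rule unit_funs_indicator[OF B])
  have int: "integrable M (\<lambda>\<omega>. indicator B (Y i \<omega>) :: real)" for i
    by (rule integrable_unit_fun[OF iB Y_measurable])
  have v: "real (visits B 0 n \<omega>) = (\<Sum>i<n. indicator B (Y i \<omega>))" for \<omega>
    by (simp add: visits_def atLeast0LessThan) (auto intro!: sum.cong simp: indicator_def)
  have ev: "(\<integral>\<omega>. real (visits B 0 n \<omega>) \<partial>M) = real n * measure \<mu> B"
    unfolding v using int integral_Y[of "indicator B"] B by (simp add: Bochner_Integration.integral_sum)
  have "prob {\<omega> \<in> space M. real (visits B 0 n \<omega>) \<ge> real (Suc m)} \<le> (\<integral>\<omega>. real (visits B 0 n \<omega>) \<partial>M) / real (Suc m)"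
    by (rule integral_Markov_inequality_measure[where A="space M"]) (auto simp: v intro!: int AE_I2 sum_nonneg)
  moreover have "prob {\<omega> \<in> space M. visits B 0 n \<omega> \<le> m} = 1 - prob {\<omega> \<in> space M. real (visits B 0 n \<omega>) \<ge> real (Suc m)}"
    by (subst prob_compl[symmetric]) (auto intro!: arg_cong[where f=prob])
  ultimately show "1 - real n * measure \<mu> B / real (Suc m) \<le> (\<Sum>k\<le>m. prob {\<omega> \<in> space M. visits B 0 n \<omega> = k})"
    unfolding eq ev by simp
qed

theorem visits_tendsto_poisson:
  fixes B :: "nat \<Rightarrow> 's set" and N :: "nat \<Rightarrow> nat" and e :: "nat \<Rightarrow> 's \<Rightarrow> real" and \<eta> :: "nat \<Rightarrow> real"
  assumes B: "\<And>n. B n \<in> sets borel"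
    and p0: "\<forall>\<^sub>F n in sequentially. measure \<mu> (B n) > 0" "(\<lambda>n. measure \<mu> (B n)) \<longlonglongrightarrow> 0"
    and N: "(\<lambda>n. real (N n) * measure \<mu> (B n)) \<longlonglongrightarrow> \<tau>" and \<tau>: "\<tau> \<ge> 0"
    and C: "C > 0" and QB: "\<forall>\<^sub>F n in sequentially. \<forall>y. Q (indicator (B n)) y \<le> C * measure \<mu> (B n)"
    and e: "\<And>m g y. g \<in> unit_funs \<Longrightarrow> \<bar>(Q ^^ m) g y - (\<integral>y. g y \<partial>\<mu>)\<bar> \<le> e m y" "\<And>m. integrable \<mu> (e m)"
    and e0: "(\<lambda>m. \<integral>y. e m y \<partial>\<mu>) \<longlonglongrightarrow> 0"
    and \<eta>: "\<forall>\<^sub>F n in sequentially. \<forall>m. \<forall>y \<in> B n. e m y \<le> \<eta> m" "\<eta> \<longlonglongrightarrow> 0"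
  shows "(\<lambda>n. prob {\<omega> \<in> space M. visits (B n) 0 (N n) \<omega> = k}) \<longlonglongrightarrow> exp (- \<tau>) * \<tau> ^ k / fact k"
proof -
  define p where "p n = measure \<mu> (B n)" for n
  define q where "q n k = prob {\<omega> \<in> space M. visits (B n) 0 (N n) \<omega> = k}" for n k
  \<comment> \<open>The window parameter is \<open>Suc s\<close>, which is positive and makes its
    predecessor equal to \<open>s\<close>.\<close>
  define \<theta> where "\<theta> s = \<eta> (Suc s) + C * (\<integral>y. e s y \<partial>\<mu>) + (\<integral>y. e (2 * Suc s) y \<partial>\<mu>)" for s
  have "filterlim (\<lambda>s. 2 * Suc s) sequentially sequentially"
    by (rule filterlim_subseq) (simp add: strict_mono_def)
  from filterlim_compose[OF e0 this] have e2: "(\<lambda>s. \<integral>y. e (2 * Suc s) y \<partial>\<mu>) \<longlonglongrightarrow> 0" .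
  have \<theta>0: "\<theta> \<longlonglongrightarrow> 0 + C * 0 + 0"
    unfolding \<theta>_def[abs_def] by (intro tendsto_intros LIMSEQ_Suc[OF \<eta>(2)] e0 e2)
  have rec: "(\<lambda>n. real (Suc k) * q n (Suc k) - \<tau> * q n k) \<longlonglongrightarrow> 0" for k
  proof (rule tendstoI)
    fix \<epsilon> :: real assume \<epsilon>: "\<epsilon> > 0"
    have "(\<lambda>s. \<tau> * (real (Suc k) * \<theta> s)) \<longlonglongrightarrow> \<tau> * (real (Suc k) * (0 + C * 0 + 0))" by (intro tendsto_intros \<theta>0)
    then have "\<forall>\<^sub>F s in sequentially. \<tau> * (real (Suc k) * \<theta> s) < \<epsilon>" using \<epsilon> by (auto dest: order_tendstoD)
    then obtain s where s: "\<tau> * (real (Suc k) * \<theta> s) < \<epsilon>" by (auto simp: eventually_sequentially)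
    \<comment> \<open>With \<open>s\<close> already fixed, all terms of \<open>U n\<close> vanish as
      \<open>n\<close> grows except the mixing error, whose limit
      \<open>\<tau> * (real (Suc k) * \<theta> s)\<close> is below \<open>\<epsilon>\<close>. The
      last term pays for replacing \<open>real (N n) * p n\<close> by \<open>\<tau>\<close>.\<close>
    define U where "U n = 2 * real (Suc s) * p n + (real (N n) * p n) * (2 * real (Suc s) * (C + 1) * p n + real (Suc k) * \<theta> s) + \<bar>real (N n) * p n - \<tau>\<bar>" for n
    have "U \<longlonglongrightarrow> 2 * real (Suc s) * 0 + \<tau> * (2 * real (Suc s) * (C + 1) * 0 + real (Suc k) * \<theta> s) + \<bar>\<tau> - \<tau>\<bar>"
      unfolding U_def[abs_def] p_def[abs_def] by (intro tendsto_intros p0 N)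
    then have "\<forall>\<^sub>F n in sequentially. U n < \<epsilon>" using s by (intro order_tendstoD(2)) auto
    then show "\<forall>\<^sub>F n in sequentially. dist (real (Suc k) * q n (Suc k) - \<tau> * q n k) 0 < \<epsilon>"
      using p0(1) QB \<eta>(1)
    proof eventually_elim
      case (elim n)
      have "\<bar>real (Suc k) * q n (Suc k) - real (N n) * p n * q n (Suc k - 1)\<bar>
        \<le> 2 * real (Suc s) * p n + real (N n) * (p n * (2 * real (Suc s) * (C + 1) * p n + real (Suc k) * (\<eta> (Suc s) + C * (\<integral>y. e (Suc s - 1) y \<partial>\<mu>) + (\<integral>y. e (2 * Suc s) y \<partial>\<mu>))))"
        unfolding q_def
        by (rule poisson_recursion[OF B]) (use elim C e in \<open>auto simp: p_def\<close>)
      then have "\<bar>real (Suc k) * q n (Suc k) - real (N n) * p n * q n k\<bar>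
        \<le> 2 * real (Suc s) * p n + (real (N n) * p n) * (2 * real (Suc s) * (C + 1) * p n + real (Suc k) * \<theta> s)"
        by (simp add: \<theta>_def mult.assoc)
      moreover have "\<bar>real (N n) * p n * q n k - \<tau> * q n k\<bar> \<le> \<bar>real (N n) * p n - \<tau>\<bar>"
      proof -
        have "\<bar>real (N n) * p n * q n k - \<tau> * q n k\<bar> = \<bar>real (N n) * p n - \<tau>\<bar> * q n k"
          by (simp add: left_diff_distrib[symmetric] abs_mult q_def)
        also have "\<dots> \<le> \<bar>real (N n) * p n - \<tau>\<bar>" by (rule mult_left_le) (auto simp: q_def)
        finally show ?thesis .
      qed
      ultimately have "\<bar>real (Suc k) * q n (Suc k) - \<tau> * q n k\<bar> \<le> U n" unfolding U_def by linarith
      then show ?case using elim by (simp add: dist_real_def)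
    qed
  qed
  have "(\<lambda>n. q n k) \<longlonglongrightarrow> exp (- \<tau>) * \<tau> ^ k / fact k"
  proof (rule tendsto_poisson_of_recursion[OF rec])
    show "(\<Sum>k\<le>m. q n k) \<le> 1" for n m unfolding q_def by (rule sum_prob_visits_bounds[OF B])
    have "\<forall>\<^sub>F n in sequentially. real (N n) * p n < \<tau> + 1"
      using N unfolding p_def by (rule order_tendstoD) simp
    then show "\<forall>\<^sub>F n in sequentially. 1 - (\<tau> + 1) / real (Suc m) \<le> (\<Sum>k\<le>m. q n k)" for m
    proof eventually_elim
      case (elim n)
      then have "1 - (\<tau> + 1) / real (Suc m) \<le> 1 - real (N n) * p n / real (Suc m)"
        by (intro diff_left_mono divide_right_mono) auto
      also have "\<dots> \<le> (\<Sum>k\<le>m. q n k)" unfolding q_def p_def by (rule sum_prob_visits_bounds[OF B])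
      finally show ?case .
    qed
  qed (rule \<tau>)
  then show ?thesis unfolding q_def .
qed

end

section \<open>Harris mixing\<close>

text \<open>\<open>dom\<close> says that \<open>\<nu>\<close> lies below \<open>K\<close>, so
  \<open>K - \<nu>\<close> acts as a positive functional. It is applied to \<open>g - f\<close> and
  \<open>g + f\<close>, and no difference of measures has to be formed.\<close>

lemma abs_integral_diff_dominated:
  fixes f g :: "'s \<Rightarrow> real"
  assumes dom: "\<And>f :: 's \<Rightarrow> real. integrable K f \<Longrightarrow> (\<And>x. 0 \<le> f x) \<Longrightarrow> integrable \<nu> f \<and> (\<integral>x. f x \<partial>\<nu>) \<le> (\<integral>x. f x \<partial>K)"
    and f: "integrable K f" and g: "integrable K g" and fg: "\<And>x. \<bar>f x\<bar> \<le> g x"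
  shows "\<bar>(\<integral>x. f x \<partial>K) - (\<integral>x. f x \<partial>\<nu>)\<bar> \<le> (\<integral>x. g x \<partial>K) - (\<integral>x. g x \<partial>\<nu>)"
proof -
  have g0: "0 \<le> g x" for x using fg[of x] by linarith
  have fg': "0 \<le> g x + f x" for x using fg[of x] by linarith
  have 1: "integrable \<nu> (\<lambda>x. g x - f x)" "(\<integral>x. g x - f x \<partial>\<nu>) \<le> (\<integral>x. g x - f x \<partial>K)"
    using dom[of "\<lambda>x. g x - f x"] f g fg abs_le_D1 by (auto simp: abs_le_iff)
  have 2: "(\<integral>x. g x + f x \<partial>\<nu>) \<le> (\<integral>x. g x + f x \<partial>K)"
    using dom[of "\<lambda>x. g x + f x"] f g fg' by auto
  have ig: "integrable \<nu> g" using dom[OF g g0] by simp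
  have if': "integrable \<nu> f" using Bochner_Integration.integrable_diff[OF ig 1(1)] by simp
  show ?thesis using 1(2) 2 f g ig if' by (simp add: abs_le_iff)
qed

section \<open>Contraction in a weighted oscillation seminorm\<close>

context markov_kernel
begin

context
  fixes V :: "'s \<Rightarrow> real" and \<gamma> L :: real
  assumes V: "V \<in> borel_measurable borel" "\<And>y. 0 \<le> V y"
    and V_int: "\<And>y. integrable (\<kappa> y) V"
    and drift: "\<And>y. (\<integral>z. V z \<partial>\<kappa> y) \<le> \<gamma> * V y + L"
    and \<gamma>: "0 \<le> \<gamma>" "\<gamma> < 1" and L: "0 \<le> L"
    and minor: "\<And>R. \<exists>\<nu>. finite_measure \<nu> \<and> sets \<nu> = sets borel \<and> measure \<nu> UNIV > 0 \<and>
      (\<forall>y. V y \<le> R \<longrightarrow> (\<forall>A \<in> sets borel. emeasure \<nu> A \<le> emeasure (\<kappa> y) A))"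
begin

text \<open>Following Hairer and Mattingly: subtracting the constant \<open>c\<close> turns the oscillation bound into a pointwise bound
  by the weight \<open>w\<close>, so that no coupling of the two kernels is needed.\<close>
lemma harris_contraction:
  obtains \<alpha> \<beta> where "0 \<le> \<alpha>" "\<alpha> < 1" "0 \<le> \<beta>"
    "\<And>\<phi> D. \<phi> \<in> unit_funs \<Longrightarrow> D \<ge> 0 \<Longrightarrow> (\<And>x y. \<bar>\<phi> x - \<phi> y\<bar> \<le> D * (2 + \<beta> * V x + \<beta> * V y)) \<Longrightarrow>
      (\<And>x y. \<bar>Q \<phi> x - Q \<phi> y\<bar> \<le> \<alpha> * D * (2 + \<beta> * V x + \<beta> * V y))"
proof -
  \<comment> \<open>Large enough for \<open>\<gamma> * R + 2 * L < R\<close>: where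
    \<open>V x + V y\<close> is at least \<open>R\<close>, the drift alone contracts.\<close>
  define R where "R = 2 * L / (1 - \<gamma>) + 1"
  have R: "R > 0" "\<gamma> * R + 2 * L < R"
  proof -
    have "R * (1 - \<gamma>) = 2 * L + (1 - \<gamma>)" using \<gamma> by (simp add: R_def field_simps)
    then show "\<gamma> * R + 2 * L < R" using \<gamma> by (simp add: algebra_simps)
    show "R > 0" using \<gamma> L by (simp add: R_def add_nonneg_pos)
  qed
  obtain \<nu> where \<nu>: "finite_measure \<nu>" "sets \<nu> = sets borel" "measure \<nu> UNIV > 0"
    and \<nu>le: "\<And>y A. V y \<le> R \<Longrightarrow> A \<in> sets borel \<Longrightarrow> emeasure \<nu> A \<le> emeasure (\<kappa> y) A"
    using minor[of R] by blast
  interpret \<nu>: finite_measure \<nu> by fact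
  have sp\<nu>: "space \<nu> = UNIV" using sets_eq_imp_space_eq[OF \<nu>(2)] by simp
  define \<eta> where "\<eta> = measure \<nu> UNIV"
  \<comment> \<open>So small that inside level \<open>R\<close> the drift term costs at most
    \<open>\<eta>\<close>, half of the gain \<open>2 * \<eta>\<close> from removing
    \<open>\<nu>\<close> from both kernels.\<close>
  define \<beta> where "\<beta> = \<eta> / (\<gamma> * R + 2 * L + 1)"
  have q: "0 \<le> \<gamma> * R + 2 * L" using \<gamma> L R by simp
  have \<eta>: "\<eta> > 0" using \<nu>(3) by (simp add: \<eta>_def)
  have \<beta>: "\<beta> > 0" "\<beta> * (\<gamma> * R + 2 * L) \<le> \<eta>" using \<eta> q by (auto simp: \<beta>_def field_simps)
  \<comment> \<open>The ratio between the bound after one step and the weight before it at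
    \<open>V x + V y = R\<close>. Beyond \<open>R\<close> the bound grows with slope
    \<open>\<gamma> \<le> \<alpha>1\<close>, so the same ratio suffices.\<close>
  define \<alpha>1 where "\<alpha>1 = (2 + \<beta> * (\<gamma> * R + 2 * L)) / (2 + \<beta> * R)"
  have bR: "2 + \<beta> * R > 0" using \<beta> R by (simp add: add_pos_pos)
  have \<alpha>1: "\<alpha>1 < 1" "\<gamma> \<le> \<alpha>1"
  proof -
    have "\<beta> * (\<gamma> * R + 2 * L) < \<beta> * R" using R \<beta> by (intro mult_strict_left_mono) auto
    then show "\<alpha>1 < 1" using bR by (simp add: \<alpha>1_def)
    have "\<gamma> * 2 \<le> 2" "0 \<le> \<beta> * (2 * L)" using \<gamma> \<beta> L by auto
    then have "\<gamma> * (2 + \<beta> * R) \<le> 2 + \<beta> * (\<gamma> * R + 2 * L)" by (simp add: algebra_simps)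
    then show "\<gamma> \<le> \<alpha>1" using bR by (simp add: \<alpha>1_def pos_le_divide_eq)
  qed
  define \<alpha> where "\<alpha> = max \<alpha>1 (1 - \<eta> / 2)"
  have \<alpha>: "0 \<le> \<alpha>" "\<alpha> < 1" using \<alpha>1 \<gamma> \<eta> by (auto simp: \<alpha>_def)
  show thesis
  proof (rule that[OF \<alpha> less_imp_le[OF \<beta>(1)]])
    fix \<phi> D x y
    assume \<phi>: "\<phi> \<in> unit_funs" and D: "D \<ge> 0" and osc: "\<And>x y. \<bar>\<phi> x - \<phi> y\<bar> \<le> D * (2 + \<beta> * V x + \<beta> * V y)"
    define w where "w u = D * (1 + \<beta> * V u)" for u
    have w0: "0 \<le> w u" for u using D \<beta> V(2)[of u] by (simp add: w_def)
    \<comment> \<open>The greatest lower bound of \<open>\<phi> v + w v\<close>. The oscillation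
      hypothesis says that no \<open>\<phi> u - w u\<close> exceeds these values, so
      \<open>\<phi>\<close> differs from \<open>c\<close> by at most \<open>w\<close>.\<close>
    define c where "c = Inf (range (\<lambda>v. \<phi> v + w v))"
    have bdd: "bdd_below (range (\<lambda>v. \<phi> v + w v))"
      using unit_funsD(2)[OF \<phi>] w0 by (intro bdd_belowI2[of _ 0]) (auto intro: add_nonneg_nonneg)
    have cw: "\<bar>\<phi> u - c\<bar> \<le> w u" for u
    proof -
      have "c \<le> \<phi> u + w u" unfolding c_def by (rule cInf_lower[OF _ bdd]) auto
      moreover have "\<phi> u - w u \<le> c" unfolding c_def
      proof (rule cInf_greatest)
        fix z assume "z \<in> range (\<lambda>v. \<phi> v + w v)"
        then obtain v where "z = \<phi> v + w v" by auto
        then show "\<phi> u - w u \<le> z" using osc[of u v] by (simp add: w_def algebra_simps abs_le_iff)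
      qed simp
      ultimately show ?thesis by (simp add: abs_le_iff)
    qed
    have \<phi>i: "integrable (\<kappa> z) \<phi>" for z by (rule integrable_kernel[OF \<phi>])
    have ki: "integrable (\<kappa> z) (\<lambda>_. a :: real)" for z a
      using prob_space.finite_measure[OF prob_kernel] by (intro finite_measure.integrable_const)
    have wi: "integrable (\<kappa> z) w" for z
      unfolding w_def[abs_def] using V_int ki by (intro integrable_mult_right Bochner_Integration.integrable_add) auto
    have \<phi>ci: "integrable (\<kappa> z) (\<lambda>u. \<phi> u - c)" for z using \<phi>i ki by auto
    have k1: "(\<integral>u. a \<partial>\<kappa> z) = a" for z and a :: real
      using prob_space.prob_space[OF prob_kernel[of z]] by simp
    have Qc: "Q \<phi> z = (\<integral>u. \<phi> u - c \<partial>\<kappa> z) + c" for z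
      unfolding Q_def using \<phi>i ki by (subst Bochner_Integration.integral_diff) (simp_all only: k1 diff_add_cancel)
    have Iw: "(\<integral>u. w u \<partial>\<kappa> z) = D * (1 + \<beta> * (\<integral>u. V u \<partial>\<kappa> z))" for z
      unfolding w_def[abs_def] using V_int ki by (simp add: prob_space.prob_space[OF prob_kernel])
    have Iw_le: "(\<integral>u. w u \<partial>\<kappa> x) + (\<integral>u. w u \<partial>\<kappa> y) \<le> D * (2 + \<beta> * (\<gamma> * (V x + V y) + 2 * L))"
    proof -
      have "\<beta> * ((\<integral>u. V u \<partial>\<kappa> x) + (\<integral>u. V u \<partial>\<kappa> y)) \<le> \<beta> * (\<gamma> * (V x + V y) + 2 * L)"
        using drift[of x] drift[of y] \<beta> by (intro mult_left_mono) (auto simp: algebra_simps)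
      then have "D * (2 + \<beta> * ((\<integral>u. V u \<partial>\<kappa> x) + (\<integral>u. V u \<partial>\<kappa> y))) \<le> D * (2 + \<beta> * (\<gamma> * (V x + V y) + 2 * L))"
        using D by (intro mult_left_mono) auto
      then show ?thesis unfolding Iw by (simp add: algebra_simps)
    qed
    have "\<bar>Q \<phi> x - Q \<phi> y\<bar> \<le> D * (\<alpha> * (2 + \<beta> * (V x + V y)))"
    proof (cases "V x + V y \<ge> R")
      case True
      have ab: "\<bar>\<integral>u. \<phi> u - c \<partial>\<kappa> z\<bar> \<le> (\<integral>u. w u \<partial>\<kappa> z)" for z
        using cw \<phi>ci wi by (intro order_trans[OF integral_abs_bound integral_mono]) auto
      have "\<bar>Q \<phi> x - Q \<phi> y\<bar> \<le> (\<integral>u. w u \<partial>\<kappa> x) + (\<integral>u. w u \<partial>\<kappa> y)"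
        unfolding Qc using ab[of x] ab[of y] by linarith
      also have "\<dots> \<le> D * (2 + \<beta> * (\<gamma> * (V x + V y) + 2 * L))" by (rule Iw_le)
      also have "\<dots> \<le> D * (\<alpha> * (2 + \<beta> * (V x + V y)))"
      proof (rule mult_left_mono[OF _ D])
        have "2 + \<beta> * (\<gamma> * R + 2 * L) = \<alpha>1 * (2 + \<beta> * R)" using bR by (simp add: \<alpha>1_def)
        moreover have "\<beta> * (\<gamma> * (V x + V y - R)) \<le> \<beta> * (\<alpha>1 * (V x + V y - R))"
          using True \<alpha>1 \<beta> by (intro mult_left_mono mult_right_mono) auto
        ultimately have "2 + \<beta> * (\<gamma> * (V x + V y) + 2 * L) \<le> \<alpha>1 * (2 + \<beta> * (V x + V y))"
          by (simp add: algebra_simps)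
        also have "\<dots> \<le> \<alpha> * (2 + \<beta> * (V x + V y))"
          using V(2) \<beta> by (intro mult_right_mono) (auto simp: \<alpha>_def)
        finally show "2 + \<beta> * (\<gamma> * (V x + V y) + 2 * L) \<le> \<alpha> * (2 + \<beta> * (V x + V y))" .
      qed
      finally show ?thesis .
    next
      \<comment> \<open>Both points lie in the sublevel set, so \<open>\<nu>\<close> can be removed
        from both kernels. It cancels in the difference and lowers the bound by
        \<open>2 * (D * \<eta>)\<close>.\<close>
      case False
      then have xy: "V x \<le> R" "V y \<le> R" using V(2)[of x] V(2)[of y] by linarith+
      have dom: "integrable \<nu> f \<and> (\<integral>u. f u \<partial>\<nu>) \<le> (\<integral>u. f u \<partial>\<kappa> z)"
        if z: "V z \<le> R" and f: "integrable (\<kappa> z) f" "\<And>u. 0 \<le> f u" for z and f :: "'s \<Rightarrow> real"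
      proof -
        have [measurable]: "f \<in> borel_measurable borel" using borel_measurable_integrable[OF f(1)] by simp
        have le: "(\<integral>\<^sup>+ u. ennreal (f u) \<partial>\<nu>) \<le> (\<integral>\<^sup>+ u. ennreal (f u) \<partial>\<kappa> z)"
          using \<nu>le[OF z] \<nu>(2) by (intro nn_integral_mono_measure) (auto simp: le_measure)
        have fin: "(\<integral>\<^sup>+ u. ennreal (f u) \<partial>\<kappa> z) = ennreal (\<integral>u. f u \<partial>\<kappa> z)"
          using f by (intro nn_integral_eq_integral) auto
        have int: "integrable \<nu> f"
          using le f \<nu>(2) unfolding fin by (intro integrableI_nonneg) (auto simp: top_unique less_top intro: le_less_trans)
        moreover have "(\<integral>u. f u \<partial>\<nu>) \<le> (\<integral>u. f u \<partial>\<kappa> z)"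
          using le unfolding fin nn_integral_eq_integral[OF int AE_I2[OF f(2)]]
          using f(2) by (subst (asm) ennreal_le_iff) auto
        ultimately show ?thesis ..
      qed
      let ?r = "\<lambda>f z. (\<integral>u. f u \<partial>\<kappa> z) - (\<integral>u. f u \<partial>\<nu>)"
      have ab: "\<bar>?r (\<lambda>u. \<phi> u - c) z\<bar> \<le> ?r w z" if "V z \<le> R" for z
        by (rule abs_integral_diff_dominated[OF dom[OF that] \<phi>ci wi cw])
      have wn: "D * \<eta> \<le> (\<integral>u. w u \<partial>\<nu>)"
      proof -
        have "(\<integral>u. D \<partial>\<nu>) \<le> (\<integral>u. w u \<partial>\<nu>)"
          using dom[OF xy(1) wi w0] D \<beta> V(2) by (intro integral_mono) (auto simp: w_def mult_left_mono algebra_simps)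
        then show ?thesis by (simp add: \<eta>_def sp\<nu> mult.commute)
      qed
      have "\<bar>Q \<phi> x - Q \<phi> y\<bar> = \<bar>?r (\<lambda>u. \<phi> u - c) x - ?r (\<lambda>u. \<phi> u - c) y\<bar>" unfolding Qc by simp
      also have "\<dots> \<le> ?r w x + ?r w y" using ab[OF xy(1)] ab[OF xy(2)] by linarith
      also have "\<dots> \<le> D * (2 + \<beta> * (\<gamma> * (V x + V y) + 2 * L)) - 2 * (D * \<eta>)" using Iw_le wn by linarith
      also have "\<dots> \<le> D * (2 - \<eta>)"
      proof -
        have "\<beta> * (\<gamma> * (V x + V y) + 2 * L) \<le> \<beta> * (\<gamma> * R + 2 * L)"
          using False \<gamma> \<beta> by (intro mult_left_mono add_right_mono) auto
        then have "D * (\<beta> * (\<gamma> * (V x + V y) + 2 * L)) \<le> D * \<eta>" using \<beta>(2) D by (intro mult_left_mono) auto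
        then show ?thesis by (simp add: algebra_simps)
      qed
      also have "\<dots> \<le> D * (\<alpha> * (2 + \<beta> * (V x + V y)))"
      proof (rule mult_left_mono[OF _ D])
        have "1 - \<eta> / 2 \<le> \<alpha>" by (simp add: \<alpha>_def)
        then have "2 - \<eta> \<le> \<alpha> * 2" by linarith
        also have "\<dots> \<le> \<alpha> * (2 + \<beta> * (V x + V y))" using \<alpha> \<beta> V(2) by (intro mult_left_mono) auto
        finally show "2 - \<eta> \<le> \<alpha> * (2 + \<beta> * (V x + V y))" .
      qed
      finally show ?thesis .
    qed
    then show "\<bar>Q \<phi> x - Q \<phi> y\<bar> \<le> \<alpha> * D * (2 + \<beta> * V x + \<beta> * V y)" by (simp add: algebra_simps)
  qed
qed

text \<open>Iterated contraction compares two starting points; averaging the second one over the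
  invariant \<open>\<mu>\<close> compares with stationarity. The oscillation of a function with
  values between 0 and 1 may be truncated at 1, which makes the bound \<open>k\<close> integrable
  without integrability of \<open>V\<close> under \<open>\<mu>\<close>. Convergence then follows by
  dominated convergence, once for each starting point and once more for the average of
  \<open>e\<close>.\<close>

lemma harris_mixing:
  assumes \<mu>: "prob_space \<mu>" "sets \<mu> = sets borel" and inv: "\<And>g. g \<in> unit_funs \<Longrightarrow> (\<integral>y. Q g y \<partial>\<mu>) = (\<integral>y. g y \<partial>\<mu>)"
  obtains e where
    "\<And>m g y. g \<in> unit_funs \<Longrightarrow> \<bar>(Q ^^ m) g y - (\<integral>y. g y \<partial>\<mu>)\<bar> \<le> e m y" "\<And>m. integrable \<mu> (e m)"
    "(\<lambda>m. \<integral>y. e m y \<partial>\<mu>) \<longlonglongrightarrow> 0" "\<And>v. \<exists>\<eta>. \<eta> \<longlonglongrightarrow> 0 \<and> (\<forall>m y. V y \<le> v \<longrightarrow> e m y \<le> (\<eta> m :: real))"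
proof -
  obtain \<alpha> \<beta> where \<alpha>: "0 \<le> \<alpha>" "\<alpha> < 1" and \<beta>: "0 \<le> \<beta>"
    and contr: "\<And>\<phi> D x y. \<phi> \<in> unit_funs \<Longrightarrow> D \<ge> 0 \<Longrightarrow> (\<And>x y. \<bar>\<phi> x - \<phi> y\<bar> \<le> D * (2 + \<beta> * V x + \<beta> * V y)) \<Longrightarrow>
      \<bar>Q \<phi> x - Q \<phi> y\<bar> \<le> \<alpha> * D * (2 + \<beta> * V x + \<beta> * V y)"
    using harris_contraction by metis
  interpret \<mu>: prob_space \<mu> by fact
  note [measurable_cong] = \<mu>(2)
  note V(1) [measurable]
  have osc: "\<bar>(Q ^^ m) g x - (Q ^^ m) g y\<bar> \<le> \<alpha> ^ m * (2 + \<beta> * V x + \<beta> * V y)" if g: "g \<in> unit_funs" for m g x y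
  proof (induction m arbitrary: x y)
    case 0
    have "0 \<le> \<beta> * V x" "0 \<le> \<beta> * V y" using \<beta> V(2) by auto
    then show ?case using unit_funsD(2,3)[OF g, of x] unit_funsD(2,3)[OF g, of y] by simp
  next
    case (Suc m)
    show ?case using contr[OF Q_pow_unit_funs[OF g, of m], of "\<alpha> ^ m" x y] Suc \<alpha> by simp
  qed
  define k where "k m v y = min 1 (\<alpha> ^ m * (2 + \<beta> * v + \<beta> * V y))" for m v y
  have k_nonneg: "0 \<le> k m v y" if "0 \<le> v" for m v y
    using \<alpha> \<beta> V(2) that by (auto simp: k_def)
  have k1: "k m v y \<le> 1" for m v y by (simp add: k_def)
  have k_meas [measurable]: "(\<lambda>y. k m v y) \<in> borel_measurable borel" for m v unfolding k_def by measurable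
  have k_int: "integrable \<mu> (k m v)" if "0 \<le> v" for m v
    using k_nonneg[OF that] k1 by (intro \<mu>.integrable_const_bound[where B=1]) auto
  have k_lim: "(\<lambda>m. k m v y) \<longlonglongrightarrow> 0" for v y
  proof -
    have "(\<lambda>m. min 1 (\<alpha> ^ m * (2 + \<beta> * v + \<beta> * V y))) \<longlonglongrightarrow> min 1 (0 * (2 + \<beta> * v + \<beta> * V y))"
      using \<alpha> by (intro tendsto_intros LIMSEQ_power_zero) auto
    then show ?thesis by (simp add: k_def)
  qed
  define \<eta> where "\<eta> v m = (\<integral>y. k m v y \<partial>\<mu>)" for v m
  have \<eta>_lim: "\<eta> v \<longlonglongrightarrow> 0" if v: "0 \<le> v" for v
  proof -
    have "(\<lambda>m. \<integral>y. k m v y \<partial>\<mu>) \<longlonglongrightarrow> (\<integral>y. 0 \<partial>\<mu>)"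
      using k_nonneg[OF v] k1 by (intro integral_dominated_convergence[where w="\<lambda>_. 1"]) (auto intro!: k_lim)
    then show ?thesis by (simp add: \<eta>_def[abs_def])
  qed
  have \<eta>_bound: "0 \<le> \<eta> v m" "\<eta> v m \<le> 1" if "0 \<le> v" for v m
  proof -
    show "0 \<le> \<eta> v m" unfolding \<eta>_def using k_nonneg[OF that] by (intro integral_nonneg_AE) auto
    have "\<eta> v m \<le> (\<integral>y. 1 \<partial>\<mu>)" unfolding \<eta>_def using k_int[OF that] k1 by (intro integral_mono) auto
    then show "\<eta> v m \<le> 1" by (simp add: \<mu>.prob_space)
  qed
  define e where "e m y = \<eta> (V y) m" for m y
  have [measurable]: "e m \<in> borel_measurable borel" for m
    unfolding e_def[abs_def] \<eta>_def k_def by measurable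
  have e_bound: "0 \<le> e m y" "e m y \<le> 1" "(\<lambda>m. e m y) \<longlonglongrightarrow> 0" for m y
    using \<eta>_bound[OF V(2)] \<eta>_lim[OF V(2)[of y]] by (auto simp: e_def)
  show thesis
  proof (rule that)
    fix m and g :: "'s \<Rightarrow> real" and y assume g: "g \<in> unit_funs"
    have Qg: "(Q ^^ m) g \<in> unit_funs" by (rule Q_pow_unit_funs[OF g])
    have Qi: "integrable \<mu> ((Q ^^ m) g)" using \<mu>.integrable_unit_fun[OF Qg, of "\<lambda>x. x"] \<mu>(2) by simp
    have "(\<integral>y. (Q ^^ m) g y \<partial>\<mu>) = (\<integral>y. g y \<partial>\<mu>)" for m
      by (induction m) (auto simp: inv Q_pow_unit_funs[OF g])
    then have "(Q ^^ m) g y - (\<integral>y. g y \<partial>\<mu>) = (\<integral>z. (Q ^^ m) g y - (Q ^^ m) g z \<partial>\<mu>)"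
      using Qi by (subst Bochner_Integration.integral_diff) (auto simp: \<mu>.prob_space)
    also have "\<bar>\<dots>\<bar> \<le> (\<integral>z. k m (V y) z \<partial>\<mu>)"
    proof (rule order_trans[OF integral_abs_bound integral_mono])
      show "integrable \<mu> (\<lambda>z. \<bar>(Q ^^ m) g y - (Q ^^ m) g z\<bar>)" using Qi by auto
      show "integrable \<mu> (k m (V y))" by (rule k_int[OF V(2)])
      show "\<bar>(Q ^^ m) g y - (Q ^^ m) g z\<bar> \<le> k m (V y) z" for z
        using osc[OF g, of m y z] unit_funsD(2,3)[OF Qg, of y] unit_funsD(2,3)[OF Qg, of z] by (auto simp: k_def)
    qed
    finally show "\<bar>(Q ^^ m) g y - (\<integral>y. g y \<partial>\<mu>)\<bar> \<le> e m y" by (simp add: e_def \<eta>_def)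
  next
    show "integrable \<mu> (e m)" for m
      using e_bound by (intro \<mu>.integrable_const_bound[where B=1]) auto
    have "(\<lambda>m. \<integral>y. e m y \<partial>\<mu>) \<longlonglongrightarrow> (\<integral>y. 0 \<partial>\<mu>)"
      using e_bound by (intro integral_dominated_convergence[where w="\<lambda>_. 1"]) auto
    then show "(\<lambda>m. \<integral>y. e m y \<partial>\<mu>) \<longlonglongrightarrow> 0" by simp
    fix v :: real
    \<comment> \<open>\<open>k\<close> is known to be nonnegative only for nonnegative levels. For
      negative \<open>v\<close> the sublevel set is empty, so enlarging \<open>v\<close> to 0 loses
      nothing.\<close>
    have "e m y \<le> \<eta> (max v 0) m" if "V y \<le> v" for m y
      unfolding e_def \<eta>_def
    proof (rule integral_mono[OF k_int k_int])
      show "k m (V y) z \<le> k m (max v 0) z" for z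
        unfolding k_def using \<alpha> \<beta> that by (intro min.mono mult_left_mono add_right_mono add_left_mono) auto
    qed (use V in auto)
    then show "\<exists>\<eta>. \<eta> \<longlonglongrightarrow> 0 \<and> (\<forall>m y. V y \<le> v \<longrightarrow> e m y \<le> \<eta> m)"
      using \<eta>_lim[of "max v 0"] by (intro exI[of _ "\<eta> (max v 0)"]) auto
  qed
qed

end

end

section \<open>Transition density bounds\<close>

context lipschitz_sde
begin

lemma bridge_decomposition:
  assumes h: "h > 0"
  obtains Z where "prob_space Z" "sets Z = sets (\<Pi>\<^sub>M i\<in>{..<2 ^ m :: nat}. (borel :: 'v measure))"
    "\<And>F. F \<in> borel_measurable (\<Pi>\<^sub>M i\<in>{..<2 ^ m :: nat}. (borel :: 'v measure)) \<Longrightarrow>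
      (\<integral>\<^sup>+ \<omega>. F (incrs 0 (h / 2 ^ m) (2 ^ m) \<omega>) \<partial>P) =
      (\<integral>\<^sup>+ \<zeta>. \<integral>\<^sup>+ w. F (\<lambda>i\<in>{..<2 ^ m}. \<zeta> i + (1 / real (2 ^ m)) *\<^sub>R w) \<partial>gauss h \<partial>Z)"
proof -
  let ?S = "\<Pi>\<^sub>M i\<in>{..<2 ^ m :: nat}. (borel :: 'v measure)"
  obtain n where n: "Suc n = 2 ^ m" using not0_implies_Suc[of "2 ^ m"] by auto
  have d: "h / 2 ^ m > 0" using h by simp
  have nd: "real (2 ^ m) * (h / 2 ^ m) = h" by simp
  obtain Z where Z: "prob_space Z" "sets Z = sets ?S"
    and ZF: "\<And>F. F \<in> borel_measurable ?S \<Longrightarrow> (\<integral>\<^sup>+ \<xi>. F \<xi> \<partial>(\<Pi>\<^sub>M i\<in>{..<2 ^ m}. gauss (h / 2 ^ m))) =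
      (\<integral>\<^sup>+ \<zeta>. \<integral>\<^sup>+ w. F (\<lambda>i\<in>{..<2 ^ m}. \<zeta> i + (1 / real (2 ^ m)) *\<^sub>R w) \<partial>gauss h \<partial>Z)"
    using gauss_bridge_decomposition[OF d, of n, where 'v='v] unfolding n nd by blast
  show thesis
  proof (rule that[OF Z])
    fix F :: "(nat \<Rightarrow> 'v) \<Rightarrow> ennreal" assume F: "F \<in> borel_measurable ?S"
    have "(\<integral>\<^sup>+ \<omega>. F (incrs 0 (h / 2 ^ m) (2 ^ m) \<omega>) \<partial>P) = (\<integral>\<^sup>+ \<xi>. F \<xi> \<partial>distr P ?S (incrs 0 (h / 2 ^ m) (2 ^ m)))"
      using d F by (subst nn_integral_distr[OF incrs_measurable]) auto
    also have "\<dots> = (\<integral>\<^sup>+ \<xi>. F \<xi> \<partial>(\<Pi>\<^sub>M i\<in>{..<2 ^ m}. gauss (h / 2 ^ m)))"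
      using d by (subst distr_incrs) auto
    finally show "(\<integral>\<^sup>+ \<omega>. F (incrs 0 (h / 2 ^ m) (2 ^ m) \<omega>) \<partial>P) =
      (\<integral>\<^sup>+ \<zeta>. \<integral>\<^sup>+ w. F (\<lambda>i\<in>{..<2 ^ m}. \<zeta> i + (1 / real (2 ^ m)) *\<^sub>R w) \<partial>gauss h \<partial>Z)"
      using ZF[OF F] by simp
  qed
qed

text \<open>For a fixed bridge, hitting \<open>B\<close> is an event about \<open>w\<close> alone:
  the preimage of \<open>B\<close> under the near-identity map.\<close>

lemma euler_ball_bridge:
  assumes ZF: "\<And>F. F \<in> borel_measurable (\<Pi>\<^sub>M i\<in>{..<2 ^ m :: nat}. (borel :: 'v measure)) \<Longrightarrow>
      (\<integral>\<^sup>+ \<omega>. F (incrs 0 (h / 2 ^ m) (2 ^ m) \<omega>) \<partial>P) =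
      (\<integral>\<^sup>+ \<zeta>. \<integral>\<^sup>+ w. F (\<lambda>i\<in>{..<2 ^ m}. \<zeta> i + (1 / real (2 ^ m)) *\<^sub>R w) \<partial>gauss h \<partial>Z)"
    and B: "B \<in> sets borel"
  shows "(\<integral>\<^sup>+ \<omega>. indicator B (euler b (h / 2 ^ m) (\<lambda>i. incr 0 (h / 2 ^ m) i \<omega>) z (2 ^ m)) \<partial>P)
    = (\<integral>\<^sup>+ \<zeta>. emeasure (gauss h) ((\<lambda>w. euler b (h / 2 ^ m) (\<lambda>i. \<zeta> i + (1 / real (2 ^ m)) *\<^sub>R w) z (2 ^ m)) -` B) \<partial>Z)"
proof -
  let ?F = "\<lambda>\<xi>. indicator B (euler b (h / 2 ^ m) \<xi> z (2 ^ m)) :: ennreal"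
  have m: "(\<lambda>\<xi>. euler b (h / 2 ^ m) \<xi> z (2 ^ m)) \<in> borel_measurable (\<Pi>\<^sub>M i\<in>{..<2 ^ m}. borel)"
    by (rule borel_measurable_euler) auto
  have F: "?F \<in> borel_measurable (\<Pi>\<^sub>M i\<in>{..<2 ^ m}. borel)"
    by (rule measurable_compose[OF m borel_measurable_indicator[OF B]])
  have 1: "euler b d (incrs 0 d (2 ^ m) \<omega>) z (2 ^ m) = euler b d (\<lambda>i. incr 0 d i \<omega>) z (2 ^ m)" for \<omega> d
    by (rule euler_cong) (simp add: incrs_def)
  have 2: "euler b d (\<lambda>i\<in>{..<2 ^ m}. \<zeta> i + (1 / real (2 ^ m)) *\<^sub>R w) z (2 ^ m) = euler b d (\<lambda>i. \<zeta> i + (1 / real (2 ^ m)) *\<^sub>R w) z (2 ^ m)" for \<zeta> w d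
    by (rule euler_cong) simp
  have 3: "(\<integral>\<^sup>+ w. indicator B (euler b d (\<lambda>i. \<zeta> i + (1 / real (2 ^ m)) *\<^sub>R w) z (2 ^ m)) \<partial>gauss h)
    = emeasure (gauss h) ((\<lambda>w. euler b d (\<lambda>i. \<zeta> i + (1 / real (2 ^ m)) *\<^sub>R w) z (2 ^ m)) -` B)" for \<zeta> d
  proof -
    let ?\<Phi> = "\<lambda>w. euler b d (\<lambda>i. \<zeta> i + (1 / real (2 ^ m)) *\<^sub>R w) z (2 ^ m)"
    have "?\<Phi> \<in> borel_measurable borel" by (rule borel_measurable_euler) auto
    then have "?\<Phi> -` B \<in> sets borel" using measurable_sets_borel[OF _ B] by simp
    then have "emeasure (gauss h) (?\<Phi> -` B) = (\<integral>\<^sup>+ w. indicator (?\<Phi> -` B) w \<partial>gauss h)" by simp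
    also have "\<dots> = (\<integral>\<^sup>+ w. indicator B (?\<Phi> w) \<partial>gauss h)" by (intro nn_integral_cong) (auto simp: indicator_def)
    finally show ?thesis by simp
  qed
  show ?thesis using ZF[OF F] unfolding 1 2 3 .
qed

text \<open>The Gaussian estimate holds for each bridge with the same constant, so averaging over
  the bridge changes nothing, and the result is uniform in the start and in the mesh.\<close>

lemma euler_ball_le:
  assumes h: "h > 0" "h * K * exp (h * K) \<le> 1/2" and r: "r > 0"
  shows "(\<integral>\<^sup>+ \<omega>. indicator (ball y r) (euler b (h / 2 ^ m) (\<lambda>i. incr 0 (h / 2 ^ m) i \<omega>) z (2 ^ m)) \<partial>P)
    \<le> ennreal ((2 * pi * h) powr (- real DIM('v) / 2) * 2 ^ DIM('v)) * emeasure lborel (ball y r)"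
    (is "_ \<le> ?c")
proof -
  obtain Z where Z: "prob_space Z" "sets Z = sets (\<Pi>\<^sub>M i\<in>{..<2 ^ m :: nat}. (borel :: 'v measure))"
    and ZF: "\<And>F. F \<in> borel_measurable (\<Pi>\<^sub>M i\<in>{..<2 ^ m :: nat}. (borel :: 'v measure)) \<Longrightarrow>
      (\<integral>\<^sup>+ \<omega>. F (incrs 0 (h / 2 ^ m) (2 ^ m) \<omega>) \<partial>P) =
      (\<integral>\<^sup>+ \<zeta>. \<integral>\<^sup>+ w. F (\<lambda>i\<in>{..<2 ^ m}. \<zeta> i + (1 / real (2 ^ m)) *\<^sub>R w) \<partial>gauss h \<partial>Z)"
    using bridge_decomposition[OF h(1)] by metis
  interpret Z: prob_space Z by fact
  note euler_ball_bridge[OF ZF borel_open[OF open_ball]]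
  also have "(\<integral>\<^sup>+ \<zeta>. emeasure (gauss h) ((\<lambda>w. euler b (h / 2 ^ m) (\<lambda>i. \<zeta> i + (1 / real (2 ^ m)) *\<^sub>R w) z (2 ^ m)) -` ball y r) \<partial>Z)
    \<le> (\<integral>\<^sup>+ \<zeta>. ?c \<partial>Z)"
  proof (intro nn_integral_mono emeasure_gauss_near_identity_le r h(1))
    fix \<zeta> w w'
    let ?\<Phi> = "\<lambda>w. euler b (h / 2 ^ m) (\<lambda>i. \<zeta> i + (1 / real (2 ^ m)) *\<^sub>R w) z (2 ^ m)"
    have "norm (?\<Phi> w - ?\<Phi> w' - (w - w')) \<le> h * K * exp (h * K) * norm (w - w')"
      by (rule euler_shift[OF lip K]) (use h in auto)
    also have "\<dots> \<le> 1/2 * norm (w - w')" using h(2) by (rule mult_right_mono) simp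
    finally show "norm (?\<Phi> w - ?\<Phi> w' - (w - w')) \<le> 1/2 * norm (w - w')" .
  qed
  also have "(\<integral>\<^sup>+ \<zeta>. ?c \<partial>Z) = ?c" by (simp add: Z.emeasure_space_1)
  finally show ?thesis .
qed

text \<open>A single bound for all meshes, from compactness of the time interval. The level 3/4 is
  such that losing another event of probability below 1/4 still leaves 1/2.\<close>

lemma path_bound:
  assumes h: "h > 0"
  obtains c where "c \<ge> 0" "prob {\<omega> \<in> space P. \<forall>m. \<forall>k\<le>2 ^ m. norm (W (real k * (h / 2 ^ m)) \<omega>) \<le> c} > 3/4"
proof -
  define A where "A c = {\<omega> \<in> space P. \<forall>m. \<forall>k\<le>2 ^ m. norm (W (real k * (h / 2 ^ m)) \<omega>) \<le> real c}" for c :: nat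
  have [measurable]: "W (real k * (h / 2 ^ m)) \<in> borel_measurable P" for k m using h by (intro W_measurable) simp
  have [measurable]: "A c \<in> events" for c unfolding A_def by measurable
  have inc: "incseq A"
  proof (rule incseq_SucI)
    fix n
    have "real n \<le> real (Suc n)" by simp
    then show "A n \<subseteq> A (Suc n)" unfolding A_def by (blast intro: order_trans)
  qed
  have U: "(\<Union>c. A c) = space P"
  proof (intro equalityI subsetI)
    fix \<omega> assume \<omega>: "\<omega> \<in> space P"
    have "compact ((\<lambda>t. W t \<omega>) ` {0..h})"
      by (intro compact_continuous_image continuous_on_subset[OF W_continuous[OF \<omega>]]) auto
    then obtain a where a: "\<And>t. t \<in> {0..h} \<Longrightarrow> norm (W t \<omega>) \<le> a"
      by (meson bounded_iff compact_imp_bounded imageI)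
    obtain c where c: "a \<le> real c" using real_arch_simple by blast
    have "norm (W (real k * (h / 2 ^ m)) \<omega>) \<le> real c" if "k \<le> 2 ^ m" for k m
    proof -
      have "real k * (h / 2 ^ m) \<le> 2 ^ m * (h / 2 ^ m)" using that h by (intro mult_right_mono) (auto simp: of_nat_le_numeral_power_cancel_iff)
      then show ?thesis using a[of "real k * (h / 2 ^ m)"] c h by auto
    qed
    then show "\<omega> \<in> (\<Union>c. A c)" using \<omega> by (auto simp: A_def)
  qed (auto simp: A_def)
  have "(\<lambda>c. prob (A c)) \<longlonglongrightarrow> prob (\<Union>c. A c)" by (rule finite_Lim_measure_incseq) (auto simp: inc)
  then have "(\<lambda>c. prob (A c)) \<longlonglongrightarrow> 1" by (simp add: U prob_space)
  then have "\<forall>\<^sub>F c in sequentially. prob (A c) > 3/4" by (rule order_tendstoD) simp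
  then obtain c where "prob (A c) > 3/4" by (auto simp: eventually_sequentially)
  then show thesis by (intro that[of "real c"]) (auto simp: A_def)
qed

lemma sum_incr: "\<omega> \<in> space P \<Longrightarrow> (\<Sum>i<k. incr 0 d i \<omega>) = W (real k * d) \<omega>"
  by (induction k) (auto simp: incr_def W_0)

text \<open>Unlike the upper bound, this one needs control of the bridge, since the Gaussian density
  is small far out. With probability at least 1/2 the partial sums of the bridge are bounded by
  \<open>2 * a\<close>, uniformly in the mesh, and only these bridges are kept.\<close>

lemma euler_ball_ge:
  assumes h: "h > 0" "h * K * exp (h * K) \<le> 1/2" and R: "R > 0"
  obtains c where "c > 0"
    "\<And>z y r m. norm z \<le> R \<Longrightarrow> norm y \<le> R \<Longrightarrow> 0 < r \<Longrightarrow> r \<le> R \<Longrightarrow> ennreal c * emeasure lborel (ball y r) \<le>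
      (\<integral>\<^sup>+ \<omega>. indicator (ball y r) (euler b (h / 2 ^ m) (\<lambda>i. incr 0 (h / 2 ^ m) i \<omega>) z (2 ^ m)) \<partial>P)"
proof -
  obtain a where a: "a \<ge> 0" "prob {\<omega> \<in> space P. \<forall>m. \<forall>k\<le>2 ^ m. norm (W (real k * (h / 2 ^ m)) \<omega>) \<le> a} > 3/4"
    using path_bound[OF h(1)] .
  define A where "A = {\<omega> \<in> space P. \<forall>m. \<forall>k\<le>2 ^ m. norm (W (real k * (h / 2 ^ m)) \<omega>) \<le> a}"
  have PA: "prob A > 3/4" using a(2) by (simp only: A_def)
  have AW: "norm (W (real k * (h / 2 ^ m)) \<omega>) \<le> a" if "\<omega> \<in> A" "k \<le> 2 ^ m" for \<omega> k m
    using that unfolding A_def by blast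
  have A_space: "\<omega> \<in> space P" if "\<omega> \<in> A" for \<omega> using that unfolding A_def by blast
  have [measurable]: "W (real k * (h / 2 ^ m)) \<in> borel_measurable P" for k m using h by (intro W_measurable) simp
  have [measurable]: "A \<in> events" unfolding A_def by measurable
  interpret g: prob_space "gauss h :: 'v measure" by (rule prob_space_gauss[OF h(1)])
  \<comment> \<open>On \<open>A\<close> the instance \<open>m = 0\<close>, \<open>k = 1\<close>
    bounds \<open>W h\<close>, whose law is \<open>gauss h\<close>.\<close>
  have ga: "g.prob (cball 0 a) > 3/4"
  proof -
    have W: "incr 0 h 0 \<in> borel_measurable P" using h by simp
    have "g.prob (cball 0 a) = prob (incr 0 h 0 -` cball 0 a \<inter> space P)"
      using h by (subst distr_incr[of 0 h 0, symmetric]) (auto simp: measure_distr[OF W])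
    also have "\<dots> \<ge> prob A"
    proof (rule finite_measure_mono)
      show "A \<subseteq> incr 0 h 0 -` cball 0 a \<inter> space P"
      proof
        fix \<omega> assume \<omega>: "\<omega> \<in> A"
        then have "norm (W h \<omega>) \<le> a" using AW[of \<omega> 1 0] by simp
        then show "\<omega> \<in> incr 0 h 0 -` cball 0 a \<inter> space P" using A_space[OF \<omega>] by (simp add: incr_def W_0)
      qed
    qed (use measurable_sets[OF W] in auto)
    finally show ?thesis using PA by linarith
  qed
  \<comment> \<open>\<open>M0\<close> bounds the endpoint for \<open>w = 0\<close> on the bridges
    that are kept, by \<open>euler_bound\<close>; \<open>M\<close> is the radius demanded by
    \<open>emeasure_gauss_near_identity_ge\<close>.\<close>
  define M0 where "M0 = (R + h * (norm (b 0) + K * (2 * a))) * exp (h * K) + 2 * a"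
  define M where "M = 2 * (R + M0) + R"
  define c where "c = (2 * pi * h) powr (- real DIM('v) / 2) * exp (- M\<^sup>2 / (2 * h)) / 2 ^ DIM('v)"
  have c: "c > 0" using h by (simp add: c_def)
  show thesis
  proof (rule that[of "c / 2"])
    fix z y :: 'v and r m
    assume z: "norm z \<le> R" and y: "norm y \<le> R" and r: "0 < r" "r \<le> R"
    let ?d = "h / 2 ^ m" and ?N = "2 ^ m :: nat"
    let ?S = "\<Pi>\<^sub>M i\<in>{..<?N}. (borel :: 'v measure)"
    obtain Z where Z: "prob_space Z" "sets Z = sets ?S"
      and ZF: "\<And>F. F \<in> borel_measurable ?S \<Longrightarrow>
        (\<integral>\<^sup>+ \<omega>. F (incrs 0 ?d ?N \<omega>) \<partial>P) =
        (\<integral>\<^sup>+ \<zeta>. \<integral>\<^sup>+ w. F (\<lambda>i\<in>{..<?N}. \<zeta> i + (1 / real ?N) *\<^sub>R w) \<partial>gauss h \<partial>Z)"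
      using bridge_decomposition[OF h(1)] by metis
    interpret Z: prob_space Z by fact
    note [measurable_cong] = Z(2)
    define G where "G s = {\<zeta> \<in> space ?S. \<forall>k\<le>?N. norm (\<Sum>i<k. \<zeta> i) \<le> s}" for s
    have [measurable]: "(\<lambda>\<zeta>. \<Sum>i<k. \<zeta> i) \<in> borel_measurable ?S" if "k \<le> ?N" for k
      using that by (intro borel_measurable_sum measurable_component_singleton) auto
    have G [measurable]: "G s \<in> sets ?S" for s
    proof -
      have "G s = (\<Inter>k\<in>{..?N}. {\<zeta> \<in> space ?S. norm (\<Sum>i<k. \<zeta> i) \<le> s})" by (auto simp: G_def)
      also have "\<dots> \<in> sets ?S" by (intro sets.finite_INT) (auto simp: space_PiM intro!: borel_measurable_le)
      finally show ?thesis .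
    qed
    have ZG: "Z.prob (G (2 * a)) \<ge> 1/2"
    proof -
      have "ennreal (3/4) \<le> ennreal (prob A)" using PA by (intro ennreal_leI) simp
      also have "\<dots> = emeasure P A" by (simp add: emeasure_eq_measure)
      also have "\<dots> = (\<integral>\<^sup>+ \<omega>. indicator A \<omega> \<partial>P)" by simp
      also have "\<dots> \<le> (\<integral>\<^sup>+ \<omega>. indicator (G a) (incrs 0 ?d ?N \<omega>) \<partial>P)"
      proof (rule nn_integral_mono)
        fix \<omega> assume "\<omega> \<in> space P"
        have "incrs 0 ?d ?N \<omega> \<in> G a" if "\<omega> \<in> A"
        proof -
          have "(\<Sum>i<k. incrs 0 ?d ?N \<omega> i) = W (real k * ?d) \<omega>" if "k \<le> ?N" for k
            using sum_incr[OF \<open>\<omega> \<in> space P\<close>, of ?d k] that by (simp add: incrs_def)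
          then have "norm (\<Sum>i<k. incrs 0 ?d ?N \<omega> i) \<le> a" if "k \<le> ?N" for k using AW[OF \<open>\<omega> \<in> A\<close> that] that by simp
          moreover have "incrs 0 ?d ?N \<omega> \<in> space ?S" by (simp add: incrs_def space_PiM)
          ultimately show ?thesis unfolding G_def by blast
        qed
        then show "indicator A \<omega> \<le> (indicator (G a) (incrs 0 ?d ?N \<omega>) :: ennreal)" by (auto simp: indicator_def)
      qed
      also have "\<dots> = (\<integral>\<^sup>+ \<zeta>. \<integral>\<^sup>+ w. indicator (G a) (\<lambda>i\<in>{..<?N}. \<zeta> i + (1 / real ?N) *\<^sub>R w) \<partial>gauss h \<partial>Z)"
        by (rule ZF) measurable
      \<comment> \<open>Removing the linear part \<open>(k / 2 ^ m) *\<^sub>R w\<close> from partial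
        sums bounded by \<open>a\<close> leaves partial sums of the bridge bounded by
        \<open>2 * a\<close>, unless \<open>norm w\<close> exceeds \<open>a\<close>.\<close>
      also have "\<dots> \<le> (\<integral>\<^sup>+ \<zeta>. \<integral>\<^sup>+ w. indicator (G (2 * a)) \<zeta> + indicator (- cball (0 :: 'v) a) w \<partial>gauss h \<partial>Z)"
      proof (intro nn_integral_mono)
        fix \<zeta> :: "nat \<Rightarrow> 'v" and w :: 'v assume "\<zeta> \<in> space Z"
        then have \<zeta>: "\<zeta> \<in> space ?S" using sets_eq_imp_space_eq[OF Z(2)] by simp
        have "\<zeta> \<in> G (2 * a)" if w: "norm w \<le> a" and g: "(\<lambda>i\<in>{..<?N}. \<zeta> i + (1 / real ?N) *\<^sub>R w) \<in> G a"
        proof -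
          have "norm (\<Sum>i<k. \<zeta> i) \<le> 2 * a" if k: "k \<le> ?N" for k
          proof -
            have "(\<Sum>i<k. (\<lambda>i\<in>{..<?N}. \<zeta> i + (1 / real ?N) *\<^sub>R w) i) = (\<Sum>i<k. \<zeta> i) + (real k / real ?N) *\<^sub>R w"
              using k by (simp add: sum.distrib scaleR_left.sum[symmetric] sum_constant_scaleR)
            then have 1: "norm ((\<Sum>i<k. \<zeta> i) + (real k / real ?N) *\<^sub>R w) \<le> a" using g k by (auto simp: G_def)
            have "real k / real ?N \<le> 1" using k by (simp del: of_nat_power)
            then have "norm ((real k / real ?N) *\<^sub>R w) \<le> 1 * norm w"
              unfolding norm_scaleR by (intro mult_right_mono) auto
            then show ?thesis
              using 1 w norm_triangle_ineq4[of "(\<Sum>i<k. \<zeta> i) + (real k / real ?N) *\<^sub>R w" "(real k / real ?N) *\<^sub>R w"] by simp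
          qed
          then show ?thesis using \<zeta> by (simp add: G_def)
        qed
        then show "indicator (G a) (\<lambda>i\<in>{..<?N}. \<zeta> i + (1 / real ?N) *\<^sub>R w) \<le> indicator (G (2 * a)) \<zeta> + (indicator (- cball 0 a) w :: ennreal)"
          by (auto simp: indicator_def)
      qed
      also have "\<dots> = emeasure Z (G (2 * a)) + emeasure (gauss h) (- cball (0 :: 'v) a)"
        by (simp add: nn_integral_add g.emeasure_space_1[simplified] Z.emeasure_space_1)
      also have "\<dots> = ennreal (Z.prob (G (2 * a)) + g.prob (- cball 0 a))"
        by (simp add: Z.emeasure_eq_measure g.emeasure_eq_measure)
      finally have "3/4 \<le> Z.prob (G (2 * a)) + g.prob (- cball 0 a)" by (subst (asm) ennreal_le_iff) auto
      moreover have "g.prob (- cball 0 a) = 1 - g.prob (cball 0 a)"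
        using g.prob_compl[of "cball 0 a"] by (simp add: Compl_eq_Diff_UNIV)
      ultimately show ?thesis using ga by linarith
    qed
    have "ennreal (c / 2) * emeasure lborel (ball y r) = ennreal (c * (1 / 2)) * emeasure lborel (ball y r)" by simp
    also have "\<dots> \<le> ennreal (c * Z.prob (G (2 * a))) * emeasure lborel (ball y r)"
      using ZG c by (intro mult_right_mono ennreal_leI mult_left_mono) auto
    also have "\<dots> = (\<integral>\<^sup>+ \<zeta>. (ennreal c * emeasure lborel (ball y r)) * indicator (G (2 * a)) \<zeta> \<partial>Z)"
      using c by (subst nn_integral_cmult_indicator) (auto simp: Z.emeasure_eq_measure ennreal_mult mult_ac)
    also have "\<dots> \<le> (\<integral>\<^sup>+ \<zeta>. emeasure (gauss h) ((\<lambda>w. euler b ?d (\<lambda>i. \<zeta> i + (1 / real ?N) *\<^sub>R w) z ?N) -` ball y r) \<partial>Z)"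
    proof (rule nn_integral_mono)
      fix \<zeta> assume "\<zeta> \<in> space Z"
      let ?\<Phi> = "\<lambda>w. euler b ?d (\<lambda>i. \<zeta> i + (1 / real ?N) *\<^sub>R w) z ?N"
      have "ennreal c * emeasure lborel (ball y r) \<le> emeasure (gauss h) (?\<Phi> -` ball y r)" if \<zeta>: "\<zeta> \<in> G (2 * a)"
        unfolding c_def
      proof (rule emeasure_gauss_near_identity_ge[OF _ r(1) h(1)])
        fix w w'
        have "norm (?\<Phi> w - ?\<Phi> w' - (w - w')) \<le> h * K * exp (h * K) * norm (w - w')"
          by (rule euler_shift[OF lip K]) (use h in auto)
        also have "\<dots> \<le> 1/2 * norm (w - w')" using h(2) by (rule mult_right_mono) simp
        finally show "norm (?\<Phi> w - ?\<Phi> w' - (w - w')) \<le> 1/2 * norm (w - w')" .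
      next
        show "?\<Phi> \<in> borel_measurable borel" by (rule borel_measurable_euler) auto
        have "norm (euler b ?d \<zeta> z ?N) \<le> (norm z + h * (norm (b 0) + K * (2 * a))) * exp (h * K) + 2 * a"
          by (rule euler_bound[OF lip K]) (use h \<zeta> in \<open>auto simp: G_def\<close>)
        also have "\<dots> \<le> M0" unfolding M0_def using z by (intro add_right_mono mult_right_mono) auto
        finally show "2 * (norm y + norm (?\<Phi> 0)) + r \<le> M" using y r by (simp add: M_def)
      qed
      then show "(ennreal c * emeasure lborel (ball y r)) * indicator (G (2 * a)) \<zeta> \<le> emeasure (gauss h) (?\<Phi> -` ball y r)"
        by (auto simp: indicator_def)
    qed
    also have "\<dots> = (\<integral>\<^sup>+ \<omega>. indicator (ball y r) (euler b ?d (\<lambda>i. incr 0 ?d i \<omega>) z ?N) \<partial>P)"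
      by (rule euler_ball_bridge[OF ZF borel_open[OF open_ball], symmetric])
    finally show "ennreal (c / 2) * emeasure lborel (ball y r) \<le> \<dots>" .
  qed (use c in simp)
qed

end

text \<open>Vitali's theorem fills an open set, up to a null set, with countably many disjoint
  balls, over which the hypothesis can be summed. Outer regularity of \<open>M\<close> passes from
  open sets to Borel sets.\<close>

lemma measure_ge_lborel_of_balls:
  fixes M :: "'v::euclidean_space measure"
  assumes M: "finite_measure M" "sets M = sets borel" and U: "open U"
    and balls: "\<And>y r. r > 0 \<Longrightarrow> ball y r \<subseteq> U \<Longrightarrow> ennreal c * emeasure lborel (ball y r) \<le> emeasure M (ball y r)"
    and A: "A \<in> sets borel"
  shows "ennreal c * emeasure lborel (A \<inter> U) \<le> emeasure M A"
proof -
  interpret M: finite_measure M by fact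
  have opn: "ennreal c * emeasure lborel V \<le> emeasure M V" if V: "open V" "V \<subseteq> U" for V
  proof -
    define I where "I = {i :: 'v \<times> real. snd i > 0 \<and> ball (fst i) (snd i) \<subseteq> V}"
    define B where "B i = ball (fst i) (snd i)" for i :: "'v \<times> real"
    have "\<exists>i. i \<in> I \<and> x \<in> ball (fst i) (snd i) \<and> snd i < d" if "x \<in> V" "0 < d" for x d
    proof -
      obtain e where e: "e > 0" "ball x e \<subseteq> V" using V(1) \<open>x \<in> V\<close> openE by blast
      have "(x, min e (d / 2)) \<in> I" using e that by (auto simp: I_def)
      then show ?thesis using e that by (intro exI[of _ "(x, min e (d / 2))"]) auto
    qed
    then obtain J where J: "countable J" "J \<subseteq> I" "pairwise (\<lambda>i j. disjnt (ball (fst i) (snd i)) (ball (fst j) (snd j))) J"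
      "negligible (V - (\<Union>i\<in>J. ball (fst i) (snd i)))"
      by (rule Vitali_covering_theorem_balls[where S=V and K=I and a=fst and r=snd]) auto
    have disj: "disjoint_family_on B J"
      using J(3) by (auto simp: disjoint_family_on_def pairwise_def disjnt_def B_def)
    have Bs [measurable]: "B i \<in> sets borel" for i by (simp add: B_def)
    have UB [measurable]: "(\<Union>i\<in>J. B i) \<in> sets borel" using J(1) by (intro sets.countable_UN'') auto
    have "V - (\<Union>i\<in>J. B i) \<in> null_sets lebesgue" using J(4) by (simp add: negligible_iff_null_sets B_def)
    then have null: "emeasure lborel (V - (\<Union>i\<in>J. B i)) = 0"
      using V(1) by (simp add: null_sets_def borel_open emeasure_completion sets.Diff)
    have "emeasure lborel V \<le> emeasure lborel ((\<Union>i\<in>J. B i) \<union> (V - (\<Union>i\<in>J. B i)))"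
      using V(1) by (intro emeasure_mono) auto
    also have "\<dots> \<le> emeasure lborel (\<Union>i\<in>J. B i) + emeasure lborel (V - (\<Union>i\<in>J. B i))"
      using V(1) by (intro emeasure_subadditive) auto
    also have "\<dots> = (\<integral>\<^sup>+ i. emeasure lborel (B i) \<partial>count_space J)"
      using null emeasure_UN_countable[OF _ J(1) disj, of lborel] by simp
    finally have "ennreal c * emeasure lborel V \<le> ennreal c * (\<integral>\<^sup>+ i. emeasure lborel (B i) \<partial>count_space J)"
      by (rule mult_left_mono) simp
    also have "\<dots> = (\<integral>\<^sup>+ i. ennreal c * emeasure lborel (B i) \<partial>count_space J)"
      by (simp add: nn_integral_cmult)
    also have "\<dots> \<le> (\<integral>\<^sup>+ i. emeasure M (B i) \<partial>count_space J)"
      using J(2) V(2) by (intro nn_integral_mono) (auto simp: B_def I_def intro!: balls)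
    also have "\<dots> = emeasure M (\<Union>i\<in>J. B i)"
      by (rule emeasure_UN_countable[OF _ J(1) disj, symmetric]) (simp add: M)
    also have "\<dots> \<le> emeasure M V"
      using J(2) V(1) M(2) by (intro emeasure_mono) (auto simp: B_def I_def)
    finally show ?thesis .
  qed
  have "emeasure M A = (INF V \<in> {V. A \<subseteq> V \<and> open V}. emeasure M V)"
    by (rule outer_regular[OF M(2) _ A]) simp
  also have "ennreal c * emeasure lborel (A \<inter> U) \<le> \<dots>"
  proof (rule INF_greatest)
    fix V assume "V \<in> {V. A \<subseteq> V \<and> open V}"
    then have V: "A \<subseteq> V" "open V" by auto
    have "ennreal c * emeasure lborel (A \<inter> U) \<le> ennreal c * emeasure lborel (V \<inter> U)"
      using V U by (intro mult_left_mono emeasure_mono) auto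
    also have "\<dots> \<le> emeasure M (V \<inter> U)" using V U by (intro opn) auto
    also have "\<dots> \<le> emeasure M V" using V U M(2) by (intro emeasure_mono) auto
    finally show "ennreal c * emeasure lborel (A \<inter> U) \<le> emeasure M V" .
  qed
  finally show ?thesis .
qed

section \<open>From Euler schemes to the transition kernel\<close>

context lipschitz_sde
begin

definition kern :: "real \<Rightarrow> 'v \<Rightarrow> 'v measure" where
  "kern h z = distr P borel (X z h)"

lemma sets_kern [simp, measurable_cong]: "sets (kern h z) = sets borel"
  by (simp add: kern_def)

lemma space_kern [simp]: "space (kern h z) = UNIV"
  by (simp add: kern_def)

lemma prob_space_kern: "h \<ge> 0 \<Longrightarrow> prob_space (kern h z)"
  unfolding kern_def by (rule prob_space_distr) simp

lemma nn_integral_kern: "h \<ge> 0 \<Longrightarrow> g \<in> borel_measurable borel \<Longrightarrow> (\<integral>\<^sup>+ y. g y \<partial>kern h z) = (\<integral>\<^sup>+ \<omega>. g (X z h \<omega>) \<partial>P)"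
  unfolding kern_def by (subst nn_integral_distr) auto

lemma integral_kern: "h \<ge> 0 \<Longrightarrow> g \<in> borel_measurable borel \<Longrightarrow> (\<integral>y. (g y :: real) \<partial>kern h z) = (\<integral>\<omega>. g (X z h \<omega>) \<partial>P)"
  unfolding kern_def by (subst integral_distr) auto

lemma emeasure_kern: "h \<ge> 0 \<Longrightarrow> A \<in> sets borel \<Longrightarrow> emeasure (kern h z) A = (\<integral>\<^sup>+ \<omega>. indicator A (X z h \<omega>) \<partial>P)"
  using nn_integral_kern[of h "indicator A" z] by simp

lemma markov_kernel_kern:
  assumes h: "h \<ge> 0" shows "markov_kernel (kern h)"
proof (rule markov_kernel.intro)
  show "prob_space (kern h y)" for y by (rule prob_space_kern[OF h])
  show "sets (kern h y) = sets borel" for y by (rule sets_kern)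
  fix g :: "'v \<Rightarrow> real" assume "g \<in> unit_funs"
  note g [measurable] = unit_funsD(1)[OF this]
  have "(\<lambda>(y, \<omega>). g (X y h \<omega>)) \<in> borel_measurable (borel \<Otimes>\<^sub>M P)"
    using h by (simp add: split_beta')
  then have "(\<lambda>y. \<integral>\<omega>. g (X y h \<omega>) \<partial>P) \<in> borel_measurable borel"
    by (rule borel_measurable_lebesgue_integral)
  then show "(\<lambda>y. \<integral>z. g z \<partial>kern h y) \<in> borel_measurable borel"
    unfolding integral_kern[OF h g] .
qed

text \<open>Chapman-Kolmogorov with the last step split off: the Markov step with the whole space as
  event of the past.\<close>

lemma emeasure_kern_Suc:
  assumes h: "h > 0" and A [measurable]: "A \<in> sets borel"
  shows "emeasure (kern (real (Suc j) * h) z) A = (\<integral>\<^sup>+ y. emeasure (kern h y) A \<partial>kern (real j * h) z)"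
proof -
  have m: "(\<lambda>y. emeasure (kern h y) A) \<in> borel_measurable borel"
  proof -
    have "(\<lambda>y. \<integral>\<^sup>+ \<omega>. indicator A (X y h \<omega>) \<partial>P) \<in> borel_measurable borel"
      using h by (intro borel_measurable_nn_integral) (simp add: split_beta')
    then show ?thesis using h by (simp add: emeasure_kern)
  qed
  have s: "space P \<in> sets (filt h j)" using sets.top[of "filt h j"] by simp
  have "emeasure (kern (real (Suc j) * h) z) A = (\<integral>\<^sup>+ \<omega>. indicator (space P) \<omega> * indicator A (X z (real (Suc j) * h) \<omega>) \<partial>P)"
    unfolding emeasure_kern[OF mult_nonneg_nonneg[OF of_nat_0_le_iff less_imp_le[OF h]] A]
    by (rule nn_integral_cong) simp
  also have "\<dots> = (\<integral>\<^sup>+ \<omega>. indicator (space P) \<omega> * (\<integral>\<^sup>+ \<omega>'. indicator A (X (X z (real j * h) \<omega>) h \<omega>') \<partial>P) \<partial>P)"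
    by (rule markov_step[OF h s]) simp
  also have "\<dots> = (\<integral>\<^sup>+ \<omega>. emeasure (kern h (X z (real j * h) \<omega>)) A \<partial>P)"
    unfolding emeasure_kern[OF less_imp_le[OF h] A] by (rule nn_integral_cong) simp
  also have "\<dots> = (\<integral>\<^sup>+ y. emeasure (kern h y) A \<partial>kern (real j * h) z)"
    using h by (intro nn_integral_kern[symmetric] m) simp
  finally show ?thesis .
qed

text \<open>A cutoff equal to 1 on \<open>ball y r\<close> and to 0 off
  \<open>ball y (2 * r)\<close>. Its continuity carries ball estimates from the Euler schemes to
  \<open>X\<close>, at the price of a factor 2 in the radius.\<close>

definition bump :: "'v \<Rightarrow> real \<Rightarrow> 'v \<Rightarrow> real" where
  "bump y r u = max 0 (min 1 (2 - dist u y / r))"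

lemma bump:
  "r > 0 \<Longrightarrow> continuous_on UNIV (bump y r)" "0 \<le> bump y r u" "bump y r u \<le> 1"
  "r > 0 \<Longrightarrow> indicator (ball y r) u \<le> ennreal (bump y r u)"
  "r > 0 \<Longrightarrow> ennreal (bump y r u) \<le> indicator (ball y (2 * r)) u"
  unfolding bump_def
  by (auto intro!: continuous_intros simp: indicator_def dist_commute field_simps intro!: ennreal_neg divide_nonpos_pos)

lemma kern_ball_le_small:
  assumes h: "h > 0" "h * K * exp (h * K) \<le> 1/2"
  obtains C where "C > 0" "\<And>z y r. r > 0 \<Longrightarrow> emeasure (kern h z) (ball y r) \<le> ennreal C * emeasure lborel (ball y r)"
proof -
  define c where "c = (2 * pi * h) powr (- real DIM('v) / 2) * 2 ^ DIM('v)"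
  have c: "c > 0" using h by (simp add: c_def)
  show thesis
  proof (rule that[of "c * 2 ^ DIM('v)"])
    fix z y :: 'v and r :: real assume r: "r > 0"
    have "emeasure (kern h z) (ball y r) \<le> (\<integral>\<^sup>+ \<omega>. ennreal (bump y r (X z h \<omega>)) \<partial>P)"
      using h r by (subst emeasure_kern) (auto intro!: nn_integral_mono bump(4))
    also have "\<dots> \<le> ennreal c * emeasure lborel (ball y (2 * r))"
    proof (rule LIMSEQ_le_const2[OF euler_integral_tendsto[OF h(1) bump(1)[OF r, of y] bump(2,3), of z]], intro exI allI impI)
      fix m
      have "(\<integral>\<^sup>+ \<omega>. ennreal (bump y r (euler b (h / 2 ^ m) (\<lambda>i. incr 0 (h / 2 ^ m) i \<omega>) z (2 ^ m))) \<partial>P)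
        \<le> (\<integral>\<^sup>+ \<omega>. indicator (ball y (2 * r)) (euler b (h / 2 ^ m) (\<lambda>i. incr 0 (h / 2 ^ m) i \<omega>) z (2 ^ m)) \<partial>P)"
        by (intro nn_integral_mono bump(5) r)
      also have "\<dots> \<le> ennreal c * emeasure lborel (ball y (2 * r))"
        unfolding c_def using r by (intro euler_ball_le h) simp
      finally show "(\<integral>\<^sup>+ \<omega>. ennreal (bump y r (euler b (h / 2 ^ m) (\<lambda>i. incr 0 (h / 2 ^ m) i \<omega>) z (2 ^ m))) \<partial>P)
        \<le> ennreal c * emeasure lborel (ball y (2 * r))" .
    qed
    also have "\<dots> = ennreal (c * 2 ^ DIM('v)) * emeasure lborel (ball y r)"
      using r c by (simp add: emeasure_lborel_ball_double[of r y y] ennreal_mult mult.assoc)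
    finally show "emeasure (kern h z) (ball y r) \<le> ennreal (c * 2 ^ DIM('v)) * emeasure lborel (ball y r)" .
  qed (use c in simp)
qed

text \<open>The Euler bound on the half-radius ball passes to the limit through the cutoff and
  yields the bound on balls; the Vitali argument extends it to all Borel sets, as a minorising
  measure requires.\<close>

lemma kern_minorization_small:
  assumes h: "h > 0" "h * K * exp (h * K) \<le> 1/2" and R: "R > 0"
  obtains c where "c > 0" "\<And>z A. norm z \<le> R \<Longrightarrow> A \<in> sets borel \<Longrightarrow>
    ennreal c * emeasure lborel (A \<inter> ball 0 R) \<le> emeasure (kern h z) A"
proof -
  obtain c where c: "c > 0" "\<And>z y r m. norm z \<le> R \<Longrightarrow> norm y \<le> R \<Longrightarrow> 0 < r \<Longrightarrow> r \<le> R \<Longrightarrow> ennreal c * emeasure lborel (ball y r) \<le>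
      (\<integral>\<^sup>+ \<omega>. indicator (ball y r) (euler b (h / 2 ^ m) (\<lambda>i. incr 0 (h / 2 ^ m) i \<omega>) z (2 ^ m)) \<partial>P)"
    using euler_ball_ge[OF h R] by blast
  show thesis
  proof (rule that[of "c / 2 ^ DIM('v)"])
    fix z :: 'v and A :: "'v set" assume z: "norm z \<le> R" and A: "A \<in> sets borel"
    show "ennreal (c / 2 ^ DIM('v)) * emeasure lborel (A \<inter> ball 0 R) \<le> emeasure (kern h z) A"
    proof (rule measure_ge_lborel_of_balls[OF _ sets_kern open_ball _ A])
      show "finite_measure (kern h z)" using prob_space_kern[of h z] h by (simp add: prob_space.finite_measure)
      fix y :: 'v and r assume r: "r > 0" and sub: "ball y r \<subseteq> ball 0 R"
      have yR: "norm y \<le> R" "r \<le> R"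
      proof -
        have "norm y + r \<le> R" using sub r by (simp add: ball_subset_ball_iff)
        then show "norm y \<le> R" "r \<le> R" using r norm_ge_zero[of y] by linarith+
      qed
      have r2: "r / 2 > 0" using r by simp
      have "ennreal (c / 2 ^ DIM('v)) * emeasure lborel (ball y r) = ennreal c * emeasure lborel (ball y (r / 2))"
      proof -
        have "emeasure lborel (ball y r) = ennreal (2 ^ DIM('v)) * emeasure lborel (ball y (r / 2))"
          using emeasure_lborel_ball_double[of "r / 2" y y] r by simp
        then show ?thesis using c by (simp add: mult.assoc[symmetric] ennreal_mult[symmetric])
      qed
      also have "\<dots> \<le> (\<integral>\<^sup>+ \<omega>. ennreal (bump y (r / 2) (X z h \<omega>)) \<partial>P)"
      proof (rule LIMSEQ_le_const[OF euler_integral_tendsto[OF h(1) bump(1)[OF r2, of y] bump(2,3), of z]], intro exI allI impI)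
        fix m
        have "ennreal c * emeasure lborel (ball y (r / 2)) \<le>
          (\<integral>\<^sup>+ \<omega>. indicator (ball y (r / 2)) (euler b (h / 2 ^ m) (\<lambda>i. incr 0 (h / 2 ^ m) i \<omega>) z (2 ^ m)) \<partial>P)"
          using yR r by (intro c(2) z) auto
        also have "\<dots> \<le> (\<integral>\<^sup>+ \<omega>. ennreal (bump y (r / 2) (euler b (h / 2 ^ m) (\<lambda>i. incr 0 (h / 2 ^ m) i \<omega>) z (2 ^ m))) \<partial>P)"
          by (intro nn_integral_mono bump(4) r2)
        finally show "ennreal c * emeasure lborel (ball y (r / 2)) \<le>
          (\<integral>\<^sup>+ \<omega>. ennreal (bump y (r / 2) (euler b (h / 2 ^ m) (\<lambda>i. incr 0 (h / 2 ^ m) i \<omega>) z (2 ^ m))) \<partial>P)" .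
      qed
      also have "\<dots> \<le> (\<integral>\<^sup>+ \<omega>. indicator (ball y r) (X z h \<omega>) \<partial>P)"
        using bump(5)[OF r2, of y] by (intro nn_integral_mono) simp
      also have "\<dots> = emeasure (kern h z) (ball y r)" using h by (simp add: emeasure_kern)
      finally show "ennreal (c / 2 ^ DIM('v)) * emeasure lborel (ball y r) \<le> emeasure (kern h z) (ball y r)" .
    qed
  qed (use c in simp)
qed

text \<open>Dividing \<open>h\<close> by \<open>Suc n\<close> shrinks
  \<open>h * K * exp (h * K)\<close> at least by that factor. The kernel over \<open>h\<close> can
  then be treated as an iterate of short ones.\<close>

lemma small_step:
  assumes h: "h > 0"
  obtains n h' where "h' > 0" "h' * K * exp (h' * K) \<le> 1/2" "h = real (Suc n) * h'"
proof -
  obtain n :: nat where n: "2 * (h * K * exp (h * K)) \<le> real n" using real_arch_simple by blast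
  define h' where "h' = h / real (Suc n)"
  have h': "h' > 0" "h' \<le> h" "h = real (Suc n) * h'" using h by (auto simp: h'_def field_simps)
  have "h' * K * exp (h' * K) \<le> h' * K * exp (h * K)"
    using h' K by (intro mult_left_mono) (auto simp: mult_right_mono)
  also have "\<dots> = (h * K * exp (h * K)) / real (Suc n)" by (simp add: h'_def)
  also have "\<dots> \<le> (real n / 2) / real (Suc n)" using n by (intro divide_right_mono) auto
  also have "\<dots> \<le> 1/2" by (simp add: field_simps)
  finally show thesis using h' by (intro that[of h' n]) auto
qed

text \<open>The last short step spreads the mass from whatever state was reached before, so its
  constant serves for the whole time \<open>h\<close>.\<close>

lemma kern_ball_le:
  assumes h: "h > 0"
  obtains C where "C > 0" "\<And>z y r. r > 0 \<Longrightarrow> emeasure (kern h z) (ball y r) \<le> ennreal C * emeasure lborel (ball y r)"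
proof -
  obtain n h' where h': "h' > 0" "h' * K * exp (h' * K) \<le> 1/2" "h = real (Suc n) * h'" using small_step[OF h] .
  obtain C where C: "C > 0" "\<And>z y r. r > 0 \<Longrightarrow> emeasure (kern h' z) (ball y r) \<le> ennreal C * emeasure lborel (ball y r)"
    using kern_ball_le_small[OF h'(1,2)] by blast
  show thesis
  proof (rule that[OF C(1)])
    fix z y :: 'v and r :: real assume r: "r > 0"
    interpret k: prob_space "kern (real n * h') z" using h' by (intro prob_space_kern) simp
    have "emeasure (kern h z) (ball y r) = (\<integral>\<^sup>+ u. emeasure (kern h' u) (ball y r) \<partial>kern (real n * h') z)"
      unfolding h'(3) by (rule emeasure_kern_Suc[OF h'(1)]) simp
    also have "\<dots> \<le> (\<integral>\<^sup>+ u. ennreal C * emeasure lborel (ball y r) \<partial>kern (real n * h') z)"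
      by (intro nn_integral_mono C(2) r)
    also have "\<dots> = ennreal C * emeasure lborel (ball y r)" using k.emeasure_space_1 by simp
    finally show "emeasure (kern h z) (ball y r) \<le> ennreal C * emeasure lborel (ball y r)" .
  qed
qed

text \<open>The lower bound has to be carried through all short steps. The path is required to be in
  \<open>ball 0 R\<close> after each of them, so every further step multiplies the constant by
  \<open>c0 * v\<close>, with \<open>v\<close> the volume of that ball.\<close>

lemma kern_minorization:
  assumes h: "h > 0" and R: "R > 0"
  obtains c where "c > 0" "\<And>z A. norm z \<le> R \<Longrightarrow> A \<in> sets borel \<Longrightarrow>
    ennreal c * emeasure lborel (A \<inter> ball 0 R) \<le> emeasure (kern h z) A"
proof -
  obtain n h' where h': "h' > 0" "h' * K * exp (h' * K) \<le> 1/2" "h = real (Suc n) * h'" using small_step[OF h] .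
  obtain c0 where c0: "c0 > 0" "\<And>z A. norm z \<le> R \<Longrightarrow> A \<in> sets borel \<Longrightarrow>
    ennreal c0 * emeasure lborel (A \<inter> ball 0 R) \<le> emeasure (kern h' z) A"
    using kern_minorization_small[OF h'(1,2) R] by blast
  define v where "v = unit_ball_vol (DIM('v)) * R ^ DIM('v)"
  have v: "v > 0" "emeasure lborel (ball (0::'v) R) = ennreal v"
    using R by (auto simp: v_def emeasure_ball)
  have "\<exists>c>0. \<forall>z A. norm z \<le> R \<longrightarrow> A \<in> sets borel \<longrightarrow>
    ennreal c * emeasure lborel (A \<inter> ball 0 R) \<le> emeasure (kern (real (Suc n) * h') z) A" for n
  proof (induction n)
    case 0
    then show ?case using c0 by auto
  next
    case (Suc n)
    then obtain c where c: "c > 0" "\<And>z A. norm z \<le> R \<Longrightarrow> A \<in> sets borel \<Longrightarrow>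
      ennreal c * emeasure lborel (A \<inter> ball 0 R) \<le> emeasure (kern (real (Suc n) * h') z) A" by auto
    show ?case
    proof (intro exI[of _ "c0 * (c * v)"] conjI allI impI)
      fix z :: 'v and A :: "'v set" assume z: "norm z \<le> R" and A: "A \<in> sets borel"
      have "ennreal (c0 * (c * v)) * emeasure lborel (A \<inter> ball 0 R)
        = (ennreal c0 * emeasure lborel (A \<inter> ball 0 R)) * (ennreal c * emeasure lborel (ball 0 R \<inter> ball (0::'v) R))"
        using c0 c v by (simp add: ennreal_mult mult_ac)
      also have "\<dots> \<le> (ennreal c0 * emeasure lborel (A \<inter> ball 0 R)) * emeasure (kern (real (Suc n) * h') z) (ball 0 R)"
        by (intro mult_left_mono c(2) z) auto
      also have "\<dots> = (\<integral>\<^sup>+ y. (ennreal c0 * emeasure lborel (A \<inter> ball 0 R)) * indicator (ball 0 R) y \<partial>kern (real (Suc n) * h') z)"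
        by (intro nn_integral_cmult_indicator[symmetric]) simp
      also have "\<dots> \<le> (\<integral>\<^sup>+ y. emeasure (kern h' y) A \<partial>kern (real (Suc n) * h') z)"
        using c0(2)[OF _ A] by (intro nn_integral_mono) (auto simp: indicator_def)
      also have "\<dots> = emeasure (kern (real (Suc (Suc n)) * h') z) A"
        by (rule emeasure_kern_Suc[OF h'(1) A, symmetric])
      finally show "ennreal (c0 * (c * v)) * emeasure lborel (A \<inter> ball 0 R) \<le> emeasure (kern (real (Suc (Suc n)) * h') z) A" .
    qed (use c c0 v in simp)
  qed
  from this[of n] show thesis using that unfolding h'(3) by blast
qed

end

section \<open>Lyapunov function\<close>

context lipschitz_sde
begin

text \<open>Dissipativity contributes \<open>- 2 * R2 * d\<close> to the coefficient of
  \<open>(norm z)\<^sup>2\<close>. The discretisation error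
  \<open>d\<^sup>2 * (norm (b z))\<^sup>2\<close> is also quadratic in \<open>z\<close>, but for
  small \<open>d\<close> it gives back at most \<open>R2 * d\<close>, so half of the dissipation
  remains.\<close>

lemma euler_drift_norm:
  assumes R2: "R2 > 0" and AD: "\<And>x. inner (b x) x \<le> R1 - R2 * (norm x)\<^sup>2"
    and d: "0 < d" "d \<le> 1" "2 * d * K\<^sup>2 \<le> R2"
  shows "(norm (z + d *\<^sub>R b z))\<^sup>2 \<le> (1 - R2 * d) * (norm z)\<^sup>2 + d * (2 * \<bar>R1\<bar> + 2 * (norm (b 0))\<^sup>2)"
proof -
  have "(norm (b z))\<^sup>2 \<le> (norm (b 0) + K * norm z)\<^sup>2"
  proof (rule power_mono)
    have "norm (b z) \<le> norm (b 0) + norm (b z - b 0)" by (rule norm_triangle_sub)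
    then show "norm (b z) \<le> norm (b 0) + K * norm z" using lip[of z 0] by simp
  qed simp
  also have "\<dots> \<le> 2 * (norm (b 0))\<^sup>2 + 2 * (K * norm z)\<^sup>2"
    using sum_squares_ge_zero[of "norm (b 0) - K * norm z" 0] by (simp add: power2_eq_square algebra_simps)
  finally have bz: "(norm (b z))\<^sup>2 \<le> 2 * (norm (b 0))\<^sup>2 + 2 * K\<^sup>2 * (norm z)\<^sup>2"
    by (simp add: power_mult_distrib)
  have "d\<^sup>2 * (norm (b z))\<^sup>2 \<le> d * (d * (2 * (norm (b 0))\<^sup>2 + 2 * K\<^sup>2 * (norm z)\<^sup>2))"
    unfolding power2_eq_square[of d] mult.assoc using bz d by (intro mult_left_mono) (auto simp: mult.assoc)
  also have "d * (2 * (norm (b 0))\<^sup>2 + 2 * K\<^sup>2 * (norm z)\<^sup>2) \<le> 2 * (norm (b 0))\<^sup>2 + R2 * (norm z)\<^sup>2"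
  proof -
    have "d * (2 * (norm (b 0))\<^sup>2) \<le> 1 * (2 * (norm (b 0))\<^sup>2)" using d by (intro mult_right_mono) auto
    moreover have "(2 * d * K\<^sup>2) * (norm z)\<^sup>2 \<le> R2 * (norm z)\<^sup>2" using d by (intro mult_right_mono) auto
    ultimately show ?thesis by (simp add: algebra_simps)
  qed
  finally have 1: "d\<^sup>2 * (norm (b z))\<^sup>2 \<le> d * (2 * (norm (b 0))\<^sup>2 + R2 * (norm z)\<^sup>2)" using d by simp
  have "(norm (z + d *\<^sub>R b z))\<^sup>2 = (norm z)\<^sup>2 + 2 * d * inner (b z) z + d\<^sup>2 * (norm (b z))\<^sup>2"
    by (simp add: power2_norm_eq_inner inner_add_left inner_add_right inner_commute power2_eq_square[of d] algebra_simps)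
  also have "\<dots> \<le> (norm z)\<^sup>2 + 2 * d * (\<bar>R1\<bar> - R2 * (norm z)\<^sup>2) + d * (2 * (norm (b 0))\<^sup>2 + R2 * (norm z)\<^sup>2)"
    using AD[of z] d by (intro add_mono mult_left_mono 1 order.refl) auto
  also have "\<dots> = (1 - R2 * d) * (norm z)\<^sup>2 + d * (2 * \<bar>R1\<bar> + 2 * (norm (b 0))\<^sup>2)"
    by (simp add: algebra_simps)
  finally show ?thesis .
qed

text \<open>Integrating the last increment first gives the recursion
  \<open>x \<mapsto> (1 - R2 * d) * x + d * c\<close>. Its fixed point \<open>c / R2\<close> does
  not depend on \<open>d\<close>, so the bound does not deteriorate as the mesh shrinks.\<close>

lemma euler_second_moment:
  fixes c :: real
  assumes d: "d > 0" and R2: "R2 > 0" "R2 * d \<le> 1" and c: "c \<ge> 0"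
    and step: "\<And>z. (norm (z + d *\<^sub>R b z))\<^sup>2 + 4 * 2 powr (DIM('v) / 2) * d \<le> (1 - R2 * d) * (norm z)\<^sup>2 + d * c"
  shows "(\<integral>\<^sup>+ \<xi>. ennreal ((norm (euler b d \<xi> z k))\<^sup>2) \<partial>(\<Pi>\<^sub>M i\<in>{..<k}. gauss d))
    \<le> ennreal ((1 - R2 * d) ^ k * (norm z)\<^sup>2 + c / R2)"
proof (induction k)
  case 0
  then show ?case using c R2 by (simp add: PiM_empty nn_integral_count_space_finite ennreal_leI)
next
  case (Suc k)
  interpret Q: product_sigma_finite "\<lambda>_::nat. gauss d :: 'v measure"
    by (intro product_sigma_finite.intro prob_space_imp_sigma_finite prob_space_gauss d)
  interpret G: prob_space "\<Pi>\<^sub>M i\<in>{..<k}. (gauss d :: 'v measure)"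
    by (intro prob_space_PiM prob_space_gauss d)
  define \<rho> where "\<rho> = 1 - R2 * d"
  have \<rho>: "\<rho> \<ge> 0" using R2 by (simp add: \<rho>_def)
  let ?E = "\<lambda>\<xi>. euler b d \<xi> z k"
  have sets_eq: "sets (\<Pi>\<^sub>M i\<in>I. (gauss d :: 'v measure)) = sets (\<Pi>\<^sub>M i\<in>I. (borel :: 'v measure))" for I :: "nat set"
    by (intro sets_PiM_cong) auto
  have E: "(\<lambda>\<xi>. euler b d \<xi> z j) \<in> borel_measurable (\<Pi>\<^sub>M i\<in>I. gauss d)" if "{..<j} \<subseteq> I" for j and I :: "nat set"
    unfolding measurable_cong_sets[OF sets_eq refl]
    using that by (intro borel_measurable_euler b_measurable measurable_component_singleton) auto
  have s: "{..<Suc k} = insert k {..<k}" by auto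
  have upd: "euler b d (\<xi>(k := y)) z (Suc k) = (?E \<xi> + d *\<^sub>R b (?E \<xi>)) + y" for \<xi> y
  proof -
    have "euler b d (\<xi>(k := y)) z k = ?E \<xi>" by (rule euler_cong) simp
    then show ?thesis by simp
  qed
  have meas: "(\<lambda>\<xi>. ennreal ((norm (euler b d \<xi> z (Suc k)))\<^sup>2)) \<in> borel_measurable (\<Pi>\<^sub>M i\<in>insert k {..<k}. gauss d)"
  proof (rule measurable_compose[OF E])
    show "(\<lambda>y :: 'v. ennreal ((norm y)\<^sup>2)) \<in> borel_measurable borel" by simp
  qed auto
  have "(\<integral>\<^sup>+ \<xi>. ennreal ((norm (euler b d \<xi> z (Suc k)))\<^sup>2) \<partial>(\<Pi>\<^sub>M i\<in>{..<Suc k}. gauss d))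
    = (\<integral>\<^sup>+ \<xi>. \<integral>\<^sup>+ y. ennreal ((norm (euler b d (\<xi>(k := y)) z (Suc k)))\<^sup>2) \<partial>gauss d \<partial>(\<Pi>\<^sub>M i\<in>{..<k}. gauss d))"
    unfolding s by (rule Q.product_nn_integral_insert[OF _ _ meas]) auto
  also have "\<dots> \<le> (\<integral>\<^sup>+ \<xi>. ennreal \<rho> * ennreal ((norm (?E \<xi>))\<^sup>2) + ennreal (d * c) \<partial>(\<Pi>\<^sub>M i\<in>{..<k}. gauss d))"
  proof (rule nn_integral_mono)
    fix \<xi> :: "nat \<Rightarrow> 'v"
    have "(\<integral>\<^sup>+ y. ennreal ((norm (euler b d (\<xi>(k := y)) z (Suc k)))\<^sup>2) \<partial>gauss d)
      \<le> ennreal ((norm (?E \<xi> + d *\<^sub>R b (?E \<xi>)))\<^sup>2 + 4 * 2 powr (DIM('v) / 2) * d)"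
      unfolding upd by (rule nn_integral_gauss_norm_square_add[OF d])
    also have "\<dots> \<le> ennreal (\<rho> * (norm (?E \<xi>))\<^sup>2 + d * c)" unfolding \<rho>_def by (intro ennreal_leI step)
    also have "\<dots> = ennreal \<rho> * ennreal ((norm (?E \<xi>))\<^sup>2) + ennreal (d * c)"
      using \<rho> d c by (simp add: ennreal_mult)
    finally show "(\<integral>\<^sup>+ y. ennreal ((norm (euler b d (\<xi>(k := y)) z (Suc k)))\<^sup>2) \<partial>gauss d)
      \<le> ennreal \<rho> * ennreal ((norm (?E \<xi>))\<^sup>2) + ennreal (d * c)" .
  qed
  also have "\<dots> = ennreal \<rho> * (\<integral>\<^sup>+ \<xi>. ennreal ((norm (?E \<xi>))\<^sup>2) \<partial>(\<Pi>\<^sub>M i\<in>{..<k}. gauss d)) + ennreal (d * c)"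
  proof -
    have [measurable]: "?E \<in> borel_measurable (\<Pi>\<^sub>M i\<in>{..<k}. gauss d)" by (rule E) simp
    show ?thesis using G.emeasure_space_1 by (subst nn_integral_add) (simp_all add: nn_integral_cmult)
  qed
  also have "\<dots> \<le> ennreal \<rho> * ennreal (\<rho> ^ k * (norm z)\<^sup>2 + c / R2) + ennreal (d * c)"
    using Suc unfolding \<rho>_def by (intro add_right_mono mult_left_mono) auto
  also have "\<dots> = ennreal (\<rho> * (\<rho> ^ k * (norm z)\<^sup>2 + c / R2) + d * c)"
    using \<rho> c R2 d by (simp add: ennreal_mult[symmetric] ennreal_plus[symmetric] del: ennreal_plus)
  also have "\<rho> * (\<rho> ^ k * (norm z)\<^sup>2 + c / R2) + d * c = \<rho> ^ Suc k * (norm z)\<^sup>2 + c / R2"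
    using R2 by (simp add: \<rho>_def field_simps)
  finally show ?case unfolding \<rho>_def .
qed

text \<open>The moment bounds of the schemes pass to \<open>X\<close> by Fatou's lemma, which needs
  no uniform integrability. The contraction survives because \<open>(1 - R2 * d) ^ (2 ^ m)\<close>
  is at most \<open>exp (- (R2 * h))\<close> when \<open>d = h / 2 ^ m\<close>.\<close>

lemma kern_lyapunov:
  assumes R2: "R2 > 0" and AD: "\<And>x. inner (b x) x \<le> R1 - R2 * (norm x)\<^sup>2" and h: "h > 0"
  obtains L where "L \<ge> 0"
    "\<And>z. (\<integral>\<^sup>+ y. ennreal ((norm y)\<^sup>2) \<partial>kern h z) \<le> ennreal (exp (- (R2 * h)) * (norm z)\<^sup>2 + L)"
proof -
  define c where "c = 2 * \<bar>R1\<bar> + 2 * (norm (b 0))\<^sup>2 + 4 * 2 powr (DIM('v) / 2)"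
  have c: "c \<ge> 0" by (simp add: c_def)
  define d where "d m = h / 2 ^ m" for m :: nat
  have d0: "d \<longlonglongrightarrow> h * 0"
  proof -
    have "(\<lambda>m. h * (1 / 2) ^ m) \<longlonglongrightarrow> h * 0" by (intro tendsto_mult_left LIMSEQ_power_zero) simp
    then show ?thesis by (simp add: d_def[abs_def] power_one_over)
  qed
  have dpos: "d m > 0" for m using h by (simp add: d_def)
  \<comment> \<open>The three entries ensure \<open>d \<le> 1\<close>, \<open>R2 * d \<le> 1\<close>
    and \<open>2 * d * K\<^sup>2 \<le> R2\<close>; the added 1 keeps the denominator positive for
    \<open>K = 0\<close>.\<close>
  define \<delta> where "\<delta> = min 1 (min (1 / R2) (R2 / (2 * K\<^sup>2 + 1)))"
  have \<delta>: "\<delta> > 0" using R2 by (simp add: \<delta>_def add_nonneg_pos)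
  have ev: "\<forall>\<^sub>F m in sequentially. d m < \<delta>" using d0 \<delta> by (auto dest: order_tendstoD)
  show thesis
  proof (rule that[of "c / R2"])
    fix z :: 'v
    define B where "B = ennreal (exp (- (R2 * h)) * (norm z)\<^sup>2 + c / R2)"
    let ?e = "\<lambda>m \<omega>. euler b (d m) (\<lambda>i. incr 0 (d m) i \<omega>) z (2 ^ m)"
    have [measurable]: "?e m \<in> borel_measurable P" for m
      using dpos[of m] by (intro borel_measurable_euler b_measurable incr_measurable) auto
    have evB: "\<forall>\<^sub>F m in sequentially. (\<integral>\<^sup>+ \<omega>. ennreal ((norm (?e m \<omega>))\<^sup>2) \<partial>P) \<le> B"
      using ev
    proof eventually_elim
      case (elim m)
      have dm: "d m \<le> 1" "R2 * d m \<le> 1" "2 * d m * K\<^sup>2 \<le> R2"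
      proof -
        show "d m \<le> 1" using elim by (simp add: \<delta>_def)
        have "d m \<le> 1 / R2" "d m \<le> R2 / (2 * K\<^sup>2 + 1)" using elim by (auto simp: \<delta>_def)
        moreover have "2 * K\<^sup>2 + 1 > 0" by (simp add: add_nonneg_pos)
        ultimately have "d m * R2 \<le> 1" "d m * (2 * K\<^sup>2 + 1) \<le> R2" using R2 by (simp_all add: pos_le_divide_eq)
        then show "R2 * d m \<le> 1" "2 * d m * K\<^sup>2 \<le> R2" using dpos[of m] by (simp_all add: algebra_simps)
      qed
      have "(\<integral>\<^sup>+ \<omega>. ennreal ((norm (?e m \<omega>))\<^sup>2) \<partial>P)
        = (\<integral>\<^sup>+ \<xi>. ennreal ((norm (euler b (d m) \<xi> z (2 ^ m)))\<^sup>2) \<partial>(\<Pi>\<^sub>M i\<in>{..<2 ^ m}. gauss (d m)))"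
        using dpos[of m] by (intro nn_integral_euler[where f="\<lambda>y. ennreal ((norm y)\<^sup>2)"]) auto
      also have "\<dots> \<le> ennreal ((1 - R2 * d m) ^ (2 ^ m) * (norm z)\<^sup>2 + c / R2)"
      proof (rule euler_second_moment[OF dpos R2 dm(2) c])
        show "(norm (x + d m *\<^sub>R b x))\<^sup>2 + 4 * 2 powr (DIM('v) / 2) * d m \<le> (1 - R2 * d m) * (norm x)\<^sup>2 + d m * c" for x
          using euler_drift_norm[OF R2 AD dpos dm(1,3), of x] by (simp add: c_def algebra_simps)
      qed
      also have "\<dots> \<le> B"
      proof -
        have "(1 - R2 * d m) ^ (2 ^ m) \<le> exp (- (R2 * d m)) ^ (2 ^ m)"
          using exp_ge_add_one_self[of "- (R2 * d m)"] dm(2) by (intro power_mono) auto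
        also have "\<dots> = exp (real (2 ^ m) * (- (R2 * d m)))" by (rule exp_of_nat_mult[symmetric])
        also have "real (2 ^ m) * (- (R2 * d m)) = - (R2 * h)" by (simp add: d_def)
        finally show ?thesis unfolding B_def by (intro ennreal_leI add_right_mono mult_right_mono) auto
      qed
      finally show ?case .
    qed
    have "(\<integral>\<^sup>+ y. ennreal ((norm y)\<^sup>2) \<partial>kern h z) = (\<integral>\<^sup>+ \<omega>. ennreal ((norm (X z h \<omega>))\<^sup>2) \<partial>P)"
      using h by (intro nn_integral_kern) auto
    also have "\<dots> = (\<integral>\<^sup>+ \<omega>. liminf (\<lambda>m. ennreal ((norm (?e m \<omega>))\<^sup>2)) \<partial>P)"
    proof (rule nn_integral_cong)
      fix \<omega> assume "\<omega> \<in> space P"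
      then have "(\<lambda>m. ?e m \<omega>) \<longlonglongrightarrow> X z h \<omega>" using euler_tendsto_start[of \<omega> h z 1] h by (simp add: d_def)
      then have "(\<lambda>m. ennreal ((norm (?e m \<omega>))\<^sup>2)) \<longlonglongrightarrow> ennreal ((norm (X z h \<omega>))\<^sup>2)"
        by (intro tendsto_ennrealI tendsto_intros)
      then show "ennreal ((norm (X z h \<omega>))\<^sup>2) = liminf (\<lambda>m. ennreal ((norm (?e m \<omega>))\<^sup>2))"
        by (intro lim_imp_Liminf[symmetric]) auto
    qed
    also have "\<dots> \<le> liminf (\<lambda>m. \<integral>\<^sup>+ \<omega>. ennreal ((norm (?e m \<omega>))\<^sup>2) \<partial>P)"
      by (rule nn_integral_liminf) simp
    also have "\<dots> \<le> limsup (\<lambda>m. \<integral>\<^sup>+ \<omega>. ennreal ((norm (?e m \<omega>))\<^sup>2) \<partial>P)" by (rule Liminf_le_Limsup) simp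
    also have "\<dots> \<le> B" by (rule Limsup_bounded[OF evB])
    finally show "(\<integral>\<^sup>+ y. ennreal ((norm y)\<^sup>2) \<partial>kern h z) \<le> ennreal (exp (- (R2 * h)) * (norm z)\<^sup>2 + c / R2)"
      unfolding B_def .
  qed (use c R2 in simp)
qed

lemma kern_mixing:
  assumes R2: "R2 > 0" and AD: "\<And>x. inner (b x) x \<le> R1 - R2 * (norm x)\<^sup>2" and h: "h > 0"
    and \<mu>: "prob_space \<mu>" "sets \<mu> = sets borel"
    and inv: "\<And>g. g \<in> unit_funs \<Longrightarrow> (\<integral>y. markov_kernel.Q (kern h) g y \<partial>\<mu>) = (\<integral>y. g y \<partial>\<mu>)"
  obtains e where
    "\<And>m g y. g \<in> unit_funs \<Longrightarrow> \<bar>(markov_kernel.Q (kern h) ^^ m) g y - (\<integral>y. g y \<partial>\<mu>)\<bar> \<le> e m y" "\<And>m. integrable \<mu> (e m)"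
    "(\<lambda>m. \<integral>y. e m y \<partial>\<mu>) \<longlonglongrightarrow> 0" "\<And>v. \<exists>\<eta>. \<eta> \<longlonglongrightarrow> 0 \<and> (\<forall>m y. norm y \<le> v \<longrightarrow> e m y \<le> (\<eta> m :: real))"
proof -
  interpret k: markov_kernel "kern h" using h by (intro markov_kernel_kern) simp
  obtain L where L: "L \<ge> 0"
    "\<And>z. (\<integral>\<^sup>+ y. ennreal ((norm y)\<^sup>2) \<partial>kern h z) \<le> ennreal (exp (- (R2 * h)) * (norm z)\<^sup>2 + L)"
    using kern_lyapunov[OF R2 AD h] by blast
  define V where "V z = (norm z)\<^sup>2" for z :: 'v
  have V_int: "integrable (kern h z) V" for z
    unfolding V_def[abs_def] using L(2)[of z] by (intro integrableI_nonneg) (auto simp: le_less_trans[OF _ ennreal_less_top])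
  have drift: "(\<integral>y. V y \<partial>kern h z) \<le> exp (- (R2 * h)) * V z + L" for z
  proof -
    have "ennreal (\<integral>y. V y \<partial>kern h z) = (\<integral>\<^sup>+ y. ennreal (V y) \<partial>kern h z)"
      by (rule nn_integral_eq_integral[symmetric, OF V_int]) (simp add: V_def)
    also have "\<dots> \<le> ennreal (exp (- (R2 * h)) * V z + L)" using L(2) by (simp add: V_def)
    finally have "ennreal (\<integral>y. V y \<partial>kern h z) \<le> ennreal (exp (- (R2 * h)) * V z + L)" .
    moreover have "0 \<le> exp (- (R2 * h)) * V z + L" using L(1) by (simp add: V_def)
    ultimately show ?thesis by (simp only: ennreal_le_iff)
  qed
  have minor: "\<exists>\<nu>. finite_measure \<nu> \<and> sets \<nu> = sets borel \<and> measure \<nu> UNIV > 0 \<and>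
      (\<forall>y. V y \<le> r \<longrightarrow> (\<forall>A \<in> sets borel. emeasure \<nu> A \<le> emeasure (kern h y) A))" for r
  proof -
    \<comment> \<open>The closed ball of this radius contains the sublevel set of \<open>V\<close>,
      and the maximum with 1 gives the minorising measure positive mass for every
      \<open>r\<close>.\<close>
    define R where "R = max 1 (sqrt \<bar>r\<bar>)"
    have R: "R > 0" by (simp add: R_def)
    obtain c where c: "c > 0" "\<And>z A. norm z \<le> R \<Longrightarrow> A \<in> sets borel \<Longrightarrow>
      ennreal c * emeasure lborel (A \<inter> ball 0 R) \<le> emeasure (kern h z) A"
      using kern_minorization[OF h R] by blast
    define \<nu> where "\<nu> = density lborel (\<lambda>y :: 'v. ennreal c * indicator (ball 0 R) y)"
    have \<nu>A: "emeasure \<nu> A = ennreal c * emeasure lborel (A \<inter> ball 0 R)" if [measurable]: "A \<in> sets borel" for A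
    proof -
      have "emeasure \<nu> A = (\<integral>\<^sup>+ y. ennreal c * indicator (A \<inter> ball 0 R) y \<partial>lborel)"
        unfolding \<nu>_def by (subst emeasure_density) (auto intro!: nn_integral_cong simp: indicator_def)
      also have "\<dots> = ennreal c * emeasure lborel (A \<inter> ball 0 R)" by (rule nn_integral_cmult_indicator) simp
      finally show ?thesis .
    qed
    have \<nu>U: "emeasure \<nu> UNIV = ennreal (c * (unit_ball_vol (DIM('v)) * R ^ DIM('v)))"
      using R c by (subst \<nu>A) (auto simp: emeasure_ball ennreal_mult)
    show ?thesis
    proof (intro exI[of _ \<nu>] conjI allI impI ballI)
      show "sets \<nu> = sets borel" by (simp add: \<nu>_def)
      have "space \<nu> = UNIV" by (simp add: \<nu>_def)
      then show "finite_measure \<nu>" using \<nu>U by (intro finite_measureI) simp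
      show "measure \<nu> UNIV > 0" using \<nu>U c R by (simp add: measure_def)
      fix y :: 'v and A :: "'v set" assume "V y \<le> r" and A: "A \<in> sets borel"
      then have "(norm y)\<^sup>2 \<le> \<bar>r\<bar>" by (simp add: V_def)
      then have "norm y \<le> sqrt \<bar>r\<bar>" by (rule real_le_rsqrt)
      then have "norm y \<le> R" by (simp add: R_def)
      then show "emeasure \<nu> A \<le> emeasure (kern h y) A" using c(2) A by (simp add: \<nu>A)
    qed
  qed
  obtain e where e: "\<And>m g y. g \<in> unit_funs \<Longrightarrow> \<bar>(k.Q ^^ m) g y - (\<integral>y. g y \<partial>\<mu>)\<bar> \<le> e m y" "\<And>m. integrable \<mu> (e m)"
    "(\<lambda>m. \<integral>y. e m y \<partial>\<mu>) \<longlonglongrightarrow> 0" "\<And>v. \<exists>\<eta>. \<eta> \<longlonglongrightarrow> 0 \<and> (\<forall>m y. V y \<le> v \<longrightarrow> e m y \<le> (\<eta> m :: real))"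
  proof (rule k.harris_mixing[OF _ _ V_int drift _ _ L(1) minor \<mu> inv])
    show "V \<in> borel_measurable borel" unfolding V_def[abs_def] by simp
  qed (use R2 h in \<open>auto simp: V_def\<close>)
  show thesis
  proof (rule that[OF e(1,2,3)])
    fix v :: real
    obtain \<eta> where \<eta>: "\<eta> \<longlonglongrightarrow> 0" "\<And>m y. V y \<le> v\<^sup>2 \<Longrightarrow> e m y \<le> \<eta> m" using e(4) by blast
    have "e m y \<le> \<eta> m" if "norm y \<le> v" for m y
      using that by (intro \<eta>(2)) (simp add: V_def power_mono)
    then show "\<exists>\<eta>. \<eta> \<longlonglongrightarrow> 0 \<and> (\<forall>m y. norm y \<le> v \<longrightarrow> e m y \<le> \<eta> m)" using \<eta>(1) by blast
  qed
qed

end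

section \<open>Poisson limit for the diffusion\<close>

context lipschitz_sde
begin

text \<open>The filtration knows the starting point from time 0 on. For a fixed start
  \<open>x\<close>, the slice of an event of the past lies in \<open>filt h j\<close> and
  \<open>markov_step\<close> applies; Fubini's theorem then integrates over the starting
  points.\<close>

lemma stationary_chain:
  assumes h: "h > 0" and inv: "invariant_measure P X \<mu>"
  shows "stationary_markov_chain (kern h) (P \<Otimes>\<^sub>M \<mu>) (\<lambda>j. filt h j \<Otimes>\<^sub>M borel) (\<lambda>j (\<omega>, x). X x (real j * h) \<omega>) \<mu>"
proof -
  interpret \<mu>: prob_space \<mu> using inv by (simp add: invariant_measure_def)
  have s\<mu> [measurable_cong]: "sets \<mu> = sets borel" using inv by (simp add: invariant_measure_def)
  interpret M: pair_prob_space P \<mu> ..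
  interpret k: markov_kernel "kern h" using h by (intro markov_kernel_kern) simp
  have space\<mu>: "space \<mu> = UNIV" using sets_eq_imp_space_eq[OF s\<mu>] by simp
  have setsM: "sets (P \<Otimes>\<^sub>M \<mu>) = sets (P \<Otimes>\<^sub>M borel)" by (rule sets_pair_measure_cong[OF refl s\<mu>])
  have Fsub: "sets (filt h j \<Otimes>\<^sub>M (borel :: 'v measure)) \<subseteq> sets (filt' \<Otimes>\<^sub>M borel)"
    if "sets (filt h j) \<subseteq> sets filt'" "space filt' = space P" for j and filt' :: "'a measure"
  proof -
    have id: "(\<lambda>\<omega>. \<omega>) \<in> measurable filt' (filt h j)" using that by (auto intro!: measurableI)
    have "(\<lambda>p. (fst p, snd p)) \<in> measurable (filt' \<Otimes>\<^sub>M borel) (filt h j \<Otimes>\<^sub>M (borel :: 'v measure))"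
      by (intro measurable_Pair measurable_compose[OF measurable_fst id] measurable_snd)
    then have m: "(\<lambda>p. p) \<in> measurable (filt' \<Otimes>\<^sub>M borel) (filt h j \<Otimes>\<^sub>M (borel :: 'v measure))" by simp
    show ?thesis
    proof
      fix A assume A: "A \<in> sets (filt h j \<Otimes>\<^sub>M (borel :: 'v measure))"
      have "A \<subseteq> space P \<times> UNIV" using sets.sets_into_space[OF A] by (simp add: space_pair_measure)
      then have "(\<lambda>p. p) -` A \<inter> space (filt' \<Otimes>\<^sub>M borel) = A" by (auto simp: space_pair_measure that(2))
      then show "A \<in> sets (filt' \<Otimes>\<^sub>M borel)" using measurable_sets[OF m A] by simp
    qed
  qed
  have FP: "sets (filt h j \<Otimes>\<^sub>M (borel :: 'v measure)) \<subseteq> sets (P \<Otimes>\<^sub>M \<mu>)" for j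
    unfolding setsM using h by (intro Fsub sets_filt_subset) auto
  show ?thesis
  proof (intro stationary_markov_chain.intro stationary_markov_chain_axioms.intro k.markov_kernel_axioms M.prob_space_axioms)
    show "sets (filt h j \<Otimes>\<^sub>M borel) \<subseteq> sets (P \<Otimes>\<^sub>M \<mu>)" for j by (rule FP)
    show "space (filt h j \<Otimes>\<^sub>M borel) = space (P \<Otimes>\<^sub>M \<mu>)" for j by (simp add: space_pair_measure space\<mu>)
    show "sets (filt h j \<Otimes>\<^sub>M borel) \<subseteq> sets (filt h (Suc j) \<Otimes>\<^sub>M (borel :: 'v measure))" for j
      using h by (intro Fsub sets_filt_mono) auto
    show "(\<lambda>(\<omega>, x). X x (real j * h) \<omega>) \<in> borel_measurable (filt h j \<Otimes>\<^sub>M borel)" for j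
      using h by (intro X_measurable_filt_pair) simp
    show "distr (P \<Otimes>\<^sub>M \<mu>) borel (\<lambda>(\<omega>, x). X x (real j * h) \<omega>) = \<mu>" for j
      using inv h by (simp add: invariant_measure_def)
    fix j and A :: "('a \<times> 'v) set" and g :: "'v \<Rightarrow> real"
    assume A: "A \<in> sets (filt h j \<Otimes>\<^sub>M borel)" and g: "g \<in> unit_funs"
    note gm [measurable] = unit_funsD(1)[OF g]
    have AM [measurable]: "A \<in> sets (P \<Otimes>\<^sub>M \<mu>)" using A FP by auto
    have Qm [measurable]: "k.Q g \<in> borel_measurable borel" by (rule unit_funsD(1)[OF k.Q_unit_funs[OF g]])
    have Ym: "(\<lambda>p. X (snd p) (real i * h) (fst p)) \<in> borel_measurable (P \<Otimes>\<^sub>M \<mu>)" for i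
      using X_measurable_pair[of "real i * h"] h by (simp add: split_beta' measurable_cong_sets[OF setsM refl])
    have QX: "ennreal (k.Q g y) = (\<integral>\<^sup>+ \<omega>'. ennreal (g (X y h \<omega>')) \<partial>P)" for y
    proof -
      have "integrable P (\<lambda>\<omega>'. g (X y h \<omega>'))" using h by (intro integrable_unit_fun[OF g]) simp
      then have "(\<integral>\<^sup>+ \<omega>'. ennreal (g (X y h \<omega>')) \<partial>P) = ennreal (\<integral>\<omega>'. g (X y h \<omega>') \<partial>P)"
        by (rule nn_integral_eq_integral) (simp add: unit_funsD(2)[OF g])
      then show ?thesis using h by (simp add: k.Q_def integral_kern)
    qed
    have fub: "(\<integral>\<^sup>+ p. ennreal (indicator A p * f (X (snd p) (real i * h) (fst p))) \<partial>(P \<Otimes>\<^sub>M \<mu>))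
      = (\<integral>\<^sup>+ x. \<integral>\<^sup>+ \<omega>. indicator ((\<lambda>\<omega>. (\<omega>, x)) -` A) \<omega> * ennreal (f (X x (real i * h) \<omega>)) \<partial>P \<partial>\<mu>)"
      if f: "f \<in> unit_funs" for f i
    proof -
      note [measurable] = unit_funsD(1)[OF f] Ym[of i]
      have "(\<lambda>p. ennreal (indicator A p * f (X (snd p) (real i * h) (fst p)))) \<in> borel_measurable (P \<Otimes>\<^sub>M \<mu>)"
        by measurable
      from M.nn_integral_snd[OF this, symmetric] show ?thesis
        by (simp add: indicator_def if_distrib[where f=ennreal] cong: if_cong)
          (intro nn_integral_cong, simp add: indicator_def)
    qed
    have "(\<integral>\<^sup>+ p. ennreal (indicator A p * g (X (snd p) (real (Suc j) * h) (fst p))) \<partial>(P \<Otimes>\<^sub>M \<mu>))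
      = (\<integral>\<^sup>+ p. ennreal (indicator A p * k.Q g (X (snd p) (real j * h) (fst p))) \<partial>(P \<Otimes>\<^sub>M \<mu>))"
      unfolding fub[OF g] fub[OF k.Q_unit_funs[OF g]] QX
    proof (rule nn_integral_cong)
      fix x
      have "(\<lambda>\<omega>. (\<omega>, x)) -` A \<in> sets (filt h j)" using sets_Pair2[OF A] .
      then show "(\<integral>\<^sup>+ \<omega>. indicator ((\<lambda>\<omega>. (\<omega>, x)) -` A) \<omega> * ennreal (g (X x (real (Suc j) * h) \<omega>)) \<partial>P)
        = (\<integral>\<^sup>+ \<omega>. indicator ((\<lambda>\<omega>. (\<omega>, x)) -` A) \<omega> * (\<integral>\<^sup>+ \<omega>'. ennreal (g (X (X x (real j * h) \<omega>) h \<omega>')) \<partial>P) \<partial>P)"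
        by (intro markov_step[OF h, where g="\<lambda>y. ennreal (g y)"]) auto
    qed
    then show "(\<integral>p. indicator A p * g ((\<lambda>(\<omega>, x). X x (real (Suc j) * h) \<omega>) p) \<partial>(P \<Otimes>\<^sub>M \<mu>))
      = (\<integral>p. indicator A p * k.Q g ((\<lambda>(\<omega>, x). X x (real j * h) \<omega>) p) \<partial>(P \<Otimes>\<^sub>M \<mu>))"
      using Ym[of j] Ym[of "Suc j"] unit_funsD(2)[OF g] unit_funsD(2)[OF k.Q_unit_funs[OF g]]
      by (subst (1 2) integral_eq_nn_integral) (auto simp: split_beta' simp del: of_nat_Suc)
  qed
qed

end

theorem theorem6:
  fixes P :: "'a measure" and W :: "real \<Rightarrow> 'a \<Rightarrow> 'v::euclidean_space"
    and b :: "'v \<Rightarrow> 'v" and X :: "'v \<Rightarrow> real \<Rightarrow> 'a \<Rightarrow> 'v" and \<mu> :: "'v measure"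
    and K R1 R2 h \<tau> :: real and x0 :: 'v and u :: "nat \<Rightarrow> real"
  assumes BM: "brownian_motion P W"
    and H: "\<And>x y. norm (b x - b y) \<le> K * norm (x - y)"
    and AD: "R2 > 0" "\<And>x. inner (b x) x \<le> R1 - R2 * (norm x)\<^sup>2"
    and sol: "\<And>x. sde_solution P b W x (X x)"
    and inv: "invariant_measure P X \<mu>"
    and ac: "absolutely_continuous lborel \<mu>"
    and h: "h > 0" and tau: "\<tau> > 0"
    and lim: "(\<lambda>n. real n * measure \<mu> (ball x0 (exp (- u n)))) \<longlonglongrightarrow> \<tau>"
  shows "\<forall>k::nat.
     (\<lambda>n. measure (P \<Otimes>\<^sub>M \<mu>)
        {(\<omega>, x) \<in> space (P \<Otimes>\<^sub>M \<mu>).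
           (\<Sum>i = 0..nat \<lfloor>\<tau> / measure \<mu> (ball x0 (exp (- u n)))\<rfloor>.
              indicator (ball x0 (exp (- u n))) (X x (real i * h) \<omega>)) = real k})
     \<longlonglongrightarrow> exp (- \<tau>) * \<tau> ^ k / fact k"
proof
  fix k :: nat
  \<comment> \<open>The locale asks for a nonnegative Lipschitz constant, and \<open>K\<close> may
    be replaced by its absolute value.\<close>
  interpret lipschitz_sde P W b "\<bar>K\<bar>" X
  proof (intro lipschitz_sde.intro brownian.intro lipschitz_sde_axioms.intro BM sol)
    show "norm (b x - b y) \<le> \<bar>K\<bar> * norm (x - y)" for x y
      using H[of x y] mult_right_mono[OF abs_ge_self[of K], of "norm (x - y)"] by simp
  qed simp
  interpret c: stationary_markov_chain "kern h" "P \<Otimes>\<^sub>M \<mu>" "\<lambda>j. filt h j \<Otimes>\<^sub>M borel" "\<lambda>j (\<omega>, x). X x (real j * h) \<omega>" \<mu>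
    by (rule stationary_chain[OF h inv])
  interpret \<mu>: prob_space \<mu> by (rule c.prob_space_\<mu>)
  have space\<mu>: "space \<mu> = UNIV" using sets_eq_imp_space_eq[OF c.sets_\<mu>] by simp
  define B where "B n = ball x0 (exp (- u n))" for n
  define p where "p n = measure \<mu> (B n)" for n
  \<comment> \<open>The sum in the statement includes both ends, so it has one term more than the
    floor.\<close>
  define N where "N n = Suc (nat \<lfloor>\<tau> / p n\<rfloor>)" for n
  have B: "B n \<in> sets borel" for n by (simp add: B_def)
  have np: "(\<lambda>n. real n * p n) \<longlonglongrightarrow> \<tau>" using lim by (simp add: p_def B_def)
  have ppos: "\<forall>\<^sub>F n in sequentially. p n > 0"
    \<comment> \<open>Once \<open>real n * p n\<close> is positive, so is \<open>p n\<close>; this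
      is where \<open>\<tau> > 0\<close> enters.\<close>
    using order_tendstoD(1)[OF np tau]
    by eventually_elim (simp add: zero_less_mult_iff)
  have p0: "p \<longlonglongrightarrow> 0"
  proof -
    have "(\<lambda>n. (real n * p n) * (1 / real n)) \<longlonglongrightarrow> \<tau> * 0" by (intro tendsto_mult np lim_1_over_n)
    moreover have "\<forall>\<^sub>F n in sequentially. (real n * p n) * (1 / real n) = p n"
      using eventually_gt_at_top[of 0] by eventually_elim simp
    ultimately show ?thesis by (simp add: tendsto_cong)
  qed
  have Np: "(\<lambda>n. real (N n) * p n) \<longlonglongrightarrow> \<tau>"
  proof (rule tendsto_sandwich[where f="\<lambda>_. \<tau>" and h="\<lambda>n. \<tau> + p n"])
    have "(\<lambda>n. \<tau> + p n) \<longlonglongrightarrow> \<tau> + 0" by (intro tendsto_intros p0)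
    then show "(\<lambda>n. \<tau> + p n) \<longlonglongrightarrow> \<tau>" by simp
    have N': "real (N n) = real_of_int \<lfloor>\<tau> / p n\<rfloor> + 1" if "p n > 0" for n
    proof -
      have "\<lfloor>\<tau> / p n\<rfloor> \<ge> 0" using tau that by simp
      then show ?thesis by (simp add: N_def)
    qed
    show "\<forall>\<^sub>F n in sequentially. \<tau> \<le> real (N n) * p n"
      using ppos
    proof eventually_elim
      case (elim n)
      have "\<tau> / p n \<le> real (N n)" using N'[OF elim] by linarith
      then show ?case using elim by (simp add: pos_divide_le_eq)
    qed
    show "\<forall>\<^sub>F n in sequentially. real (N n) * p n \<le> \<tau> + p n"
      using ppos
    proof eventually_elim
      case (elim n)
      have "real (N n) \<le> \<tau> / p n + 1" using N'[OF elim] by linarith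
      then have "real (N n) * p n \<le> (\<tau> / p n + 1) * p n" using elim by (intro mult_right_mono) auto
      then show ?case using elim by (simp add: distrib_right)
    qed
  qed simp
  \<comment> \<open>The balls are known to be small only in mass. A concentric ball with more than
    half of the mass contains every \<open>B n\<close> with \<open>p n < 1/2\<close>, which confines
    these to a fixed bounded set.\<close>
  obtain r :: nat where r: "measure \<mu> (ball x0 (real r)) > 1/2"
  proof -
    have "(\<lambda>r. measure \<mu> (ball x0 (real r))) \<longlonglongrightarrow> measure \<mu> (\<Union>r. ball x0 (real r))"
      by (rule \<mu>.finite_Lim_measure_incseq) (auto simp: incseq_def)
    moreover have "(\<Union>r. ball x0 (real r)) = UNIV" using reals_Archimedean2 by auto
    ultimately have "(\<lambda>r. measure \<mu> (ball x0 (real r))) \<longlonglongrightarrow> 1" using \<mu>.prob_space by (simp add: space\<mu>)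
    then have "\<forall>\<^sub>F r in sequentially. measure \<mu> (ball x0 (real r)) > 1/2" by (rule order_tendstoD) simp
    then show thesis using that by (auto simp: eventually_sequentially)
  qed
  define R where "R = norm x0 + real r"
  have r0: "real r > 0" using r by (cases r) auto
  have R: "R > 0" using r0 by (simp add: R_def add_nonneg_pos)
  have sub: "ball x0 (real r) \<subseteq> ball 0 R" by (simp add: R_def ball_subset_ball_iff)
  have R2: "measure \<mu> (ball 0 R) \<ge> 1/2"
    using r \<mu>.finite_measure_mono[OF sub] by (simp add: c.sets_\<mu>)
  have "\<forall>\<^sub>F n in sequentially. p n < 1/2" using p0 by (rule order_tendstoD) simp
  then have small: "\<forall>\<^sub>F n in sequentially. B n \<subseteq> ball x0 (real r)"
  proof eventually_elim
    case (elim n)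
    have "exp (- u n) \<le> real r"
    proof (rule ccontr)
      assume "\<not> exp (- u n) \<le> real r"
      then have "measure \<mu> (ball x0 (real r)) \<le> p n"
        unfolding p_def B_def by (intro \<mu>.finite_measure_mono) auto
      then show False using elim r by simp
    qed
    then show ?case by (auto simp: B_def)
  qed
  obtain C where C: "C > 0" "\<And>z y r. r > 0 \<Longrightarrow> emeasure (kern h z) (ball y r) \<le> ennreal C * emeasure lborel (ball y r)"
    using kern_ball_le[OF h] by blast
  obtain a where a: "a > 0" "\<And>z A. norm z \<le> R \<Longrightarrow> A \<in> sets borel \<Longrightarrow>
    ennreal a * emeasure lborel (A \<inter> ball 0 R) \<le> emeasure (kern h z) A"
    using kern_minorization[OF h R] by blast
  obtain e where e:
    "\<And>m g y. g \<in> unit_funs \<Longrightarrow> \<bar>(c.Q ^^ m) g y - (\<integral>y. g y \<partial>\<mu>)\<bar> \<le> e m y" "\<And>m. integrable \<mu> (e m)"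
    "(\<lambda>m. \<integral>y. e m y \<partial>\<mu>) \<longlonglongrightarrow> 0" "\<And>v. \<exists>\<eta>. \<eta> \<longlonglongrightarrow> 0 \<and> (\<forall>m y. norm y \<le> v \<longrightarrow> e m y \<le> (\<eta> m :: real))"
    by (rule kern_mixing[OF AD h c.prob_space_\<mu> c.sets_\<mu> c.invariant_\<mu>]) auto
  obtain \<eta> where \<eta>: "\<eta> \<longlonglongrightarrow> 0" "\<And>m y. norm y \<le> R \<Longrightarrow> e m y \<le> \<eta> m" using e(4)[of R] by blast
  have Qind: "c.Q (indicator (B n)) y = measure (kern h y) (B n)" for n y
    using B by (simp add: c.Q_def)
  \<comment> \<open>With \<open>l\<close> the Lebesgue measure of \<open>B n\<close>, the kernel
    gives \<open>B n\<close> at most \<open>C * l\<close> from every state and at least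
    \<open>a * l\<close> from \<open>ball 0 R\<close>, whose mass is at least 1/2. By invariance
    \<open>a * l / 2 \<le> p n\<close>, whence the constant \<open>2 * C / a\<close>.\<close>
  have QB: "\<forall>\<^sub>F n in sequentially. \<forall>y. c.Q (indicator (B n)) y \<le> (2 * C / a) * p n"
    using small
  proof eventually_elim
    case (elim n)
    define l where "l = unit_ball_vol (DIM('v)) * exp (- u n) ^ DIM('v)"
    have l: "emeasure lborel (B n) = ennreal l" "l \<ge> 0"
      by (auto simp: l_def B_def emeasure_ball)
    have BR: "B n \<inter> ball 0 R = B n" using elim sub by auto
    have kf: "emeasure (kern h y) (B n) = ennreal (measure (kern h y) (B n))" for y
      using prob_space_kern[of h y] h by (intro finite_measure.emeasure_eq_measure) (simp add: prob_space.finite_measure)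
    have up: "measure (kern h y) (B n) \<le> C * l" for y
    proof -
      have "ennreal (measure (kern h y) (B n)) \<le> ennreal C * ennreal l"
        using C(2)[of "exp (- u n)" y x0] unfolding kf[symmetric] l(1)[symmetric] by (simp add: B_def)
      then show ?thesis using C(1) l(2) by (simp add: ennreal_mult[symmetric])
    qed
    have low: "a * l \<le> measure (kern h y) (B n)" if "y \<in> ball 0 R" for y
    proof -
      have "ennreal a * ennreal l \<le> ennreal (measure (kern h y) (B n))"
        using a(2)[of y "B n"] B that unfolding kf BR l(1) by simp
      then show ?thesis using a(1) l(2) by (simp add: ennreal_mult[symmetric])
    qed
    have iB: "indicator (B n) \<in> unit_funs" by (rule unit_funs_indicator[OF B])
    have "a * l / 2 \<le> a * l * measure \<mu> (ball 0 R)"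
      using R2 a(1) l(2) mult_left_mono[OF R2, of "a * l"] by simp
    also have "\<dots> = (\<integral>y. a * l * indicator (ball 0 R) y \<partial>\<mu>)" by simp
    also have "\<dots> \<le> (\<integral>y. c.Q (indicator (B n)) y \<partial>\<mu>)"
    proof (rule integral_mono)
      show "integrable \<mu> (\<lambda>y. a * l * indicator (ball 0 R) y)" by (simp add: \<mu>.emeasure_eq_measure)
      show "integrable \<mu> (\<lambda>y. c.Q (indicator (B n)) y)"
        using \<mu>.integrable_unit_fun[OF c.Q_unit_funs[OF iB], of "\<lambda>x. x"] by simp
      show "a * l * indicator (ball 0 R) y \<le> c.Q (indicator (B n)) y" for y
        unfolding Qind using low[of y] by (auto simp: indicator_def)
    qed
    also have "\<dots> = p n" using c.invariant_\<mu>[OF iB] B by (simp add: p_def)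
    finally have "l \<le> 2 * p n / a" using a(1) by (simp add: field_simps)
    then have "C * l \<le> C * (2 * p n / a)" using C(1) by (intro mult_left_mono) auto
    then show ?case unfolding Qind using up by (auto intro: order_trans simp: mult_ac)
  qed
  have main: "(\<lambda>n. measure (P \<Otimes>\<^sub>M \<mu>) {q \<in> space (P \<Otimes>\<^sub>M \<mu>). c.visits (B n) 0 (N n) q = k}) \<longlonglongrightarrow> exp (- \<tau>) * \<tau> ^ k / fact k"
  proof (rule c.visits_tendsto_poisson[OF B _ _ _ _ _ QB[unfolded p_def] e(1,2,3) _ \<eta>(1)])
    show "\<forall>\<^sub>F n in sequentially. \<forall>m. \<forall>y\<in>B n. e m y \<le> \<eta> m"
      using small
    proof eventually_elim
      case (elim n)
      then have "norm y \<le> R" if "y \<in> B n" for y using that sub by auto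
      then show ?case using \<eta>(2) by blast
    qed
  qed (use ppos p0 Np tau C a in \<open>auto simp: p_def[abs_def]\<close>)
  have "{(\<omega>, x) \<in> space (P \<Otimes>\<^sub>M \<mu>). (\<Sum>i = 0..nat \<lfloor>\<tau> / measure \<mu> (ball x0 (exp (- u n)))\<rfloor>.
      indicator (ball x0 (exp (- u n))) (X x (real i * h) \<omega>)) = real k}
    = {q \<in> space (P \<Otimes>\<^sub>M \<mu>). c.visits (B n) 0 (N n) q = k}" for n
  proof -
    \<comment> \<open>The real indicators of the statement are casts of the natural-valued ones in
      \<open>visits\<close>, and the closed index range becomes half-open through the
      \<open>Suc\<close> in \<open>N\<close>.\<close>
    have "(\<Sum>i = 0..nat \<lfloor>\<tau> / measure \<mu> (ball x0 (exp (- u n)))\<rfloor>. indicator (ball x0 (exp (- u n))) (X x (real i * h) \<omega>))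
      = real (c.visits (B n) 0 (N n) (\<omega>, x))" for \<omega> x
      unfolding c.visits_def N_def p_def B_def of_nat_sum
      by (intro sum.cong) (auto simp: indicator_def)
    then show ?thesis by auto
  qed
  then show "(\<lambda>n. measure (P \<Otimes>\<^sub>M \<mu>)
        {(\<omega>, x) \<in> space (P \<Otimes>\<^sub>M \<mu>).
           (\<Sum>i = 0..nat \<lfloor>\<tau> / measure \<mu> (ball x0 (exp (- u n)))\<rfloor>.
              indicator (ball x0 (exp (- u n))) (X x (real i * h) \<omega>)) = real k})
     \<longlonglongrightarrow> exp (- \<tau>) * \<tau> ^ k / fact k"
    using main by simp
qed

end
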